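(* The Ising anyons form a tight braided bimonoidal category $\mathcal I^{\mathrm{any}}$, with additive structure the direct sum and multiplicative structure given by the fusion rule, associativity isomorphism and braiding described in the context.
   Context: Ising anyons. $\mathcal I^{\mathrm{any}}$ is the abelian category with objects triples $(m;n;p)$ of nonnegative integers and morphisms triples of complex linear maps $\mathbb C^m\to\mathbb C^{m'}$, $\mathbb C^n\to\mathbb C^{n'}$, $\mathbb C^p\to\mathbb C^{p'}$. Put $0=(0;0;0)$, $\mathbb 1=(1;0;0)$ (vacuum), $\sigma=(0;1;0)$ (non-abelian anyon), $\psi=(0;0;1)$ (fermion); the additive structure is the direct sum $\oplus$. The product $\otimes$ is $\mathbb C$-bilinear on morphisms, preserves direct sums in each variable (the distributivity isomorphisms and multiplicative zeros being the canonical ones of the additive structure), and is determined by the fusion rule: $\mathbb 1$ is the unit, $\sigma\otimes\sigma=\mathbb 1\oplus\psi$, $\sigma\otimes\psi=\sigma=\psi\otimes\sigma$, $\psi\otimes\psi=\mathbb 1$. On simple objects the associativity isomorphism is the identity except in the following cases: $(\sigma\otimes\sigma)\otimes\sigma\to\sigma\otimes(\sigma\otimes\sigma)$, on the two-dimensional $\sigma$-component with bases given by the channels $\mathbb 1,\psi\subset\sigma\otimes\sigma$ (in this order), is $\frac1{\sqrt2}\begin{pmatrix}1&1\\1&-1\end{pmatrix}$; $(\psi\otimes\sigma)\otimes\psi\to\psi\otimes(\sigma\otimes\psi)$ is $-1$; and $(\sigma\otimes\psi)\otimes\sigma\to\sigma\otimes(\psi\otimes\sigma)$ is $1$ on the $\mathbb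 1$-component and $-1$ on the $\psi$-component. With $w=e^{\pi i/8}$, the braiding on simple objects is the identity when one of them is $\mathbb 1$; on $\sigma\otimes\sigma$ it is $w^{-1}$ on the $\mathbb 1$-component and $w^3$ on the $\psi$-component; $\sigma\otimes\psi\to\psi\otimes\sigma$ and $\psi\otimes\sigma\to\sigma\otimes\psi$ are $w^{-4}=-i$; and on $\psi\otimes\psi$ it is $-1$. Both are extended to all objects by naturality and additivity. Write $AB$ for $A\otimes B$; $\otimes$ binds tighter than $\oplus$. A bimonoidal category is a category $C$ with a symmetric monoidal structure $(\oplus,0,\alpha^\oplus,\lambda^\oplus,\rho^\oplus,\zeta^\oplus)$, a monoidal structure $(\otimes,1,\alpha^\otimes,\lambda^\otimes,\rho^\otimes)$ (with $\alpha_{A,B,C}:(AB)C\to A(BC)$, $\lambda_A$, $\rho_A$ the left/right unit isomorphisms), natural isomorphisms $\lambda^\bullet_A:0A\to0$, $\rho^\bullet_A:A0\to 0$, and natural monomorphisms $\delta^l_{A,B,C}:A(B\oplus C)\to AB\oplus AC$, $\delta^r_{A,B,C}:(A\oplus B)C\to AC\oplus BC$, such that for all objects: $\delta^l_{A,C,B}(1\otimes\zeta^\oplus_{B,C})=\zeta^\oplus_{AB,AC}\delta^l_{A,B,C}$; $\delta^r_{B,A,C}(\zeta^\oplus_{A,B}\otimes1)=\zeta^\oplus_{AC,BC}\delta^r_{A,B,C}$; $\alpha^\oplus(\delta^r_{A,B,D}\oplus1)\delta^r_{A\oplus B,C,D}=(1\oplus\delta^r_{B,C,D})\delta^r_{A,B\oplus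 C,D}(\alpha^\oplus_{A,B,C}\otimes1)$; $\alpha^\oplus(\delta^l_{A,B,C}\oplus1)\delta^l_{A,B\oplus C,D}=(1\oplus\delta^l_{A,C,D})\delta^l_{A,B,C\oplus D}(1\otimes\alpha^\oplus_{B,C,D})$; $\delta^l_{A,BC,BD}(1\otimes\delta^l_{B,C,D})\alpha^\otimes_{A,B,C\oplus D}=(\alpha^\otimes_{A,B,C}\oplus\alpha^\otimes_{A,B,D})\delta^l_{AB,C,D}$; $(\alpha^\otimes_{A,C,D}\oplus\alpha^\otimes_{B,C,D})\delta^r_{AC,BC,D}(\delta^r_{A,B,C}\otimes1)=\delta^r_{A,B,CD}\alpha^\otimes_{A\oplus B,C,D}$; $(\alpha^\otimes_{A,B,D}\oplus\alpha^\otimes_{A,C,D})\delta^r_{AB,AC,D}(\delta^l_{A,B,C}\otimes1)=\delta^l_{A,BD,CD}(1\otimes\delta^r_{B,C,D})\alpha^\otimes_{A,B\oplus C,D}$; $\mu(\delta^l_{A,C,D}\oplus\delta^l_{B,C,D})\delta^r_{A,B,C\oplus D}=(\delta^r_{A,B,C}\oplus\delta^r_{A,B,D})\delta^l_{A\oplus B,C,D}$, where $\mu:(AC\oplus AD)\oplus(BC\oplus BD)\to(AC\oplus BC)\oplus(AD\oplus BD)$ is the coherence isomorphism exchanging the two middle summands; $\lambda^\bullet_0=\rho^\bullet_0$; $\lambda^\oplus_0(\lambda^\bullet_A\oplus\lambda^\bullet_B)\delta^l_{0,A,B}=\lambda^\bullet_{A\oplus B}$; $\lambda^\oplus_0(\rho^\bullet_A\oplus\rho^\bullet_B)\delta^r_{A,B,0}=\rho^\bullet_{A\oplus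 B}$; $\rho^\otimes_0=\lambda^\bullet_1$; $\lambda^\otimes_0=\rho^\bullet_1$; $\lambda^\bullet_{AB}\alpha^\otimes_{0,A,B}=\lambda^\bullet_B(\lambda^\bullet_A\otimes1)$; $\rho^\bullet_A(1\otimes\lambda^\bullet_B)\alpha^\otimes_{A,0,B}=\lambda^\bullet_B(\rho^\bullet_A\otimes1)$; $\rho^\bullet_A(1\otimes\rho^\bullet_B)\alpha^\otimes_{A,B,0}=\rho^\bullet_{AB}$; $\lambda^\oplus_{AB}(\rho^\bullet_A\oplus1)\delta^l_{A,0,B}=1\otimes\lambda^\oplus_B$; $\lambda^\oplus_{BA}(\lambda^\bullet_A\oplus1)\delta^r_{0,B,A}=\lambda^\oplus_B\otimes1$; $\rho^\oplus_{AB}(1\oplus\rho^\bullet_A)\delta^l_{A,B,0}=1\otimes\rho^\oplus_B$; $\rho^\oplus_{AB}(1\oplus\lambda^\bullet_B)\delta^r_{A,0,B}=\rho^\oplus_A\otimes1$; $(\lambda^\otimes_A\oplus\lambda^\otimes_B)\delta^l_{1,A,B}=\lambda^\otimes_{A\oplus B}$; $(\rho^\otimes_A\oplus\rho^\otimes_B)\delta^r_{A,B,1}=\rho^\otimes_{A\oplus B}$. It is tight if $\delta^l,\delta^r$ are natural isomorphisms. A braided bimonoidal category is a bimonoidal category with a braiding $\zeta^\otimes$ making $\otimes$ braided monoidal, such that $\delta^l_{C,A,B}\zeta^\otimes_{A\oplus B,C}=(\zeta^\otimes_{A,C}\oplus\zeta^\otimes_{B,C})\delta^r_{A,B,C}$,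 $\delta^r_{B,C,A}\zeta^\otimes_{A,B\oplus C}=(\zeta^\otimes_{A,B}\oplus\zeta^\otimes_{A,C})\delta^l_{A,B,C}$, $\lambda^\bullet_A\zeta^\otimes_{A,0}=\rho^\bullet_A$, and $\rho^\bullet_A\zeta^\otimes_{0,A}=\lambda^\bullet_A$. *)

theory Defs
  imports Complex_Main "Jordan_Normal_Form.Matrix"
begin

section \<open>Categories with monoidal structures\<close>

text \<open>The objects form the whole type \<open>'o\<close>. Composition is written in application order and is
  only meaningful on composable arrows; since hom-sets are disjoint it need not mention objects.\<close>

locale category =
  fixes hom :: "'o \<Rightarrow> 'o \<Rightarrow> 'm set"
    and ide :: "'o \<Rightarrow> 'm"
    and comp :: "'m \<Rightarrow> 'm \<Rightarrow> 'm"  (infixr "\<cdot>" 55)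
  assumes hom_disjoint: "\<lbrakk>f \<in> hom A B; f \<in> hom A' B'\<rbrakk> \<Longrightarrow> A = A' \<and> B = B'"
    and ide_hom: "ide A \<in> hom A A"
    and comp_hom: "\<lbrakk>f \<in> hom A B; g \<in> hom B C\<rbrakk> \<Longrightarrow> g \<cdot> f \<in> hom A C"
    and comp_ide_left: "f \<in> hom A B \<Longrightarrow> ide B \<cdot> f = f"
    and comp_ide_right: "f \<in> hom A B \<Longrightarrow> f \<cdot> ide A = f"
    and comp_assoc: "\<lbrakk>f \<in> hom A B; g \<in> hom B C; h \<in> hom C D\<rbrakk> \<Longrightarrow> (h \<cdot> g) \<cdot> f = h \<cdot> (g \<cdot> f)"
begin

definition mutually_inverse :: "'o \<Rightarrow> 'o \<Rightarrow> 'm \<Rightarrow> 'm \<Rightarrow> bool" where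
  "mutually_inverse A B f g \<longleftrightarrow>
     f \<in> hom A B \<and> g \<in> hom B A \<and> g \<cdot> f = ide A \<and> f \<cdot> g = ide B"

definition is_iso :: "'o \<Rightarrow> 'o \<Rightarrow> 'm \<Rightarrow> bool" where
  "is_iso A B f \<longleftrightarrow> (\<exists>g. mutually_inverse A B f g)"

definition inv_arr :: "'m \<Rightarrow> 'm" where
  "inv_arr f = (THE g. \<exists>A B. mutually_inverse A B f g)"

definition is_mono :: "'o \<Rightarrow> 'o \<Rightarrow> 'm \<Rightarrow> bool" where
  "is_mono A B f \<longleftrightarrow>
     f \<in> hom A B \<and> (\<forall>X g h. g \<in> hom X A \<longrightarrow> h \<in> hom X A \<longrightarrow> f \<cdot> g = f \<cdot> h \<longrightarrow> g = h)"

end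

locale monoidal_category = category hom ide comp
  for hom :: "'o \<Rightarrow> 'o \<Rightarrow> 'm set"
    and ide :: "'o \<Rightarrow> 'm"
    and comp :: "'m \<Rightarrow> 'm \<Rightarrow> 'm"  (infixr "\<cdot>" 55) +
  fixes tens_obj :: "'o \<Rightarrow> 'o \<Rightarrow> 'o"  (infixl "\<otimes>\<^sub>o" 70)
    and tens_arr :: "'m \<Rightarrow> 'm \<Rightarrow> 'm"  (infixl "\<otimes>\<^sub>a" 70)
    and unit :: "'o"
    and assoc :: "'o \<Rightarrow> 'o \<Rightarrow> 'o \<Rightarrow> 'm"
    and lunit :: "'o \<Rightarrow> 'm"
    and runit :: "'o \<Rightarrow> 'm"
  assumes tens_hom: "\<lbrakk>f \<in> hom A A'; g \<in> hom B B'\<rbrakk> \<Longrightarrow> f \<otimes>\<^sub>a g \<in> hom (A \<otimes>\<^sub>o B) (A' \<otimes>\<^sub>o B')"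
    and tens_ide: "ide A \<otimes>\<^sub>a ide B = ide (A \<otimes>\<^sub>o B)"
    and tens_comp: "\<lbrakk>f \<in> hom A A'; f' \<in> hom A' A''; g \<in> hom B B'; g' \<in> hom B' B''\<rbrakk> \<Longrightarrow>
          (f' \<cdot> f) \<otimes>\<^sub>a (g' \<cdot> g) = (f' \<otimes>\<^sub>a g') \<cdot> (f \<otimes>\<^sub>a g)"
    and assoc_iso: "is_iso ((A \<otimes>\<^sub>o B) \<otimes>\<^sub>o C) (A \<otimes>\<^sub>o (B \<otimes>\<^sub>o C)) (assoc A B C)"
    and assoc_natural: "\<lbrakk>f \<in> hom A A'; g \<in> hom B B'; h \<in> hom C C'\<rbrakk> \<Longrightarrow>
          assoc A' B' C' \<cdot> ((f \<otimes>\<^sub>a g) \<otimes>\<^sub>a h) = (f \<otimes>\<^sub>a (g \<otimes>\<^sub>a h)) \<cdot> assoc A B C"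
    and lunit_iso: "is_iso (unit \<otimes>\<^sub>o A) A (lunit A)"
    and lunit_natural: "f \<in> hom A A' \<Longrightarrow> lunit A' \<cdot> (ide unit \<otimes>\<^sub>a f) = f \<cdot> lunit A"
    and runit_iso: "is_iso (A \<otimes>\<^sub>o unit) A (runit A)"
    and runit_natural: "f \<in> hom A A' \<Longrightarrow> runit A' \<cdot> (f \<otimes>\<^sub>a ide unit) = f \<cdot> runit A"
    and pentagon: "assoc A B (C \<otimes>\<^sub>o D) \<cdot> assoc (A \<otimes>\<^sub>o B) C D =
          (ide A \<otimes>\<^sub>a assoc B C D) \<cdot> assoc A (B \<otimes>\<^sub>o C) D \<cdot> (assoc A B C \<otimes>\<^sub>a ide D)"
    and triangle: "(ide A \<otimes>\<^sub>a lunit B) \<cdot> assoc A unit B = runit A \<otimes>\<^sub>a ide B"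

locale braided_monoidal_category =
  monoidal_category hom ide comp tens_obj tens_arr unit assoc lunit runit
  for hom :: "'o \<Rightarrow> 'o \<Rightarrow> 'm set"
    and ide :: "'o \<Rightarrow> 'm"
    and comp :: "'m \<Rightarrow> 'm \<Rightarrow> 'm"  (infixr "\<cdot>" 55)
    and tens_obj :: "'o \<Rightarrow> 'o \<Rightarrow> 'o"  (infixl "\<otimes>\<^sub>o" 70)
    and tens_arr :: "'m \<Rightarrow> 'm \<Rightarrow> 'm"  (infixl "\<otimes>\<^sub>a" 70)
    and unit :: "'o"
    and assoc :: "'o \<Rightarrow> 'o \<Rightarrow> 'o \<Rightarrow> 'm"
    and lunit :: "'o \<Rightarrow> 'm"
    and runit :: "'o \<Rightarrow> 'm" +
  fixes braid :: "'o \<Rightarrow> 'o \<Rightarrow> 'm"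
  assumes braid_iso: "is_iso (A \<otimes>\<^sub>o B) (B \<otimes>\<^sub>o A) (braid A B)"
    and braid_natural: "\<lbrakk>f \<in> hom A A'; g \<in> hom B B'\<rbrakk> \<Longrightarrow>
          braid A' B' \<cdot> (f \<otimes>\<^sub>a g) = (g \<otimes>\<^sub>a f) \<cdot> braid A B"
    and braid_unit: "lunit A \<cdot> braid A unit = runit A"
    and hexagon1: "assoc B C A \<cdot> braid A (B \<otimes>\<^sub>o C) \<cdot> assoc A B C =
          (ide B \<otimes>\<^sub>a braid A C) \<cdot> assoc B A C \<cdot> (braid A B \<otimes>\<^sub>a ide C)"
    and hexagon2: "inv_arr (assoc C A B) \<cdot> braid (A \<otimes>\<^sub>o B) C \<cdot> inv_arr (assoc A B C) =
          (braid A C \<otimes>\<^sub>a ide B) \<cdot> inv_arr (assoc A C B) \<cdot> (ide A \<otimes>\<^sub>a braid B C)"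

locale symmetric_monoidal_category =
  braided_monoidal_category hom ide comp tens_obj tens_arr unit assoc lunit runit braid
  for hom :: "'o \<Rightarrow> 'o \<Rightarrow> 'm set"
    and ide :: "'o \<Rightarrow> 'm"
    and comp :: "'m \<Rightarrow> 'm \<Rightarrow> 'm"  (infixr "\<cdot>" 55)
    and tens_obj :: "'o \<Rightarrow> 'o \<Rightarrow> 'o"  (infixl "\<otimes>\<^sub>o" 70)
    and tens_arr :: "'m \<Rightarrow> 'm \<Rightarrow> 'm"  (infixl "\<otimes>\<^sub>a" 70)
    and unit :: "'o"
    and assoc :: "'o \<Rightarrow> 'o \<Rightarrow> 'o \<Rightarrow> 'm"
    and lunit :: "'o \<Rightarrow> 'm"
    and runit :: "'o \<Rightarrow> 'm"
    and braid :: "'o \<Rightarrow> 'o \<Rightarrow> 'm" +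
  assumes braid_involutive: "braid B A \<cdot> braid A B = ide (A \<otimes>\<^sub>o B)"
begin

text \<open>The coherence isomorphism \<open>(W X)(Y Z) \<rightarrow> (W Y)(X Z)\<close>.\<close>

definition mid_swap :: "'o \<Rightarrow> 'o \<Rightarrow> 'o \<Rightarrow> 'o \<Rightarrow> 'm" where
  "mid_swap W X Y Z =
     inv_arr (assoc W Y (X \<otimes>\<^sub>o Z)) \<cdot>
     (ide W \<otimes>\<^sub>a (assoc Y X Z \<cdot> (braid X Y \<otimes>\<^sub>a ide Z) \<cdot> inv_arr (assoc X Y Z))) \<cdot>
     assoc W X (Y \<otimes>\<^sub>o Z)"

end


section \<open>Bimonoidal categories\<close>

locale bimonoidal_category =
  category hom ide comp +
  add: symmetric_monoidal_category hom ide comp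
    sum_obj sum_arr zero_obj sum_assoc sum_lunit sum_runit sum_braid +
  mult: monoidal_category hom ide comp
    prod_obj prod_arr one_obj prod_assoc prod_lunit prod_runit
  for hom :: "'o \<Rightarrow> 'o \<Rightarrow> 'm set"
    and ide :: "'o \<Rightarrow> 'm"  ("\<^bold>1")
    and comp :: "'m \<Rightarrow> 'm \<Rightarrow> 'm"  (infixr "\<cdot>" 55)
    and sum_obj :: "'o \<Rightarrow> 'o \<Rightarrow> 'o"  (infixl "\<oplus>\<^sub>o" 65)
    and sum_arr :: "'m \<Rightarrow> 'm \<Rightarrow> 'm"  (infixl "\<oplus>\<^sub>a" 65)
    and zero_obj :: "'o"  ("\<^bold>0")
    and sum_assoc :: "'o \<Rightarrow> 'o \<Rightarrow> 'o \<Rightarrow> 'm"  ("\<alpha>\<^sup>\<oplus>")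
    and sum_lunit :: "'o \<Rightarrow> 'm"  ("\<lambda>\<^sup>\<oplus>")
    and sum_runit :: "'o \<Rightarrow> 'm"  ("\<rho>\<^sup>\<oplus>")
    and sum_braid :: "'o \<Rightarrow> 'o \<Rightarrow> 'm"  ("\<zeta>\<^sup>\<oplus>")
    and prod_obj :: "'o \<Rightarrow> 'o \<Rightarrow> 'o"  (infixl "\<otimes>\<^sub>o" 70)
    and prod_arr :: "'m \<Rightarrow> 'm \<Rightarrow> 'm"  (infixl "\<otimes>\<^sub>a" 70)
    and one_obj :: "'o"  ("I")
    and prod_assoc :: "'o \<Rightarrow> 'o \<Rightarrow> 'o \<Rightarrow> 'm"  ("\<alpha>\<^sup>\<otimes>")
    and prod_lunit :: "'o \<Rightarrow> 'm"  ("\<lambda>\<^sup>\<otimes>")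
    and prod_runit :: "'o \<Rightarrow> 'm"  ("\<rho>\<^sup>\<otimes>") +
  fixes lnull :: "'o \<Rightarrow> 'm"  ("\<lambda>\<^sup>\<bullet>")
    and rnull :: "'o \<Rightarrow> 'm"  ("\<rho>\<^sup>\<bullet>")
    and ldist :: "'o \<Rightarrow> 'o \<Rightarrow> 'o \<Rightarrow> 'm"  ("\<delta>\<^sup>l")
    and rdist :: "'o \<Rightarrow> 'o \<Rightarrow> 'o \<Rightarrow> 'm"  ("\<delta>\<^sup>r")
  assumes lnull_iso: "is_iso (\<^bold>0 \<otimes>\<^sub>o A) \<^bold>0 (\<lambda>\<^sup>\<bullet> A)"
    and lnull_natural: "f \<in> hom A A' \<Longrightarrow> \<lambda>\<^sup>\<bullet> A' \<cdot> (\<^bold>1 \<^bold>0 \<otimes>\<^sub>a f) = \<lambda>\<^sup>\<bullet> A"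
    and rnull_iso: "is_iso (A \<otimes>\<^sub>o \<^bold>0) \<^bold>0 (\<rho>\<^sup>\<bullet> A)"
    and rnull_natural: "f \<in> hom A A' \<Longrightarrow> \<rho>\<^sup>\<bullet> A' \<cdot> (f \<otimes>\<^sub>a \<^bold>1 \<^bold>0) = \<rho>\<^sup>\<bullet> A"
    and ldist_mono: "is_mono (A \<otimes>\<^sub>o (B \<oplus>\<^sub>o C)) (A \<otimes>\<^sub>o B \<oplus>\<^sub>o A \<otimes>\<^sub>o C) (\<delta>\<^sup>l A B C)"
    and ldist_natural: "\<lbrakk>f \<in> hom A A'; g \<in> hom B B'; h \<in> hom C C'\<rbrakk> \<Longrightarrow>
          \<delta>\<^sup>l A' B' C' \<cdot> (f \<otimes>\<^sub>a (g \<oplus>\<^sub>a h)) = (f \<otimes>\<^sub>a g \<oplus>\<^sub>a f \<otimes>\<^sub>a h) \<cdot> \<delta>\<^sup>l A B C"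
    and rdist_mono: "is_mono ((A \<oplus>\<^sub>o B) \<otimes>\<^sub>o C) (A \<otimes>\<^sub>o C \<oplus>\<^sub>o B \<otimes>\<^sub>o C) (\<delta>\<^sup>r A B C)"
    and rdist_natural: "\<lbrakk>f \<in> hom A A'; g \<in> hom B B'; h \<in> hom C C'\<rbrakk> \<Longrightarrow>
          \<delta>\<^sup>r A' B' C' \<cdot> ((f \<oplus>\<^sub>a g) \<otimes>\<^sub>a h) = (f \<otimes>\<^sub>a h \<oplus>\<^sub>a g \<otimes>\<^sub>a h) \<cdot> \<delta>\<^sup>r A B C"
    and ldist_sum_braid:
      "\<delta>\<^sup>l A C B \<cdot> (\<^bold>1 A \<otimes>\<^sub>a \<zeta>\<^sup>\<oplus> B C) = \<zeta>\<^sup>\<oplus> (A \<otimes>\<^sub>o B) (A \<otimes>\<^sub>o C) \<cdot> \<delta>\<^sup>l A B C"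
    and rdist_sum_braid:
      "\<delta>\<^sup>r B A C \<cdot> (\<zeta>\<^sup>\<oplus> A B \<otimes>\<^sub>a \<^bold>1 C) = \<zeta>\<^sup>\<oplus> (A \<otimes>\<^sub>o C) (B \<otimes>\<^sub>o C) \<cdot> \<delta>\<^sup>r A B C"
    and rdist_sum_assoc:
      "\<alpha>\<^sup>\<oplus> (A \<otimes>\<^sub>o D) (B \<otimes>\<^sub>o D) (C \<otimes>\<^sub>o D) \<cdot> (\<delta>\<^sup>r A B D \<oplus>\<^sub>a \<^bold>1 (C \<otimes>\<^sub>o D)) \<cdot> \<delta>\<^sup>r (A \<oplus>\<^sub>o B) C D =
       (\<^bold>1 (A \<otimes>\<^sub>o D) \<oplus>\<^sub>a \<delta>\<^sup>r B C D) \<cdot> \<delta>\<^sup>r A (B \<oplus>\<^sub>o C) D \<cdot> (\<alpha>\<^sup>\<oplus> A B C \<otimes>\<^sub>a \<^bold>1 D)"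
    and ldist_sum_assoc:
      "\<alpha>\<^sup>\<oplus> (A \<otimes>\<^sub>o B) (A \<otimes>\<^sub>o C) (A \<otimes>\<^sub>o D) \<cdot> (\<delta>\<^sup>l A B C \<oplus>\<^sub>a \<^bold>1 (A \<otimes>\<^sub>o D)) \<cdot> \<delta>\<^sup>l A (B \<oplus>\<^sub>o C) D =
       (\<^bold>1 (A \<otimes>\<^sub>o B) \<oplus>\<^sub>a \<delta>\<^sup>l A C D) \<cdot> \<delta>\<^sup>l A B (C \<oplus>\<^sub>o D) \<cdot> (\<^bold>1 A \<otimes>\<^sub>a \<alpha>\<^sup>\<oplus> B C D)"
    and ldist_prod_assoc:
      "\<delta>\<^sup>l A (B \<otimes>\<^sub>o C) (B \<otimes>\<^sub>o D) \<cdot> (\<^bold>1 A \<otimes>\<^sub>a \<delta>\<^sup>l B C D) \<cdot> \<alpha>\<^sup>\<otimes> A B (C \<oplus>\<^sub>o D) =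
       (\<alpha>\<^sup>\<otimes> A B C \<oplus>\<^sub>a \<alpha>\<^sup>\<otimes> A B D) \<cdot> \<delta>\<^sup>l (A \<otimes>\<^sub>o B) C D"
    and rdist_prod_assoc:
      "(\<alpha>\<^sup>\<otimes> A C D \<oplus>\<^sub>a \<alpha>\<^sup>\<otimes> B C D) \<cdot> \<delta>\<^sup>r (A \<otimes>\<^sub>o C) (B \<otimes>\<^sub>o C) D \<cdot> (\<delta>\<^sup>r A B C \<otimes>\<^sub>a \<^bold>1 D) =
       \<delta>\<^sup>r A B (C \<otimes>\<^sub>o D) \<cdot> \<alpha>\<^sup>\<otimes> (A \<oplus>\<^sub>o B) C D"
    and lrdist_prod_assoc:
      "(\<alpha>\<^sup>\<otimes> A B D \<oplus>\<^sub>a \<alpha>\<^sup>\<otimes> A C D) \<cdot> \<delta>\<^sup>r (A \<otimes>\<^sub>o B) (A \<otimes>\<^sub>o C) D \<cdot> (\<delta>\<^sup>l A B C \<otimes>\<^sub>a \<^bold>1 D) =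
       \<delta>\<^sup>l A (B \<otimes>\<^sub>o D) (C \<otimes>\<^sub>o D) \<cdot> (\<^bold>1 A \<otimes>\<^sub>a \<delta>\<^sup>r B C D) \<cdot> \<alpha>\<^sup>\<otimes> A (B \<oplus>\<^sub>o C) D"
    and dist_mid_swap:
      "add.mid_swap (A \<otimes>\<^sub>o C) (A \<otimes>\<^sub>o D) (B \<otimes>\<^sub>o C) (B \<otimes>\<^sub>o D) \<cdot>
         (\<delta>\<^sup>l A C D \<oplus>\<^sub>a \<delta>\<^sup>l B C D) \<cdot> \<delta>\<^sup>r A B (C \<oplus>\<^sub>o D) =
       (\<delta>\<^sup>r A B C \<oplus>\<^sub>a \<delta>\<^sup>r A B D) \<cdot> \<delta>\<^sup>l (A \<oplus>\<^sub>o B) C D"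
    and null_zero: "\<lambda>\<^sup>\<bullet> \<^bold>0 = \<rho>\<^sup>\<bullet> \<^bold>0"
    and lnull_sum: "\<lambda>\<^sup>\<oplus> \<^bold>0 \<cdot> (\<lambda>\<^sup>\<bullet> A \<oplus>\<^sub>a \<lambda>\<^sup>\<bullet> B) \<cdot> \<delta>\<^sup>l \<^bold>0 A B = \<lambda>\<^sup>\<bullet> (A \<oplus>\<^sub>o B)"
    and rnull_sum: "\<lambda>\<^sup>\<oplus> \<^bold>0 \<cdot> (\<rho>\<^sup>\<bullet> A \<oplus>\<^sub>a \<rho>\<^sup>\<bullet> B) \<cdot> \<delta>\<^sup>r A B \<^bold>0 = \<rho>\<^sup>\<bullet> (A \<oplus>\<^sub>o B)"
    and runit_zero: "\<rho>\<^sup>\<otimes> \<^bold>0 = \<lambda>\<^sup>\<bullet> I"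
    and lunit_zero: "\<lambda>\<^sup>\<otimes> \<^bold>0 = \<rho>\<^sup>\<bullet> I"
    and null_prod_assoc1: "\<lambda>\<^sup>\<bullet> (A \<otimes>\<^sub>o B) \<cdot> \<alpha>\<^sup>\<otimes> \<^bold>0 A B = \<lambda>\<^sup>\<bullet> B \<cdot> (\<lambda>\<^sup>\<bullet> A \<otimes>\<^sub>a \<^bold>1 B)"
    and null_prod_assoc2:
      "\<rho>\<^sup>\<bullet> A \<cdot> (\<^bold>1 A \<otimes>\<^sub>a \<lambda>\<^sup>\<bullet> B) \<cdot> \<alpha>\<^sup>\<otimes> A \<^bold>0 B = \<lambda>\<^sup>\<bullet> B \<cdot> (\<rho>\<^sup>\<bullet> A \<otimes>\<^sub>a \<^bold>1 B)"
    and null_prod_assoc3: "\<rho>\<^sup>\<bullet> A \<cdot> (\<^bold>1 A \<otimes>\<^sub>a \<rho>\<^sup>\<bullet> B) \<cdot> \<alpha>\<^sup>\<otimes> A B \<^bold>0 = \<rho>\<^sup>\<bullet> (A \<otimes>\<^sub>o B)"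
    and ldist_zero_left:
      "\<lambda>\<^sup>\<oplus> (A \<otimes>\<^sub>o B) \<cdot> (\<rho>\<^sup>\<bullet> A \<oplus>\<^sub>a \<^bold>1 (A \<otimes>\<^sub>o B)) \<cdot> \<delta>\<^sup>l A \<^bold>0 B = \<^bold>1 A \<otimes>\<^sub>a \<lambda>\<^sup>\<oplus> B"
    and rdist_zero_left:
      "\<lambda>\<^sup>\<oplus> (B \<otimes>\<^sub>o A) \<cdot> (\<lambda>\<^sup>\<bullet> A \<oplus>\<^sub>a \<^bold>1 (B \<otimes>\<^sub>o A)) \<cdot> \<delta>\<^sup>r \<^bold>0 B A = \<lambda>\<^sup>\<oplus> B \<otimes>\<^sub>a \<^bold>1 A"
    and ldist_zero_right:
      "\<rho>\<^sup>\<oplus> (A \<otimes>\<^sub>o B) \<cdot> (\<^bold>1 (A \<otimes>\<^sub>o B) \<oplus>\<^sub>a \<rho>\<^sup>\<bullet> A) \<cdot> \<delta>\<^sup>l A B \<^bold>0 = \<^bold>1 A \<otimes>\<^sub>a \<rho>\<^sup>\<oplus> B"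
    and rdist_zero_right:
      "\<rho>\<^sup>\<oplus> (A \<otimes>\<^sub>o B) \<cdot> (\<^bold>1 (A \<otimes>\<^sub>o B) \<oplus>\<^sub>a \<lambda>\<^sup>\<bullet> B) \<cdot> \<delta>\<^sup>r A \<^bold>0 B = \<rho>\<^sup>\<oplus> A \<otimes>\<^sub>a \<^bold>1 B"
    and ldist_one: "(\<lambda>\<^sup>\<otimes> A \<oplus>\<^sub>a \<lambda>\<^sup>\<otimes> B) \<cdot> \<delta>\<^sup>l I A B = \<lambda>\<^sup>\<otimes> (A \<oplus>\<^sub>o B)"
    and rdist_one: "(\<rho>\<^sup>\<otimes> A \<oplus>\<^sub>a \<rho>\<^sup>\<otimes> B) \<cdot> \<delta>\<^sup>r A B I = \<rho>\<^sup>\<otimes> (A \<oplus>\<^sub>o B)"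

locale braided_bimonoidal_category =
  bimonoidal_category hom ide comp
    sum_obj sum_arr zero_obj sum_assoc sum_lunit sum_runit sum_braid
    prod_obj prod_arr one_obj prod_assoc prod_lunit prod_runit
    lnull rnull ldist rdist +
  mult: braided_monoidal_category hom ide comp
    prod_obj prod_arr one_obj prod_assoc prod_lunit prod_runit prod_braid
  for hom :: "'o \<Rightarrow> 'o \<Rightarrow> 'm set"
    and ide :: "'o \<Rightarrow> 'm"  ("\<^bold>1")
    and comp :: "'m \<Rightarrow> 'm \<Rightarrow> 'm"  (infixr "\<cdot>" 55)
    and sum_obj :: "'o \<Rightarrow> 'o \<Rightarrow> 'o"  (infixl "\<oplus>\<^sub>o" 65)
    and sum_arr :: "'m \<Rightarrow> 'm \<Rightarrow> 'm"  (infixl "\<oplus>\<^sub>a" 65)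
    and zero_obj :: "'o"  ("\<^bold>0")
    and sum_assoc :: "'o \<Rightarrow> 'o \<Rightarrow> 'o \<Rightarrow> 'm"  ("\<alpha>\<^sup>\<oplus>")
    and sum_lunit :: "'o \<Rightarrow> 'm"  ("\<lambda>\<^sup>\<oplus>")
    and sum_runit :: "'o \<Rightarrow> 'm"  ("\<rho>\<^sup>\<oplus>")
    and sum_braid :: "'o \<Rightarrow> 'o \<Rightarrow> 'm"  ("\<zeta>\<^sup>\<oplus>")
    and prod_obj :: "'o \<Rightarrow> 'o \<Rightarrow> 'o"  (infixl "\<otimes>\<^sub>o" 70)
    and prod_arr :: "'m \<Rightarrow> 'm \<Rightarrow> 'm"  (infixl "\<otimes>\<^sub>a" 70)
    and one_obj :: "'o"  ("I")
    and prod_assoc :: "'o \<Rightarrow> 'o \<Rightarrow> 'o \<Rightarrow> 'm"  ("\<alpha>\<^sup>\<otimes>")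
    and prod_lunit :: "'o \<Rightarrow> 'm"  ("\<lambda>\<^sup>\<otimes>")
    and prod_runit :: "'o \<Rightarrow> 'm"  ("\<rho>\<^sup>\<otimes>")
    and prod_braid :: "'o \<Rightarrow> 'o \<Rightarrow> 'm"  ("\<zeta>\<^sup>\<otimes>")
    and lnull :: "'o \<Rightarrow> 'm"  ("\<lambda>\<^sup>\<bullet>")
    and rnull :: "'o \<Rightarrow> 'm"  ("\<rho>\<^sup>\<bullet>")
    and ldist :: "'o \<Rightarrow> 'o \<Rightarrow> 'o \<Rightarrow> 'm"  ("\<delta>\<^sup>l")
    and rdist :: "'o \<Rightarrow> 'o \<Rightarrow> 'o \<Rightarrow> 'm"  ("\<delta>\<^sup>r") +
  assumes ldist_prod_braid:
      "\<delta>\<^sup>l C A B \<cdot> \<zeta>\<^sup>\<otimes> (A \<oplus>\<^sub>o B) C = (\<zeta>\<^sup>\<otimes> A C \<oplus>\<^sub>a \<zeta>\<^sup>\<otimes> B C) \<cdot> \<delta>\<^sup>r A B C"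
    and rdist_prod_braid:
      "\<delta>\<^sup>r B C A \<cdot> \<zeta>\<^sup>\<otimes> A (B \<oplus>\<^sub>o C) = (\<zeta>\<^sup>\<otimes> A B \<oplus>\<^sub>a \<zeta>\<^sup>\<otimes> A C) \<cdot> \<delta>\<^sup>l A B C"
    and lnull_prod_braid: "\<lambda>\<^sup>\<bullet> A \<cdot> \<zeta>\<^sup>\<otimes> A \<^bold>0 = \<rho>\<^sup>\<bullet> A"
    and rnull_prod_braid: "\<rho>\<^sup>\<bullet> A \<cdot> \<zeta>\<^sup>\<otimes> \<^bold>0 A = \<lambda>\<^sup>\<bullet> A"

locale tight_braided_bimonoidal_category =
  braided_bimonoidal_category +
  assumes ldist_iso: "is_iso (A \<otimes>\<^sub>o (B \<oplus>\<^sub>o C)) (A \<otimes>\<^sub>o B \<oplus>\<^sub>o A \<otimes>\<^sub>o C) (\<delta>\<^sup>l A B C)"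
    and rdist_iso: "is_iso ((A \<oplus>\<^sub>o B) \<otimes>\<^sub>o C) (A \<otimes>\<^sub>o C \<oplus>\<^sub>o B \<otimes>\<^sub>o C) (\<delta>\<^sup>r A B C)"


section \<open>The category of Ising anyons\<close>

text \<open>The components of a triple are indexed by the three charges: vacuum, non-abelian anyon and
  fermion. A linear map \<open>\<complex>\<^sup>m \<rightarrow> \<complex>\<^sup>n\<close> is an \<open>n\<close> by \<open>m\<close> matrix; matrices remember both
  dimensions, also when one of them is zero.\<close>

datatype charge = Vac | Sig | Psi

type_synonym iobj = "nat \<times> nat \<times> nat"
type_synonym iarr = "complex mat \<times> complex mat \<times> complex mat"

fun component :: "'a \<times> 'a \<times> 'a \<Rightarrow> charge \<Rightarrow> 'a" where
  "component (x, y, z) Vac = x"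
| "component (x, y, z) Sig = y"
| "component (x, y, z) Psi = z"

definition triple :: "(charge \<Rightarrow> 'a) \<Rightarrow> 'a \<times> 'a \<times> 'a" where
  "triple f = (f Vac, f Sig, f Psi)"

definition ihom :: "iobj \<Rightarrow> iobj \<Rightarrow> iarr set" where
  "ihom A B = {f. \<forall>c. component f c \<in> carrier_mat (component B c) (component A c)}"

definition iide :: "iobj \<Rightarrow> iarr" where
  "iide A = triple (\<lambda>c. 1\<^sub>m (component A c))"

definition icomp :: "iarr \<Rightarrow> iarr \<Rightarrow> iarr" where
  "icomp g f = triple (\<lambda>c. component g c * component f c)"

definition izero_arr :: "iobj \<Rightarrow> iobj \<Rightarrow> iarr" where
  "izero_arr A B = triple (\<lambda>c. 0\<^sub>m (component B c) (component A c))"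

definition iadd :: "iarr \<Rightarrow> iarr \<Rightarrow> iarr" where
  "iadd f g = triple (\<lambda>c. component f c + component g c)"

text \<open>Matrices of all sizes share one type, which therefore has no zero and no \<open>sum\<close>; a finite sum
  of arrows \<open>A \<rightarrow> B\<close> is formed entrywise.\<close>

definition iSum :: "iobj \<Rightarrow> iobj \<Rightarrow> 'i set \<Rightarrow> ('i \<Rightarrow> iarr) \<Rightarrow> iarr" where
  "iSum A B J t = triple (\<lambda>c. mat (component B c) (component A c)
     (\<lambda>(p, q). \<Sum>j\<in>J. component (t j) c $$ (p, q)))"

subsection \<open>Direct sums\<close>

definition izero :: iobj where "izero = (0, 0, 0)"

definition dsum_obj :: "iobj \<Rightarrow> iobj \<Rightarrow> iobj" where
  "dsum_obj A B = triple (\<lambda>c. component A c + component B c)"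

definition block_diag :: "complex mat \<Rightarrow> complex mat \<Rightarrow> complex mat"  (infixr "\<boxplus>" 65) where
  "M \<boxplus> N = four_block_mat M (0\<^sub>m (dim_row M) (dim_col N)) (0\<^sub>m (dim_row N) (dim_col M)) N"

definition dsum_arr :: "iarr \<Rightarrow> iarr \<Rightarrow> iarr" where
  "dsum_arr f g = triple (\<lambda>c. component f c \<boxplus> component g c)"

definition inj1 :: "iobj \<Rightarrow> iobj \<Rightarrow> iarr" where
  "inj1 A B = triple (\<lambda>c. 1\<^sub>m (component A c) @\<^sub>r 0\<^sub>m (component B c) (component A c))"

definition inj2 :: "iobj \<Rightarrow> iobj \<Rightarrow> iarr" where
  "inj2 A B = triple (\<lambda>c. 0\<^sub>m (component A c) (component B c) @\<^sub>r 1\<^sub>m (component B c))"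

definition proj1 :: "iobj \<Rightarrow> iobj \<Rightarrow> iarr" where
  "proj1 A B = triple (\<lambda>c. transpose_mat (component (inj1 A B) c))"

definition proj2 :: "iobj \<Rightarrow> iobj \<Rightarrow> iarr" where
  "proj2 A B = triple (\<lambda>c. transpose_mat (component (inj2 A B) c))"

text \<open>\<open>\<oplus>\<close> is strictly associative and strictly unital, so its canonical associativity and unit
  isomorphisms have identity matrices. The symmetry interchanges the summands.\<close>

definition dsum_assoc :: "iobj \<Rightarrow> iobj \<Rightarrow> iobj \<Rightarrow> iarr" where
  "dsum_assoc A B C = iide (dsum_obj A (dsum_obj B C))"

definition dsum_lunit :: "iobj \<Rightarrow> iarr" where "dsum_lunit A = iide A"

definition dsum_runit :: "iobj \<Rightarrow> iarr" where "dsum_runit A = iide A"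

definition dsum_braid :: "iobj \<Rightarrow> iobj \<Rightarrow> iarr" where
  "dsum_braid A B = iadd (icomp (inj2 B A) (proj1 A B)) (icomp (inj1 B A) (proj2 A B))"

subsection \<open>The fusion product\<close>

definition simple :: "charge \<Rightarrow> iobj" where
  "simple a = triple (\<lambda>c. if c = a then 1 else 0)"

definition ione :: iobj where "ione = (1, 0, 0)"

text \<open>Within each component the fusion channels are ordered lexicographically by the charges of the
  two factors, and each channel \<open>\<complex>\<^sup>m \<otimes> \<complex>\<^sup>n\<close> carries the lexicographic basis. This makes
  \<open>ione\<close> a strict unit, and puts the channel \<open>Vac\<close> before \<open>Psi\<close> in both \<open>(\<sigma>\<sigma>)\<sigma>\<close> and
  \<open>\<sigma>(\<sigma>\<sigma>)\<close>.\<close>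

fun fuse_obj :: "iobj \<Rightarrow> iobj \<Rightarrow> iobj" where
  "fuse_obj (m, n, p) (m', n', p') =
     (m * m' + n * n' + p * p',
      m * n' + n * m' + n * p' + p * n',
      m * p' + n * n' + p * m')"

definition kronecker :: "complex mat \<Rightarrow> complex mat \<Rightarrow> complex mat"  (infixr "\<odot>" 70) where
  "M \<odot> N = mat (dim_row M * dim_row N) (dim_col M * dim_col N)
     (\<lambda>(i, j). M $$ (i div dim_row N, j div dim_col N) * N $$ (i mod dim_row N, j mod dim_col N))"

fun fuse_arr :: "iarr \<Rightarrow> iarr \<Rightarrow> iarr" where
  "fuse_arr (f, g, h) (f', g', h') =
     (f \<odot> f' \<boxplus> g \<odot> g' \<boxplus> h \<odot> h',
      f \<odot> g' \<boxplus> g \<odot> f' \<boxplus> g \<odot> h' \<boxplus> h \<odot> g',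
      f \<odot> h' \<boxplus> g \<odot> g' \<boxplus> h \<odot> f')"

lemma fusion_rules:
  "simple Vac = ione"
  "fuse_obj ione A = A"
  "fuse_obj A ione = A"
  "fuse_obj (simple Sig) (simple Sig) = dsum_obj ione (simple Psi)"
  "fuse_obj (simple Sig) (simple Psi) = simple Sig"
  "fuse_obj (simple Psi) (simple Sig) = simple Sig"
  "fuse_obj (simple Psi) (simple Psi) = ione"
  by (cases A; simp add: simple_def ione_def dsum_obj_def triple_def)+

text \<open>Every object is the direct sum of copies of simple objects; \<open>copies A\<close> lists them, and
  \<open>incl A\<close>, \<open>proj A\<close> are the inclusions and projections of this decomposition.\<close>

definition copies :: "iobj \<Rightarrow> (charge \<times> nat) set" where
  "copies A = {(a, i). i < component A a}"

definition incl :: "iobj \<Rightarrow> charge \<times> nat \<Rightarrow> iarr" where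
  "incl A s = triple (\<lambda>c. mat (component A c) (component (simple (fst s)) c)
     (\<lambda>(p, q). if p = snd s then 1 else 0))"

definition proj :: "iobj \<Rightarrow> charge \<times> nat \<Rightarrow> iarr" where
  "proj A s = triple (\<lambda>c. mat (component (simple (fst s)) c) (component A c)
     (\<lambda>(p, q). if q = snd s then 1 else 0))"

fun assoc_simple :: "charge \<Rightarrow> charge \<Rightarrow> charge \<Rightarrow> iarr" where
  "assoc_simple Sig Sig Sig =
     (1\<^sub>m 0, complex_of_real (1 / sqrt 2) \<cdot>\<^sub>m mat_of_rows_list 2 [[1, 1], [1, -1]], 1\<^sub>m 0)"
| "assoc_simple Psi Sig Psi = (1\<^sub>m 0, (-1) \<cdot>\<^sub>m 1\<^sub>m 1, 1\<^sub>m 0)"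
| "assoc_simple Sig Psi Sig = (1\<^sub>m 1, 1\<^sub>m 0, (-1) \<cdot>\<^sub>m 1\<^sub>m 1)"
| "assoc_simple a b c = iide (fuse_obj (fuse_obj (simple a) (simple b)) (simple c))"

definition ising_w :: complex where "ising_w = exp (of_real pi * \<i> / 8)"

fun braid_simple :: "charge \<Rightarrow> charge \<Rightarrow> iarr" where
  "braid_simple Sig Sig = (inverse ising_w \<cdot>\<^sub>m 1\<^sub>m 1, 1\<^sub>m 0, ising_w ^ 3 \<cdot>\<^sub>m 1\<^sub>m 1)"
| "braid_simple Sig Psi = (1\<^sub>m 0, inverse (ising_w ^ 4) \<cdot>\<^sub>m 1\<^sub>m 1, 1\<^sub>m 0)"
| "braid_simple Psi Sig = (1\<^sub>m 0, inverse (ising_w ^ 4) \<cdot>\<^sub>m 1\<^sub>m 1, 1\<^sub>m 0)"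
| "braid_simple Psi Psi = ((-1) \<cdot>\<^sub>m 1\<^sub>m 1, 1\<^sub>m 0, 1\<^sub>m 0)"
| "braid_simple a b = iide (fuse_obj (simple a) (simple b))"

text \<open>A natural transformation between functors additive in each variable is the sum of its values
  on simple objects, conjugated by the inclusions and projections.\<close>

definition fuse_assoc :: "iobj \<Rightarrow> iobj \<Rightarrow> iobj \<Rightarrow> iarr" where
  "fuse_assoc A B C =
     iSum (fuse_obj (fuse_obj A B) C) (fuse_obj A (fuse_obj B C)) (copies A \<times> copies B \<times> copies C)
       (\<lambda>(r, s, t).
          icomp (fuse_arr (incl A r) (fuse_arr (incl B s) (incl C t)))
            (icomp (assoc_simple (fst r) (fst s) (fst t))
              (fuse_arr (fuse_arr (proj A r) (proj B s)) (proj C t))))"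

definition fuse_braid :: "iobj \<Rightarrow> iobj \<Rightarrow> iarr" where
  "fuse_braid A B =
     iSum (fuse_obj A B) (fuse_obj B A) (copies A \<times> copies B)
       (\<lambda>(r, s).
          icomp (fuse_arr (incl B s) (incl A r))
            (icomp (braid_simple (fst r) (fst s)) (fuse_arr (proj A r) (proj B s))))"

definition fuse_lunit :: "iobj \<Rightarrow> iarr" where "fuse_lunit A = iide A"

definition fuse_runit :: "iobj \<Rightarrow> iarr" where "fuse_runit A = iide A"

subsection \<open>Multiplicative zeros and distributivity\<close>

definition fuse_lnull :: "iobj \<Rightarrow> iarr" where
  "fuse_lnull A = izero_arr (fuse_obj izero A) izero"

definition fuse_rnull :: "iobj \<Rightarrow> iarr" where
  "fuse_rnull A = izero_arr (fuse_obj A izero) izero"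

text \<open>The components of \<open>\<delta>\<^sup>l\<close> and \<open>\<delta>\<^sup>r\<close> in the target direct sum are the images of the
  projections of the source direct sum.\<close>

definition fuse_ldist :: "iobj \<Rightarrow> iobj \<Rightarrow> iobj \<Rightarrow> iarr" where
  "fuse_ldist A B C =
     iadd (icomp (inj1 (fuse_obj A B) (fuse_obj A C)) (fuse_arr (iide A) (proj1 B C)))
          (icomp (inj2 (fuse_obj A B) (fuse_obj A C)) (fuse_arr (iide A) (proj2 B C)))"

definition fuse_rdist :: "iobj \<Rightarrow> iobj \<Rightarrow> iobj \<Rightarrow> iarr" where
  "fuse_rdist A B C =
     iadd (icomp (inj1 (fuse_obj A C) (fuse_obj B C)) (fuse_arr (proj1 A B) (iide C)))
          (icomp (inj2 (fuse_obj A C) (fuse_obj B C)) (fuse_arr (proj2 A B) (iide C)))"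

end

theory Submission
  imports Defs
begin

text \<open>The theorem has two independent halves.

\<^bold>\<open>The distributive laws cost nothing.\<close> Let a category have zero arrows, sums of arrows and
biproducts, and let a braided monoidal product on it be bilinear on arrows. The distributivity maps
are the arrows into a biproduct whose components are the images of the projections, so each law is an
equation between two arrows into a biproduct. It may be checked after composing with the projections,
where it becomes an instance of naturality; laws about the zero object hold because an arrow into a
zero object is unique. This half is carried out abstractly in the locale
\<open>additive_braided_category\<close> and ends in its theorem \<open>tight_braided_bimonoidal\<close>.

\<^bold>\<open>The monoidal half is decided on simple objects.\<close> Every product of objects is decomposed into
products of simple ones, and an arrow is determined by its restrictions to the parts of such a
\<open>decomposition\<close>. The associativity and the braiding are sums of their values on simple objects,
conjugated by inclusions and projections. Schur's lemma (\<open>simple_arrow_cases\<close>: an arrow between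
simple objects is a multiple of the identity or zero) makes them natural (\<open>diag_natural\<close>),
and they are invertible because they are so on simple objects (\<open>diag_inverse\<close>). By naturality the
pentagon and the hexagons restrict to the same equations for simple objects (\<open>fuse_pentagon\<close>,
\<open>fuse_hexagon1\<close>, \<open>fuse_hexagon2\<close>). If one of the objects is the unit these are trivial, since the
unit is strict and the associativity and braiding are identities there. What remains are sixteen
pentagons and eight hexagons of each kind with all objects in \<open>\<sigma>, \<psi>\<close>: equations between matrices
of size at most two, proved by computation in \<open>pentagon_nonunit\<close>, \<open>hexagon1_nonunit\<close> and
\<open>hexagon2_nonunit\<close>. The only object there that is not simple is \<open>\<sigma>\<sigma> = \<one> \<oplus> \<psi>\<close>, and the only
arithmetic used is \<open>1/\<surd>2 \<cdot> 1/\<surd>2 = 1/2\<close> and the values of the eighth roots of unity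
\<open>w\<^sup>4 = \<i>\<close> and \<open>w\<^sup>-\<^sup>2 = (1 - \<i>)/\<surd>2\<close>.\<close>

section \<open>Additive categories are symmetric monoidal\<close>

context category
begin

lemma mutually_inverse_unique:
  assumes "mutually_inverse A B f g" and "mutually_inverse A' B' f g'"
  shows "g = g'"
proof -
  have AB: "A' = A" "B' = B"
    using assms hom_disjoint unfolding mutually_inverse_def by blast+
  have f: "f \<in> hom A B" and g: "g \<in> hom B A" "g \<cdot> f = ide A" and g': "g' \<in> hom B A" "f \<cdot> g' = ide B"
    using assms unfolding AB mutually_inverse_def by auto
  have "g = g \<cdot> (f \<cdot> g')" using g g' comp_ide_right by metis
  also have "\<dots> = (g \<cdot> f) \<cdot> g'" using comp_assoc[OF g'(1) f g(1)] by simp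
  also have "\<dots> = g'" using g(2) comp_ide_left[OF g'(1)] by simp
  finally show ?thesis .
qed

lemma inv_arr_eq: "mutually_inverse A B f g \<Longrightarrow> inv_arr f = g"
  unfolding inv_arr_def using mutually_inverse_unique by (intro the_equality) blast+

lemma is_iso_imp_is_mono:
  assumes "is_iso A B f"
  shows "is_mono A B f"
proof -
  obtain f' where f: "f \<in> hom A B" and f': "f' \<in> hom B A" "f' \<cdot> f = ide A"
    using assms unfolding is_iso_def mutually_inverse_def by blast
  have "g = f' \<cdot> (f \<cdot> g)" if "g \<in> hom X A" for X g
    using comp_assoc[OF that f f'(1)] f'(2) comp_ide_left[OF that] by simp
  then show ?thesis unfolding is_mono_def using f by metis
qed

end

text \<open>Source and target are total functions and the composite of any two arrows has a source and a target,
even where the composite means nothing. Typing conditions are then unconditional equations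
that the simplifier solves. The structure maps of the direct sum are not defined but
characterised by their composites with the projections, so that a model may realise them strictly.\<close>

locale additive_category =
  fixes dom cod :: "'m \<Rightarrow> 'o"
    and ide :: "'o \<Rightarrow> 'm"
    and comp :: "'m \<Rightarrow> 'm \<Rightarrow> 'm"  (infixr "\<cdot>" 55)
    and zero :: "'o \<Rightarrow> 'o \<Rightarrow> 'm"
    and add :: "'m \<Rightarrow> 'm \<Rightarrow> 'm"  (infixl "\<^bold>+" 54)
    and sum_obj :: "'o \<Rightarrow> 'o \<Rightarrow> 'o"  (infixl "\<oplus>\<^sub>o" 65)
    and sum_arr :: "'m \<Rightarrow> 'm \<Rightarrow> 'm"  (infixl "\<oplus>\<^sub>a" 65)
    and zero_obj :: "'o"
    and in1 in2 pr1 pr2 :: "'o \<Rightarrow> 'o \<Rightarrow> 'm"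
    and sum_assoc :: "'o \<Rightarrow> 'o \<Rightarrow> 'o \<Rightarrow> 'm"
    and sum_lunit :: "'o \<Rightarrow> 'm"
    and sum_runit :: "'o \<Rightarrow> 'm"
    and sum_braid :: "'o \<Rightarrow> 'o \<Rightarrow> 'm"
  assumes dom_ide [simp]: "dom (ide A) = A"
    and cod_ide [simp]: "cod (ide A) = A"
    and dom_comp [simp]: "dom (g \<cdot> f) = dom f"
    and cod_comp [simp]: "cod (g \<cdot> f) = cod g"
    and dom_zero [simp]: "dom (zero A B) = A"
    and cod_zero [simp]: "cod (zero A B) = B"
    and dom_add [simp]: "dom (f \<^bold>+ g) = dom g"
    and cod_add [simp]: "cod (f \<^bold>+ g) = cod g"
    and dom_sum [simp]: "dom (f \<oplus>\<^sub>a g) = dom f \<oplus>\<^sub>o dom g"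
    and cod_sum [simp]: "cod (f \<oplus>\<^sub>a g) = cod f \<oplus>\<^sub>o cod g"
    and dom_in1 [simp]: "dom (in1 A B) = A" and cod_in1 [simp]: "cod (in1 A B) = A \<oplus>\<^sub>o B"
    and dom_in2 [simp]: "dom (in2 A B) = B" and cod_in2 [simp]: "cod (in2 A B) = A \<oplus>\<^sub>o B"
    and dom_pr1 [simp]: "dom (pr1 A B) = A \<oplus>\<^sub>o B" and cod_pr1 [simp]: "cod (pr1 A B) = A"
    and dom_pr2 [simp]: "dom (pr2 A B) = A \<oplus>\<^sub>o B" and cod_pr2 [simp]: "cod (pr2 A B) = B"
    and dom_sum_assoc [simp]: "dom (sum_assoc A B C) = A \<oplus>\<^sub>o B \<oplus>\<^sub>o C"
    and cod_sum_assoc [simp]: "cod (sum_assoc A B C) = A \<oplus>\<^sub>o (B \<oplus>\<^sub>o C)"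
    and dom_sum_braid [simp]: "dom (sum_braid A B) = A \<oplus>\<^sub>o B"
    and cod_sum_braid [simp]: "cod (sum_braid A B) = B \<oplus>\<^sub>o A"
    and ide_comp [simp]: "cod f = B \<Longrightarrow> ide B \<cdot> f = f"
    and comp_ide [simp]: "dom f = A \<Longrightarrow> f \<cdot> ide A = f"
    and comp_right_assoc [simp]: "\<lbrakk>dom h = cod g; dom g = cod f\<rbrakk> \<Longrightarrow> (h \<cdot> g) \<cdot> f = h \<cdot> (g \<cdot> f)"
    and comp_zero_left [simp]: "cod f = A \<Longrightarrow> zero A B \<cdot> f = zero (dom f) B"
    and comp_zero_right [simp]: "dom f = B \<Longrightarrow> f \<cdot> zero A B = zero A (cod f)"
    and comp_add_left [simp]: "\<lbrakk>dom g = cod f; dom g' = cod f; cod g = cod g'\<rbrakk> \<Longrightarrow>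
          (g \<^bold>+ g') \<cdot> f = (g \<cdot> f \<^bold>+ g' \<cdot> f)"
    and comp_add_right [simp]: "\<lbrakk>dom g = cod f; dom g = cod f'; dom f = dom f'\<rbrakk> \<Longrightarrow>
          g \<cdot> (f \<^bold>+ f') = (g \<cdot> f \<^bold>+ g \<cdot> f')"
    and add_zero_left [simp]: "\<lbrakk>dom f = A; cod f = B\<rbrakk> \<Longrightarrow> (zero A B \<^bold>+ f) = f"
    and add_zero_right [simp]: "\<lbrakk>dom f = A; cod f = B\<rbrakk> \<Longrightarrow> (f \<^bold>+ zero A B) = f"
    and ide_zero_obj: "ide zero_obj = zero zero_obj zero_obj"
    and pr1_in1 [simp]: "pr1 A B \<cdot> in1 A B = ide A"
    and pr1_in2 [simp]: "pr1 A B \<cdot> in2 A B = zero B A"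
    and pr2_in1 [simp]: "pr2 A B \<cdot> in1 A B = zero A B"
    and pr2_in2 [simp]: "pr2 A B \<cdot> in2 A B = ide B"
    and in_pr: "(in1 A B \<cdot> pr1 A B \<^bold>+ in2 A B \<cdot> pr2 A B) = ide (A \<oplus>\<^sub>o B)"
    and pr1_sum [simp]: "\<lbrakk>cod f = A; cod g = B\<rbrakk> \<Longrightarrow> pr1 A B \<cdot> (f \<oplus>\<^sub>a g) = f \<cdot> pr1 (dom f) (dom g)"
    and pr2_sum [simp]: "\<lbrakk>cod f = A; cod g = B\<rbrakk> \<Longrightarrow> pr2 A B \<cdot> (f \<oplus>\<^sub>a g) = g \<cdot> pr2 (dom f) (dom g)"
    and pr1_assoc [simp]: "pr1 A (B \<oplus>\<^sub>o C) \<cdot> sum_assoc A B C = pr1 A B \<cdot> pr1 (A \<oplus>\<^sub>o B) C"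
    and pr1_pr2_assoc [simp]:
          "pr1 B C \<cdot> (pr2 A (B \<oplus>\<^sub>o C) \<cdot> sum_assoc A B C) = pr2 A B \<cdot> pr1 (A \<oplus>\<^sub>o B) C"
    and pr2_pr2_assoc [simp]: "pr2 B C \<cdot> (pr2 A (B \<oplus>\<^sub>o C) \<cdot> sum_assoc A B C) = pr2 (A \<oplus>\<^sub>o B) C"
    and sum_lunit_eq: "sum_lunit A = pr2 zero_obj A"
    and sum_runit_eq: "sum_runit A = pr1 A zero_obj"
    and pr1_braid [simp]: "pr1 B A \<cdot> sum_braid A B = pr2 A B"
    and pr2_braid [simp]: "pr2 B A \<cdot> sum_braid A B = pr1 A B"
begin

definition hom :: "'o \<Rightarrow> 'o \<Rightarrow> 'm set" where
  "hom A B = {f. dom f = A \<and> cod f = B}"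

lemma in_hom [simp]: "f \<in> hom A B \<longleftrightarrow> dom f = A \<and> cod f = B"
  by (simp add: hom_def)

sublocale category hom ide comp
  by unfold_locales auto

text \<open>Composites are kept associated to the right, so an equation \<open>g \<cdot> f = k\<close> is also needed where
\<open>f\<close> is followed by a further factor. This rule produces the second form of each equation below.\<close>

lemma assoc_cong: "\<lbrakk>g \<cdot> f = k; dom g = cod f; cod h = dom f\<rbrakk> \<Longrightarrow> g \<cdot> (f \<cdot> h) = k \<cdot> h"
  using comp_right_assoc by force

lemma pr_in_comp [simp]:
  "cod h = A \<Longrightarrow> pr1 A B \<cdot> (in1 A B \<cdot> h) = h"
  "cod h = B \<Longrightarrow> pr1 A B \<cdot> (in2 A B \<cdot> h) = zero (dom h) A"
  "cod h = A \<Longrightarrow> pr2 A B \<cdot> (in1 A B \<cdot> h) = zero (dom h) B"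
  "cod h = B \<Longrightarrow> pr2 A B \<cdot> (in2 A B \<cdot> h) = h"
  by (simp_all add: assoc_cong[OF pr1_in1] assoc_cong[OF pr1_in2] assoc_cong[OF pr2_in1]
      assoc_cong[OF pr2_in2])

lemma pr_sum_comp [simp]:
  "\<lbrakk>cod f = A; cod g = B; cod h = dom f \<oplus>\<^sub>o dom g\<rbrakk> \<Longrightarrow>
     pr1 A B \<cdot> ((f \<oplus>\<^sub>a g) \<cdot> h) = f \<cdot> (pr1 (dom f) (dom g) \<cdot> h)"
  "\<lbrakk>cod f = A; cod g = B; cod h = dom f \<oplus>\<^sub>o dom g\<rbrakk> \<Longrightarrow>
     pr2 A B \<cdot> ((f \<oplus>\<^sub>a g) \<cdot> h) = g \<cdot> (pr2 (dom f) (dom g) \<cdot> h)"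
  by (simp_all add: assoc_cong[OF pr1_sum] assoc_cong[OF pr2_sum])

lemma pr_braid_comp [simp]:
  "cod h = A \<oplus>\<^sub>o B \<Longrightarrow> pr1 B A \<cdot> (sum_braid A B \<cdot> h) = pr2 A B \<cdot> h"
  "cod h = A \<oplus>\<^sub>o B \<Longrightarrow> pr2 B A \<cdot> (sum_braid A B \<cdot> h) = pr1 A B \<cdot> h"
  by (simp_all add: assoc_cong[OF pr1_braid] assoc_cong[OF pr2_braid])

lemma pr_assoc_comp [simp]:
  assumes "cod h = A \<oplus>\<^sub>o B \<oplus>\<^sub>o C"
  shows "pr1 A (B \<oplus>\<^sub>o C) \<cdot> (sum_assoc A B C \<cdot> h) = pr1 A B \<cdot> (pr1 (A \<oplus>\<^sub>o B) C \<cdot> h)"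
    and "pr1 B C \<cdot> (pr2 A (B \<oplus>\<^sub>o C) \<cdot> (sum_assoc A B C \<cdot> h)) = pr2 A B \<cdot> (pr1 (A \<oplus>\<^sub>o B) C \<cdot> h)"
    and "pr2 B C \<cdot> (pr2 A (B \<oplus>\<^sub>o C) \<cdot> (sum_assoc A B C \<cdot> h)) = pr2 (A \<oplus>\<^sub>o B) C \<cdot> h"
  using assms assoc_cong[OF pr1_assoc, where h = h] assoc_cong[OF pr1_pr2_assoc, where h = h]
    assoc_cong[OF pr2_pr2_assoc, where h = h] by simp_all

text \<open>The projections are jointly monic. All coherence laws are proved from this rule and its two variants
for three summands.\<close>

lemma sum_eqI:
  assumes "cod f = A \<oplus>\<^sub>o B" "cod g = A \<oplus>\<^sub>o B"
    and "pr1 A B \<cdot> f = pr1 A B \<cdot> g" "pr2 A B \<cdot> f = pr2 A B \<cdot> g"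
  shows "f = g"
proof -
  have "f = (in1 A B \<cdot> pr1 A B \<^bold>+ in2 A B \<cdot> pr2 A B) \<cdot> f"
    using assms(1) by (simp add: in_pr del: comp_add_left)
  also have "\<dots> = (in1 A B \<cdot> pr1 A B \<^bold>+ in2 A B \<cdot> pr2 A B) \<cdot> g"
    using assms by simp
  also have "\<dots> = g"
    using assms(2) by (simp add: in_pr del: comp_add_left)
  finally show ?thesis .
qed

lemma sum_eqI_right:
  assumes "cod f = A \<oplus>\<^sub>o (B \<oplus>\<^sub>o C)" "cod g = A \<oplus>\<^sub>o (B \<oplus>\<^sub>o C)"
    and "pr1 A (B \<oplus>\<^sub>o C) \<cdot> f = pr1 A (B \<oplus>\<^sub>o C) \<cdot> g"
    and "pr1 B C \<cdot> (pr2 A (B \<oplus>\<^sub>o C) \<cdot> f) = pr1 B C \<cdot> (pr2 A (B \<oplus>\<^sub>o C) \<cdot> g)"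
    and "pr2 B C \<cdot> (pr2 A (B \<oplus>\<^sub>o C) \<cdot> f) = pr2 B C \<cdot> (pr2 A (B \<oplus>\<^sub>o C) \<cdot> g)"
  shows "f = g"
  by (rule sum_eqI[OF assms(1,2,3)], rule sum_eqI[OF _ _ assms(4,5)]) simp_all

lemma sum_eqI_left:
  assumes "cod f = A \<oplus>\<^sub>o B \<oplus>\<^sub>o C" "cod g = A \<oplus>\<^sub>o B \<oplus>\<^sub>o C"
    and "pr1 A B \<cdot> (pr1 (A \<oplus>\<^sub>o B) C \<cdot> f) = pr1 A B \<cdot> (pr1 (A \<oplus>\<^sub>o B) C \<cdot> g)"
    and "pr2 A B \<cdot> (pr1 (A \<oplus>\<^sub>o B) C \<cdot> f) = pr2 A B \<cdot> (pr1 (A \<oplus>\<^sub>o B) C \<cdot> g)"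
    and "pr2 (A \<oplus>\<^sub>o B) C \<cdot> f = pr2 (A \<oplus>\<^sub>o B) C \<cdot> g"
  shows "f = g"
  by (rule sum_eqI[OF assms(1,2) _ assms(5)], rule sum_eqI[OF _ _ assms(3,4)]) simp_all

lemma zero_target_eqI:
  assumes "ide A = zero A A" "cod f = A" "cod g = A" "dom f = dom g"
  shows "f = g"
proof -
  have "h = zero (dom h) A" if "cod h = A" for h
  proof -
    have "h = ide A \<cdot> h" using that by simp
    also have "\<dots> = zero A A \<cdot> h" by (simp only: assms(1))
    finally show ?thesis using that by simp
  qed
  then show ?thesis using assms(2-4) by metis
qed

lemma pr_zero_obj:
  "pr1 zero_obj A = zero (zero_obj \<oplus>\<^sub>o A) zero_obj"
  "pr2 A zero_obj = zero (A \<oplus>\<^sub>o zero_obj) zero_obj"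
  by (rule zero_target_eqI[OF ide_zero_obj]; simp)+

lemma mutually_inverseI [intro]:
  "\<lbrakk>dom f = A; cod f = B; dom g = B; cod g = A; g \<cdot> f = ide A; f \<cdot> g = ide B\<rbrakk> \<Longrightarrow>
     mutually_inverse A B f g"
  by (simp add: mutually_inverse_def)

lemma is_isoI:
  "\<lbrakk>dom f = A; cod f = B; dom g = B; cod g = A; g \<cdot> f = ide A; f \<cdot> g = ide B\<rbrakk> \<Longrightarrow> is_iso A B f"
  unfolding is_iso_def by blast

lemma sum_ide [simp]: "ide A \<oplus>\<^sub>a ide B = ide (A \<oplus>\<^sub>o B)"
  by (rule sum_eqI[of _ A B]) simp_all

text \<open>The inverse is written as a sum of arrows only to show that it exists; afterwards it is
used through its composites with the projections.\<close>

abbreviation "assoc_inv A B C \<equiv>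
  (in1 (A \<oplus>\<^sub>o B) C \<cdot> (in1 A B \<cdot> pr1 A (B \<oplus>\<^sub>o C) \<^bold>+ in2 A B \<cdot> pr1 B C \<cdot> pr2 A (B \<oplus>\<^sub>o C))
   \<^bold>+ in2 (A \<oplus>\<^sub>o B) C \<cdot> pr2 B C \<cdot> pr2 A (B \<oplus>\<^sub>o C))"

lemma sum_assoc_inverse:
  "mutually_inverse (A \<oplus>\<^sub>o B \<oplus>\<^sub>o C) (A \<oplus>\<^sub>o (B \<oplus>\<^sub>o C)) (sum_assoc A B C) (assoc_inv A B C)"
proof
  show "assoc_inv A B C \<cdot> sum_assoc A B C = ide (A \<oplus>\<^sub>o B \<oplus>\<^sub>o C)"
    by (rule sum_eqI_left[of _ A B C]) simp_all
  show "sum_assoc A B C \<cdot> assoc_inv A B C = ide (A \<oplus>\<^sub>o (B \<oplus>\<^sub>o C))"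
    by (rule sum_eqI_right[of _ A B C]) simp_all
qed simp_all

lemma inv_sum_assoc: "inv_arr (sum_assoc A B C) = assoc_inv A B C"
  by (rule inv_arr_eq[OF sum_assoc_inverse])

lemma inv_assoc_structure [simp]:
  "dom (inv_arr (sum_assoc A B C)) = A \<oplus>\<^sub>o (B \<oplus>\<^sub>o C)"
  "cod (inv_arr (sum_assoc A B C)) = A \<oplus>\<^sub>o B \<oplus>\<^sub>o C"
  by (simp_all add: inv_sum_assoc)

lemma pr_inv_assoc [simp]:
  "pr1 A B \<cdot> (pr1 (A \<oplus>\<^sub>o B) C \<cdot> inv_arr (sum_assoc A B C)) = pr1 A (B \<oplus>\<^sub>o C)"
  "pr2 A B \<cdot> (pr1 (A \<oplus>\<^sub>o B) C \<cdot> inv_arr (sum_assoc A B C)) = pr1 B C \<cdot> pr2 A (B \<oplus>\<^sub>o C)"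
  "pr2 (A \<oplus>\<^sub>o B) C \<cdot> inv_arr (sum_assoc A B C) = pr2 B C \<cdot> pr2 A (B \<oplus>\<^sub>o C)"
  by (simp_all add: inv_sum_assoc)

lemma pr_inv_assoc_comp [simp]:
  assumes "cod h = A \<oplus>\<^sub>o (B \<oplus>\<^sub>o C)"
  shows "pr1 A B \<cdot> (pr1 (A \<oplus>\<^sub>o B) C \<cdot> (inv_arr (sum_assoc A B C) \<cdot> h)) = pr1 A (B \<oplus>\<^sub>o C) \<cdot> h"
    and "pr2 A B \<cdot> (pr1 (A \<oplus>\<^sub>o B) C \<cdot> (inv_arr (sum_assoc A B C) \<cdot> h)) =
      pr1 B C \<cdot> (pr2 A (B \<oplus>\<^sub>o C) \<cdot> h)"
    and "pr2 (A \<oplus>\<^sub>o B) C \<cdot> (inv_arr (sum_assoc A B C) \<cdot> h) = pr2 B C \<cdot> (pr2 A (B \<oplus>\<^sub>o C) \<cdot> h)"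
  using assms assoc_cong[OF pr_inv_assoc(1), where h = h] assoc_cong[OF pr_inv_assoc(2), where h =
      h]
    assoc_cong[OF pr_inv_assoc(3), where h = h] by simp_all

lemma sum_monoidal:
  "monoidal_category hom ide comp sum_obj sum_arr zero_obj sum_assoc sum_lunit sum_runit"
proof (unfold_locales, unfold in_hom)
  fix A show "is_iso (zero_obj \<oplus>\<^sub>o A) A (sum_lunit A)"
  proof (rule is_isoI)
    show "in2 zero_obj A \<cdot> sum_lunit A = ide (zero_obj \<oplus>\<^sub>o A)"
      by (rule sum_eqI[of _ zero_obj A]) (simp_all add: sum_lunit_eq pr_zero_obj)
  qed (simp_all add: sum_lunit_eq)
next
  fix A show "is_iso (A \<oplus>\<^sub>o zero_obj) A (sum_runit A)"
  proof (rule is_isoI)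
    show "in1 A zero_obj \<cdot> sum_runit A = ide (A \<oplus>\<^sub>o zero_obj)"
      by (rule sum_eqI[of _ A zero_obj]) (simp_all add: sum_runit_eq pr_zero_obj)
  qed (simp_all add: sum_runit_eq)
next
  fix A B C show "is_iso (A \<oplus>\<^sub>o B \<oplus>\<^sub>o C) (A \<oplus>\<^sub>o (B \<oplus>\<^sub>o C)) (sum_assoc A B C)"
    using sum_assoc_inverse unfolding is_iso_def by blast
next
  fix A B C D show "sum_assoc A B (C \<oplus>\<^sub>o D) \<cdot> sum_assoc (A \<oplus>\<^sub>o B) C D =
    (ide A \<oplus>\<^sub>a sum_assoc B C D) \<cdot> sum_assoc A (B \<oplus>\<^sub>o C) D \<cdot> (sum_assoc A B C \<oplus>\<^sub>a ide D)"
    by (rule sum_eqI_right[of _ A B "C \<oplus>\<^sub>o D"], simp_all, rule sum_eqI[of _ C D], simp_all)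
next
  fix A B show "(ide A \<oplus>\<^sub>a sum_lunit B) \<cdot> sum_assoc A zero_obj B = sum_runit A \<oplus>\<^sub>a ide B"
    by (rule sum_eqI[of _ A B]) (simp_all add: sum_lunit_eq sum_runit_eq)
next
  fix f f' g g' A A' A'' B B' B''
  assume "dom f = A \<and> cod f = A'" "dom f' = A' \<and> cod f' = A''"
    "dom g = B \<and> cod g = B'" "dom g' = B' \<and> cod g' = B''"
  then show "(f' \<cdot> f) \<oplus>\<^sub>a (g' \<cdot> g) = (f' \<oplus>\<^sub>a g') \<cdot> (f \<oplus>\<^sub>a g)"
    by - (rule sum_eqI[of _ A'' B''], simp_all)
next
  fix f g h A A' B B' C C'
  assume "dom f = A \<and> cod f = A'" "dom g = B \<and> cod g = B'" "dom h = C \<and> cod h = C'"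
  then show "sum_assoc A' B' C' \<cdot> (f \<oplus>\<^sub>a g \<oplus>\<^sub>a h) = (f \<oplus>\<^sub>a (g \<oplus>\<^sub>a h)) \<cdot> sum_assoc A B C"
    by - (rule sum_eqI_right[of _ A' B' C'], simp_all)
qed (simp_all add: sum_lunit_eq sum_runit_eq)

lemma sum_symmetric_monoidal:
  "symmetric_monoidal_category hom ide comp sum_obj sum_arr zero_obj sum_assoc sum_lunit sum_runit
     sum_braid"
proof -
  interpret add: monoidal_category hom ide comp sum_obj sum_arr zero_obj sum_assoc sum_lunit
      sum_runit
    by (rule sum_monoidal)
  have involutive: "sum_braid B A \<cdot> sum_braid A B = ide (A \<oplus>\<^sub>o B)" for A B
    by (rule sum_eqI[of _ A B]) simp_all
  show ?thesis
  proof (unfold_locales, unfold in_hom)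
    fix A B show "is_iso (A \<oplus>\<^sub>o B) (B \<oplus>\<^sub>o A) (sum_braid A B)"
      by (rule is_isoI[OF _ _ _ _ involutive involutive]) simp_all
  next
    fix f g A A' B B' assume "dom f = A \<and> cod f = A'" "dom g = B \<and> cod g = B'"
    then show "sum_braid A' B' \<cdot> (f \<oplus>\<^sub>a g) = (g \<oplus>\<^sub>a f) \<cdot> sum_braid A B"
      by - (rule sum_eqI[of _ B' A'], simp_all)
  next
    fix A B C
    show "sum_assoc B C A \<cdot> sum_braid A (B \<oplus>\<^sub>o C) \<cdot> sum_assoc A B C =
      (ide B \<oplus>\<^sub>a sum_braid A C) \<cdot> sum_assoc B A C \<cdot> (sum_braid A B \<oplus>\<^sub>a ide C)"
      by (rule sum_eqI_right[of _ B C A]) simp_all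
    show "inv_arr (sum_assoc C A B) \<cdot> sum_braid (A \<oplus>\<^sub>o B) C \<cdot> inv_arr (sum_assoc A B C) =
      (sum_braid A C \<oplus>\<^sub>a ide B) \<cdot> inv_arr (sum_assoc A C B) \<cdot> (ide A \<oplus>\<^sub>a sum_braid B C)"
      by (rule sum_eqI_left[of _ C A B]) simp_all
  qed (simp_all add: involutive sum_lunit_eq sum_runit_eq)
qed

end

section \<open>A bilinear braided product distributes over direct sums\<close>

locale additive_braided_category =
  additive_category dom cod ide comp zero add sum_obj sum_arr zero_obj in1 in2 pr1 pr2
    sum_assoc sum_lunit sum_runit sum_braid
  for dom cod :: "'m \<Rightarrow> 'o"
    and ide :: "'o \<Rightarrow> 'm"
    and comp :: "'m \<Rightarrow> 'm \<Rightarrow> 'm"  (infixr "\<cdot>" 55)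
    and zero :: "'o \<Rightarrow> 'o \<Rightarrow> 'm"
    and add :: "'m \<Rightarrow> 'm \<Rightarrow> 'm"  (infixl "\<^bold>+" 54)
    and sum_obj :: "'o \<Rightarrow> 'o \<Rightarrow> 'o"  (infixl "\<oplus>\<^sub>o" 65)
    and sum_arr :: "'m \<Rightarrow> 'm \<Rightarrow> 'm"  (infixl "\<oplus>\<^sub>a" 65)
    and zero_obj :: "'o"
    and in1 in2 pr1 pr2 :: "'o \<Rightarrow> 'o \<Rightarrow> 'm"
    and sum_assoc :: "'o \<Rightarrow> 'o \<Rightarrow> 'o \<Rightarrow> 'm"
    and sum_lunit :: "'o \<Rightarrow> 'm"
    and sum_runit :: "'o \<Rightarrow> 'm"
    and sum_braid :: "'o \<Rightarrow> 'o \<Rightarrow> 'm" +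
  fixes tens_obj :: "'o \<Rightarrow> 'o \<Rightarrow> 'o"  (infixl "\<otimes>\<^sub>o" 70)
    and tens_arr :: "'m \<Rightarrow> 'm \<Rightarrow> 'm"  (infixl "\<otimes>\<^sub>a" 70)
    and unit :: "'o"
    and assoc :: "'o \<Rightarrow> 'o \<Rightarrow> 'o \<Rightarrow> 'm"
    and lunit :: "'o \<Rightarrow> 'm"
    and runit :: "'o \<Rightarrow> 'm"
    and braid :: "'o \<Rightarrow> 'o \<Rightarrow> 'm"
    and lnull :: "'o \<Rightarrow> 'm"
    and rnull :: "'o \<Rightarrow> 'm"
    and ldist :: "'o \<Rightarrow> 'o \<Rightarrow> 'o \<Rightarrow> 'm"
    and rdist :: "'o \<Rightarrow> 'o \<Rightarrow> 'o \<Rightarrow> 'm"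
  assumes tens_braided:
      "braided_monoidal_category hom ide comp tens_obj tens_arr unit assoc lunit runit braid"
    and tens_zero_left: "zero A B \<otimes>\<^sub>a f = zero (A \<otimes>\<^sub>o dom f) (B \<otimes>\<^sub>o cod f)"
    and tens_zero_right: "f \<otimes>\<^sub>a zero A B = zero (dom f \<otimes>\<^sub>o A) (cod f \<otimes>\<^sub>o B)"
    and tens_add_left: "\<lbrakk>dom f = dom f'; cod f = cod f'\<rbrakk> \<Longrightarrow>
          (f \<^bold>+ f') \<otimes>\<^sub>a g = (f \<otimes>\<^sub>a g \<^bold>+ f' \<otimes>\<^sub>a g)"
    and tens_add_right: "\<lbrakk>dom g = dom g'; cod g = cod g'\<rbrakk> \<Longrightarrow>
          f \<otimes>\<^sub>a (g \<^bold>+ g') = (f \<otimes>\<^sub>a g \<^bold>+ f \<otimes>\<^sub>a g')"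
    and lnull_eq: "lnull A = zero (zero_obj \<otimes>\<^sub>o A) zero_obj"
    and rnull_eq: "rnull A = zero (A \<otimes>\<^sub>o zero_obj) zero_obj"
    and ldist_eq: "ldist A B C =
          (in1 (A \<otimes>\<^sub>o B) (A \<otimes>\<^sub>o C) \<cdot> (ide A \<otimes>\<^sub>a pr1 B C)
           \<^bold>+ in2 (A \<otimes>\<^sub>o B) (A \<otimes>\<^sub>o C) \<cdot> (ide A \<otimes>\<^sub>a pr2 B C))"
    and rdist_eq: "rdist A B C =
          (in1 (A \<otimes>\<^sub>o C) (B \<otimes>\<^sub>o C) \<cdot> (pr1 A B \<otimes>\<^sub>a ide C)
           \<^bold>+ in2 (A \<otimes>\<^sub>o C) (B \<otimes>\<^sub>o C) \<cdot> (pr2 A B \<otimes>\<^sub>a ide C))"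
begin

sublocale add: symmetric_monoidal_category hom ide comp sum_obj sum_arr zero_obj sum_assoc sum_lunit
  sum_runit sum_braid
  by (rule sum_symmetric_monoidal)

sublocale mult: braided_monoidal_category hom ide comp tens_obj tens_arr unit assoc lunit runit
    braid
  by (rule tens_braided)

lemma dom_cod_tens [simp]:
  "dom (f \<otimes>\<^sub>a g) = dom f \<otimes>\<^sub>o dom g" "cod (f \<otimes>\<^sub>a g) = cod f \<otimes>\<^sub>o cod g"
  using mult.tens_hom[of f "dom f" "cod f" g "dom g" "cod g"] by simp_all

lemma dom_cod_structure [simp]:
  "dom (assoc A B C) = A \<otimes>\<^sub>o B \<otimes>\<^sub>o C" "cod (assoc A B C) = A \<otimes>\<^sub>o (B \<otimes>\<^sub>o C)"
  "dom (lunit A) = unit \<otimes>\<^sub>o A" "cod (lunit A) = A"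
  "dom (runit A) = A \<otimes>\<^sub>o unit" "cod (runit A) = A"
  "dom (braid A B) = A \<otimes>\<^sub>o B" "cod (braid A B) = B \<otimes>\<^sub>o A"
  using mult.assoc_iso[of A B C] mult.lunit_iso[of A] mult.runit_iso[of A] mult.braid_iso[of A B]
  by (auto simp: is_iso_def mutually_inverse_def)

lemma tens_comp [simp]:
  "\<lbrakk>dom f' = cod f; dom g' = cod g\<rbrakk> \<Longrightarrow> (f' \<otimes>\<^sub>a g') \<cdot> (f \<otimes>\<^sub>a g) = (f' \<cdot> f) \<otimes>\<^sub>a (g' \<cdot> g)"
  using mult.tens_comp[of f "dom f" "cod f" f' "cod f'" g "dom g" "cod g" g' "cod g'"] by simp

lemma tens_comp_comp [simp]:
  "\<lbrakk>dom f' = cod f; dom g' = cod g; cod h = dom f \<otimes>\<^sub>o dom g\<rbrakk> \<Longrightarrow>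
     (f' \<otimes>\<^sub>a g') \<cdot> ((f \<otimes>\<^sub>a g) \<cdot> h) = ((f' \<cdot> f) \<otimes>\<^sub>a (g' \<cdot> g)) \<cdot> h"
  by (rule assoc_cong) simp_all

lemmas [simp] = mult.tens_ide tens_zero_left tens_zero_right

text \<open>The product with a zero object is a zero object: an object is zero iff its identity is a zero arrow,
and bilinearity preserves zero arrows.\<close>

lemma tens_zero_obj:
  "ide (zero_obj \<otimes>\<^sub>o A) = zero (zero_obj \<otimes>\<^sub>o A) (zero_obj \<otimes>\<^sub>o A)"
  "ide (A \<otimes>\<^sub>o zero_obj) = zero (A \<otimes>\<^sub>o zero_obj) (A \<otimes>\<^sub>o zero_obj)"
  by (simp_all add: ide_zero_obj flip: mult.tens_ide)

text \<open>Naturality moves the associativity isomorphism to the left. An identity on a product is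
  recognised as a product of identities, which needs rules of its own.\<close>

lemma assoc_nat [simp]:
  "\<lbrakk>dom f = A; dom g = B; dom h = C\<rbrakk> \<Longrightarrow>
     (f \<otimes>\<^sub>a (g \<otimes>\<^sub>a h)) \<cdot> assoc A B C = assoc (cod f) (cod g) (cod h) \<cdot> (f \<otimes>\<^sub>a g \<otimes>\<^sub>a h)"
  using mult.assoc_natural[of f A "cod f" g B "cod g" h C "cod h"] by simp

lemma assoc_nat_ide [simp]:
  "dom f = A \<Longrightarrow> (f \<otimes>\<^sub>a ide (B \<otimes>\<^sub>o C)) \<cdot> assoc A B C = assoc (cod f) B C \<cdot> (f \<otimes>\<^sub>a ide B \<otimes>\<^sub>a ide C)"
  using assoc_nat[of f A "ide B" B "ide C" C] by simp

lemma assoc_nat_comp [simp]: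
  "\<lbrakk>dom f = A; dom g = B; dom h = C; cod k = A \<otimes>\<^sub>o B \<otimes>\<^sub>o C\<rbrakk> \<Longrightarrow>
     (f \<otimes>\<^sub>a (g \<otimes>\<^sub>a h)) \<cdot> (assoc A B C \<cdot> k) = assoc (cod f) (cod g) (cod h) \<cdot> ((f \<otimes>\<^sub>a g \<otimes>\<^sub>a h) \<cdot> k)"
  by (subst assoc_cong[OF assoc_nat]) simp_all

lemma braid_nat [simp]:
  "\<lbrakk>dom f = A; dom g = B\<rbrakk> \<Longrightarrow> (g \<otimes>\<^sub>a f) \<cdot> braid A B = braid (cod f) (cod g) \<cdot> (f \<otimes>\<^sub>a g)"
  using mult.braid_natural[of f A "cod f" g B "cod g"] by simp

lemma unit_nat [simp]:
  "dom f = A \<Longrightarrow> f \<cdot> lunit A = lunit (cod f) \<cdot> (ide unit \<otimes>\<^sub>a f)"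
  "dom f = A \<Longrightarrow> f \<cdot> runit A = runit (cod f) \<cdot> (f \<otimes>\<^sub>a ide unit)"
  using mult.lunit_natural[of f A "cod f"] mult.runit_natural[of f A "cod f"] by simp_all

lemma dist_structure [simp]:
  "dom (ldist A B C) = A \<otimes>\<^sub>o (B \<oplus>\<^sub>o C)" "cod (ldist A B C) = A \<otimes>\<^sub>o B \<oplus>\<^sub>o A \<otimes>\<^sub>o C"
  "dom (rdist A B C) = (A \<oplus>\<^sub>o B) \<otimes>\<^sub>o C" "cod (rdist A B C) = A \<otimes>\<^sub>o C \<oplus>\<^sub>o B \<otimes>\<^sub>o C"
  by (simp_all add: ldist_eq rdist_eq)

lemma pr_dist [simp]:
  "pr1 (A \<otimes>\<^sub>o B) (A \<otimes>\<^sub>o C) \<cdot> ldist A B C = ide A \<otimes>\<^sub>a pr1 B C"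
  "pr2 (A \<otimes>\<^sub>o B) (A \<otimes>\<^sub>o C) \<cdot> ldist A B C = ide A \<otimes>\<^sub>a pr2 B C"
  "pr1 (A \<otimes>\<^sub>o C) (B \<otimes>\<^sub>o C) \<cdot> rdist A B C = pr1 A B \<otimes>\<^sub>a ide C"
  "pr2 (A \<otimes>\<^sub>o C) (B \<otimes>\<^sub>o C) \<cdot> rdist A B C = pr2 A B \<otimes>\<^sub>a ide C"
  by (simp_all add: ldist_eq rdist_eq)

lemma pr_dist_comp [simp]:
  "cod h = A \<otimes>\<^sub>o (B \<oplus>\<^sub>o C) \<Longrightarrow>
     pr1 (A \<otimes>\<^sub>o B) (A \<otimes>\<^sub>o C) \<cdot> (ldist A B C \<cdot> h) = (ide A \<otimes>\<^sub>a pr1 B C) \<cdot> h"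
  "cod h = A \<otimes>\<^sub>o (B \<oplus>\<^sub>o C) \<Longrightarrow>
     pr2 (A \<otimes>\<^sub>o B) (A \<otimes>\<^sub>o C) \<cdot> (ldist A B C \<cdot> h) = (ide A \<otimes>\<^sub>a pr2 B C) \<cdot> h"
  "cod h = (A \<oplus>\<^sub>o B) \<otimes>\<^sub>o C \<Longrightarrow>
     pr1 (A \<otimes>\<^sub>o C) (B \<otimes>\<^sub>o C) \<cdot> (rdist A B C \<cdot> h) = (pr1 A B \<otimes>\<^sub>a ide C) \<cdot> h"
  "cod h = (A \<oplus>\<^sub>o B) \<otimes>\<^sub>o C \<Longrightarrow>
     pr2 (A \<otimes>\<^sub>o C) (B \<otimes>\<^sub>o C) \<cdot> (rdist A B C \<cdot> h) = (pr2 A B \<otimes>\<^sub>a ide C) \<cdot> h"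
  by (rule assoc_cong; simp)+

lemma ldist_iso: "is_iso (A \<otimes>\<^sub>o (B \<oplus>\<^sub>o C)) (A \<otimes>\<^sub>o B \<oplus>\<^sub>o A \<otimes>\<^sub>o C) (ldist A B C)"
proof (rule is_isoI)
  let ?g = "((ide A \<otimes>\<^sub>a in1 B C) \<cdot> pr1 (A \<otimes>\<^sub>o B) (A \<otimes>\<^sub>o C)
    \<^bold>+ (ide A \<otimes>\<^sub>a in2 B C) \<cdot> pr2 (A \<otimes>\<^sub>o B) (A \<otimes>\<^sub>o C))"
  show "?g \<cdot> ldist A B C = ide (A \<otimes>\<^sub>o (B \<oplus>\<^sub>o C))"
    by (simp add: in_pr flip: tens_add_right)
  show "ldist A B C \<cdot> ?g = ide (A \<otimes>\<^sub>o B \<oplus>\<^sub>o A \<otimes>\<^sub>o C)"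
    by (rule sum_eqI[of _ "A \<otimes>\<^sub>o B" "A \<otimes>\<^sub>o C"]) simp_all
qed simp_all

lemma rdist_iso: "is_iso ((A \<oplus>\<^sub>o B) \<otimes>\<^sub>o C) (A \<otimes>\<^sub>o C \<oplus>\<^sub>o B \<otimes>\<^sub>o C) (rdist A B C)"
proof (rule is_isoI)
  let ?g = "((in1 A B \<otimes>\<^sub>a ide C) \<cdot> pr1 (A \<otimes>\<^sub>o C) (B \<otimes>\<^sub>o C)
    \<^bold>+ (in2 A B \<otimes>\<^sub>a ide C) \<cdot> pr2 (A \<otimes>\<^sub>o C) (B \<otimes>\<^sub>o C))"
  show "?g \<cdot> rdist A B C = ide ((A \<oplus>\<^sub>o B) \<otimes>\<^sub>o C)"
    by (simp add: in_pr flip: tens_add_left)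
  show "rdist A B C \<cdot> ?g = ide (A \<otimes>\<^sub>o C \<oplus>\<^sub>o B \<otimes>\<^sub>o C)"
    by (rule sum_eqI[of _ "A \<otimes>\<^sub>o C" "B \<otimes>\<^sub>o C"]) simp_all
qed simp_all

lemma mid_swap_structure [simp]:
  "dom (add.mid_swap W X Y Z) = W \<oplus>\<^sub>o X \<oplus>\<^sub>o (Y \<oplus>\<^sub>o Z)"
  "cod (add.mid_swap W X Y Z) = W \<oplus>\<^sub>o Y \<oplus>\<^sub>o (X \<oplus>\<^sub>o Z)"
  by (simp_all add: add.mid_swap_def)

lemma pr_mid_swap [simp]:
  assumes "cod h = W \<oplus>\<^sub>o X \<oplus>\<^sub>o (Y \<oplus>\<^sub>o Z)"
  shows "pr1 W Y \<cdot> (pr1 (W \<oplus>\<^sub>o Y) (X \<oplus>\<^sub>o Z) \<cdot> (add.mid_swap W X Y Z \<cdot> h)) =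
      pr1 W X \<cdot> (pr1 (W \<oplus>\<^sub>o X) (Y \<oplus>\<^sub>o Z) \<cdot> h)"
    and "pr2 W Y \<cdot> (pr1 (W \<oplus>\<^sub>o Y) (X \<oplus>\<^sub>o Z) \<cdot> (add.mid_swap W X Y Z \<cdot> h)) =
      pr1 Y Z \<cdot> (pr2 (W \<oplus>\<^sub>o X) (Y \<oplus>\<^sub>o Z) \<cdot> h)"
    and "pr1 X Z \<cdot> (pr2 (W \<oplus>\<^sub>o Y) (X \<oplus>\<^sub>o Z) \<cdot> (add.mid_swap W X Y Z \<cdot> h)) =
      pr2 W X \<cdot> (pr1 (W \<oplus>\<^sub>o X) (Y \<oplus>\<^sub>o Z) \<cdot> h)"
    and "pr2 X Z \<cdot> (pr2 (W \<oplus>\<^sub>o Y) (X \<oplus>\<^sub>o Z) \<cdot> (add.mid_swap W X Y Z \<cdot> h)) =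
      pr2 Y Z \<cdot> (pr2 (W \<oplus>\<^sub>o X) (Y \<oplus>\<^sub>o Z) \<cdot> h)"
  using assms by (simp_all add: add.mid_swap_def)

text \<open>Distributivity maps are eliminated by their projections, after which naturality moves
the associativity, unit and braiding maps of both sides to the left.\<close>

theorem tight_braided_bimonoidal:
  "tight_braided_bimonoidal_category hom ide comp
     sum_obj sum_arr zero_obj sum_assoc sum_lunit sum_runit sum_braid
     tens_obj tens_arr unit assoc lunit runit braid lnull rnull ldist rdist"
proof (unfold_locales, unfold in_hom)
  show "is_iso (zero_obj \<otimes>\<^sub>o A) zero_obj (lnull A)" for A
    by (rule is_isoI[where g = "zero zero_obj (zero_obj \<otimes>\<^sub>o A)"])
      (simp_all add: lnull_eq tens_zero_obj ide_zero_obj)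
  show "is_iso (A \<otimes>\<^sub>o zero_obj) zero_obj (rnull A)" for A
    by (rule is_isoI[where g = "zero zero_obj (A \<otimes>\<^sub>o zero_obj)"])
      (simp_all add: rnull_eq tens_zero_obj ide_zero_obj)
  show "is_mono (A \<otimes>\<^sub>o (B \<oplus>\<^sub>o C)) (A \<otimes>\<^sub>o B \<oplus>\<^sub>o A \<otimes>\<^sub>o C) (ldist A B C)" for A B C
    by (rule is_iso_imp_is_mono[OF ldist_iso])
  show "is_mono ((A \<oplus>\<^sub>o B) \<otimes>\<^sub>o C) (A \<otimes>\<^sub>o C \<oplus>\<^sub>o B \<otimes>\<^sub>o C) (rdist A B C)" for A B C
    by (rule is_iso_imp_is_mono[OF rdist_iso])
  show "is_iso (A \<otimes>\<^sub>o (B \<oplus>\<^sub>o C)) (A \<otimes>\<^sub>o B \<oplus>\<^sub>o A \<otimes>\<^sub>o C) (ldist A B C)" for A B C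
    by (rule ldist_iso)
  show "is_iso ((A \<oplus>\<^sub>o B) \<otimes>\<^sub>o C) (A \<otimes>\<^sub>o C \<oplus>\<^sub>o B \<otimes>\<^sub>o C) (rdist A B C)" for A B C
    by (rule rdist_iso)
  fix A B C D
  show "sum_assoc (A \<otimes>\<^sub>o D) (B \<otimes>\<^sub>o D) (C \<otimes>\<^sub>o D) \<cdot> (rdist A B D \<oplus>\<^sub>a ide (C \<otimes>\<^sub>o D)) \<cdot> rdist
      (A \<oplus>\<^sub>o B) C D =
       (ide (A \<otimes>\<^sub>o D) \<oplus>\<^sub>a rdist B C D) \<cdot> rdist A (B \<oplus>\<^sub>o C) D \<cdot> (sum_assoc A B C \<otimes>\<^sub>a ide D)"
    by (rule sum_eqI_right[of _ "A \<otimes>\<^sub>o D" "B \<otimes>\<^sub>o D" "C \<otimes>\<^sub>o D"]) simp_all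
  show "sum_assoc (A \<otimes>\<^sub>o B) (A \<otimes>\<^sub>o C) (A \<otimes>\<^sub>o D) \<cdot> (ldist A B C \<oplus>\<^sub>a ide (A \<otimes>\<^sub>o D)) \<cdot> ldist A
      (B \<oplus>\<^sub>o C) D =
       (ide (A \<otimes>\<^sub>o B) \<oplus>\<^sub>a ldist A C D) \<cdot> ldist A B (C \<oplus>\<^sub>o D) \<cdot> (ide A \<otimes>\<^sub>a sum_assoc B C D)"
    by (rule sum_eqI_right[of _ "A \<otimes>\<^sub>o B" "A \<otimes>\<^sub>o C" "A \<otimes>\<^sub>o D"]) simp_all
  show "add.mid_swap (A \<otimes>\<^sub>o C) (A \<otimes>\<^sub>o D) (B \<otimes>\<^sub>o C) (B \<otimes>\<^sub>o D) \<cdot>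
         (ldist A C D \<oplus>\<^sub>a ldist B C D) \<cdot> rdist A B (C \<oplus>\<^sub>o D) =
       (rdist A B C \<oplus>\<^sub>a rdist A B D) \<cdot> ldist (A \<oplus>\<^sub>o B) C D"
    by (rule sum_eqI_left[of _ "A \<otimes>\<^sub>o C" "B \<otimes>\<^sub>o C" "A \<otimes>\<^sub>o D \<oplus>\<^sub>o B \<otimes>\<^sub>o D"], simp_all,
        rule sum_eqI[of _ "A \<otimes>\<^sub>o D" "B \<otimes>\<^sub>o D"], simp_all)
next
  fix A B C D
  show "ldist A (B \<otimes>\<^sub>o C) (B \<otimes>\<^sub>o D) \<cdot> (ide A \<otimes>\<^sub>a ldist B C D) \<cdot> assoc A B (C \<oplus>\<^sub>o D) =
       (assoc A B C \<oplus>\<^sub>a assoc A B D) \<cdot> ldist (A \<otimes>\<^sub>o B) C D"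
    by (rule sum_eqI[of _ "A \<otimes>\<^sub>o (B \<otimes>\<^sub>o C)" "A \<otimes>\<^sub>o (B \<otimes>\<^sub>o D)"]) simp_all
  show "(assoc A C D \<oplus>\<^sub>a assoc B C D) \<cdot> rdist (A \<otimes>\<^sub>o C) (B \<otimes>\<^sub>o C) D \<cdot> (rdist A B C \<otimes>\<^sub>a ide D) =
       rdist A B (C \<otimes>\<^sub>o D) \<cdot> assoc (A \<oplus>\<^sub>o B) C D"
    by (rule sum_eqI[of _ "A \<otimes>\<^sub>o (C \<otimes>\<^sub>o D)" "B \<otimes>\<^sub>o (C \<otimes>\<^sub>o D)"]) simp_all
  show "(assoc A B D \<oplus>\<^sub>a assoc A C D) \<cdot> rdist (A \<otimes>\<^sub>o B) (A \<otimes>\<^sub>o C) D \<cdot> (ldist A B C \<otimes>\<^sub>a ide D) =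
       ldist A (B \<otimes>\<^sub>o D) (C \<otimes>\<^sub>o D) \<cdot> (ide A \<otimes>\<^sub>a rdist B C D) \<cdot> assoc A (B \<oplus>\<^sub>o C) D"
    by (rule sum_eqI[of _ "A \<otimes>\<^sub>o (B \<otimes>\<^sub>o D)" "A \<otimes>\<^sub>o (C \<otimes>\<^sub>o D)"]) simp_all
  show "ldist C A B \<cdot> braid (A \<oplus>\<^sub>o B) C = (braid A C \<oplus>\<^sub>a braid B C) \<cdot> rdist A B C"
    by (rule sum_eqI[of _ "C \<otimes>\<^sub>o A" "C \<otimes>\<^sub>o B"]) simp_all
  show "rdist B C A \<cdot> braid A (B \<oplus>\<^sub>o C) = (braid A B \<oplus>\<^sub>a braid A C) \<cdot> ldist A B C"
    by (rule sum_eqI[of _ "B \<otimes>\<^sub>o A" "C \<otimes>\<^sub>o A"]) simp_all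
  show "ldist A C B \<cdot> (ide A \<otimes>\<^sub>a sum_braid B C) = sum_braid (A \<otimes>\<^sub>o B) (A \<otimes>\<^sub>o C) \<cdot> ldist A B C"
    by (rule sum_eqI[of _ "A \<otimes>\<^sub>o C" "A \<otimes>\<^sub>o B"]) simp_all
  show "rdist B A C \<cdot> (sum_braid A B \<otimes>\<^sub>a ide C) = sum_braid (A \<otimes>\<^sub>o C) (B \<otimes>\<^sub>o C) \<cdot> rdist A B C"
    by (rule sum_eqI[of _ "B \<otimes>\<^sub>o C" "A \<otimes>\<^sub>o C"]) simp_all
  show "(lunit A \<oplus>\<^sub>a lunit B) \<cdot> ldist unit A B = lunit (A \<oplus>\<^sub>o B)"
    by (rule sum_eqI[of _ A B]) simp_all
  show "(runit A \<oplus>\<^sub>a runit B) \<cdot> rdist A B unit = runit (A \<oplus>\<^sub>o B)"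
    by (rule sum_eqI[of _ A B]) simp_all
next
  fix f g h A A' B B' C C'
  assume "dom f = A \<and> cod f = A'" "dom g = B \<and> cod g = B'" "dom h = C \<and> cod h = C'"
  then show "ldist A' B' C' \<cdot> (f \<otimes>\<^sub>a (g \<oplus>\<^sub>a h)) = (f \<otimes>\<^sub>a g \<oplus>\<^sub>a f \<otimes>\<^sub>a h) \<cdot> ldist A B C"
    by - (rule sum_eqI[of _ "A' \<otimes>\<^sub>o B'" "A' \<otimes>\<^sub>o C'"], simp_all)
next
  fix f g h A A' B B' C C'
  assume "dom f = A \<and> cod f = A'" "dom g = B \<and> cod g = B'" "dom h = C \<and> cod h = C'"
  then show "rdist A' B' C' \<cdot> ((f \<oplus>\<^sub>a g) \<otimes>\<^sub>a h) = (f \<otimes>\<^sub>a h \<oplus>\<^sub>a g \<otimes>\<^sub>a h) \<cdot> rdist A B C"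
    by - (rule sum_eqI[of _ "A' \<otimes>\<^sub>o C'" "B' \<otimes>\<^sub>o C'"], simp_all)
next
  show "runit zero_obj = lnull unit" "lunit zero_obj = rnull unit"
    by (rule zero_target_eqI[OF ide_zero_obj]; simp add: lnull_eq rnull_eq)+
qed (simp_all add: lnull_eq rnull_eq sum_lunit_eq sum_runit_eq)

end

section \<open>Arrows of the Ising category\<close>

lemma component_triple [simp]: "component (triple f) c = f c"
  by (cases c) (simp_all add: triple_def)

lemma triple_component [simp]: "triple (component x) = x"
  by (cases x) (simp add: triple_def)

lemma component_eqI: "(\<And>c. component f c = component g c) \<Longrightarrow> f = g"
  by (metis triple_component ext)

text \<open>Matrices carry both dimensions, so every triple of matrices is an arrow between definite objects.\<close>

definition idom :: "iarr \<Rightarrow> iobj" where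
  "idom f = triple (\<lambda>c. dim_col (component f c))"

definition icod :: "iarr \<Rightarrow> iobj" where
  "icod f = triple (\<lambda>c. dim_row (component f c))"

lemma component_idom [simp]: "component (idom f) c = dim_col (component f c)"
  by (simp add: idom_def)

lemma component_icod [simp]: "component (icod f) c = dim_row (component f c)"
  by (simp add: icod_def)

lemma idom_eq_iff: "idom f = A \<longleftrightarrow> (\<forall>c. dim_col (component f c) = component A c)"
  using component_eqI[of "idom f" A] by auto

lemma icod_eq_iff: "icod f = B \<longleftrightarrow> (\<forall>c. dim_row (component f c) = component B c)"
  using component_eqI[of "icod f" B] by auto

lemma ihom_eq: "ihom A B = {f. idom f = A \<and> icod f = B}"
  unfolding ihom_def carrier_mat_def idom_eq_iff icod_eq_iff by blast

lemma idom_eqD: "idom f = idom g \<Longrightarrow> dim_col (component f c) = dim_col (component g c)"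
  by (metis component_idom)

lemma icod_eqD: "icod f = icod g \<Longrightarrow> dim_row (component f c) = dim_row (component g c)"
  by (metis component_icod)

lemma idom_icod_eqD: "idom g = icod f \<Longrightarrow> dim_col (component g c) = dim_row (component f c)"
  by (metis component_idom component_icod)

lemma component_ops [simp]:
  "component (iide A) c = 1\<^sub>m (component A c)"
  "component (icomp g f) c = component g c * component f c"
  "component (izero_arr A B) c = 0\<^sub>m (component B c) (component A c)"
  "component (iadd f g) c = component f c + component g c"
  "component (dsum_obj A B) c = component A c + component B c"
  "component (dsum_arr f g) c = component f c \<boxplus> component g c"
  "component (simple a) c = (if c = a then 1 else 0)"
  "component izero c = 0"
  by (simp_all add: iide_def icomp_def izero_arr_def iadd_def dsum_obj_def dsum_arr_def simple_def)
    (cases c; simp add: izero_def)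

lemma component_ione [simp]: "component ione c = (if c = Vac then 1 else 0)"
  by (cases c) (simp_all add: ione_def)

lemma mult_entry:
  "\<lbrakk>i < dim_row M; j < dim_col N; dim_col M = dim_row N\<rbrakk> \<Longrightarrow>
     (M * N) $$ (i, j) = (\<Sum>k<dim_row N. M $$ (i, k) * N $$ (k, j))"
  by (auto simp: scalar_prod_def lessThan_atLeast0 intro!: sum.cong)

definition iscale :: "complex \<Rightarrow> iarr \<Rightarrow> iarr" where
  "iscale x f = triple (\<lambda>c. x \<cdot>\<^sub>m component f c)"

lemma component_iscale [simp]: "component (iscale x f) c = x \<cdot>\<^sub>m component f c"
  by (simp add: iscale_def)

lemma idom_icod [simp]:
  "idom (iide A) = A" "icod (iide A) = A"
  "idom (icomp g f) = idom f" "icod (icomp g f) = icod g"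
  "idom (izero_arr A B) = A" "icod (izero_arr A B) = B"
  "idom (iadd f g) = idom g" "icod (iadd f g) = icod g"
  "idom (dsum_arr f g) = dsum_obj (idom f) (idom g)"
  "icod (dsum_arr f g) = dsum_obj (icod f) (icod g)"
  "idom (iscale x f) = idom f" "icod (iscale x f) = icod f"
  by (rule component_eqI; simp add: block_diag_def)+

lemma icomp_ide_left [simp]: "icod f = B \<Longrightarrow> icomp (iide B) f = f"
  by (rule component_eqI) (auto simp: left_mult_one_mat[OF carrier_matI])

lemma icomp_ide_right [simp]: "idom f = A \<Longrightarrow> icomp f (iide A) = f"
  by (rule component_eqI) (auto simp: right_mult_one_mat[OF carrier_matI])

lemma icomp_assoc [simp]:
  assumes "idom h = icod g" "idom g = icod f"
  shows "icomp (icomp h g) f = icomp h (icomp g f)"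
  by (rule component_eqI, simp, rule assoc_mult_mat[OF carrier_matI carrier_matI carrier_matI])
    (simp_all add: assms[THEN idom_icod_eqD])

lemma icomp_zero [simp]:
  "icod f = A \<Longrightarrow> icomp (izero_arr A B) f = izero_arr (idom f) B"
  "idom f = B \<Longrightarrow> icomp f (izero_arr A B) = izero_arr A (icod f)"
  by (rule component_eqI; auto)+

lemma icomp_add_left [simp]:
  assumes "idom g = icod f" "idom g' = icod f" "icod g = icod g'"
  shows "icomp (iadd g g') f = iadd (icomp g f) (icomp g' f)"
  by (rule component_eqI, simp, rule add_mult_distrib_mat[OF carrier_matI carrier_matI
      carrier_matI])
    (simp_all add: assms(1,2)[THEN idom_icod_eqD] icod_eqD[OF assms(3)])

lemma icomp_add_right [simp]:
  assumes "idom g = icod f" "idom g = icod f'" "idom f = idom f'"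
  shows "icomp g (iadd f f') = iadd (icomp g f) (icomp g f')"
  by (rule component_eqI, simp, rule mult_add_distrib_mat[OF carrier_matI carrier_matI
      carrier_matI])
    (simp_all add: assms(1,2)[THEN idom_icod_eqD, symmetric] idom_eqD[OF assms(3)])

lemma iadd_zero [simp]:
  "\<lbrakk>idom f = A; icod f = B\<rbrakk> \<Longrightarrow> iadd (izero_arr A B) f = f"
  "\<lbrakk>idom f = A; icod f = B\<rbrakk> \<Longrightarrow> iadd f (izero_arr A B) = f"
  by (rule component_eqI; auto)+

lemma icomp_scale [simp]:
  assumes "idom g = icod f"
  shows "icomp (iscale x g) f = iscale x (icomp g f)" "icomp g (iscale x f) = iscale x (icomp g f)"
  by (rule component_eqI, simp add: mult_smult_assoc_mat[OF carrier_matI carrier_matI]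
      mult_smult_distrib[OF carrier_matI carrier_matI] idom_icod_eqD[OF assms])+

lemma iide_izero: "iide izero = izero_arr izero izero"
  by (rule component_eqI) auto

section \<open>Block diagonal matrices and Kronecker products\<close>

lemma dim_block_diag [simp]:
  "dim_row (M \<boxplus> N) = dim_row M + dim_row N" "dim_col (M \<boxplus> N) = dim_col M + dim_col N"
  by (simp_all add: block_diag_def)

lemma block_diag_entry:
  "\<lbrakk>i < dim_row M + dim_row N; j < dim_col M + dim_col N\<rbrakk> \<Longrightarrow>
     (M \<boxplus> N) $$ (i, j) =
       (if i < dim_row M \<and> j < dim_col M then M $$ (i, j)
        else if dim_row M \<le> i \<and> dim_col M \<le> j then N $$ (i - dim_row M, j - dim_col M) else 0)"
  by (auto simp: block_diag_def)

lemma block_diag_mult [simp]: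
  assumes "dim_col M = dim_row M'" "dim_col N = dim_row N'"
  shows "(M \<boxplus> N) * (M' \<boxplus> N') = (M * M') \<boxplus> (N * N')"
proof -
  have c: "M \<in> carrier_mat (dim_row M) (dim_row M')" "N \<in> carrier_mat (dim_row N) (dim_row N')"
    "M' \<in> carrier_mat (dim_row M') (dim_col M')" "N' \<in> carrier_mat (dim_row N') (dim_col N')"
    using assms by auto
  show ?thesis
    unfolding block_diag_def assms
    by (subst mult_four_block_mat[OF c(1) zero_carrier_mat zero_carrier_mat c(2)
          c(3) zero_carrier_mat zero_carrier_mat c(4)])
      (use assms in \<open>simp add: left_add_zero_mat[OF carrier_matI] right_add_zero_mat[OF
          carrier_matI]\<close>)
qed

lemma block_diag_one [simp]: "1\<^sub>m m \<boxplus> 1\<^sub>m n = 1\<^sub>m (m + n)"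
  by (simp add: block_diag_def)

lemma block_diag_zero [simp]: "0\<^sub>m m n \<boxplus> 0\<^sub>m m' n' = 0\<^sub>m (m + m') (n + n')"
  by (simp add: block_diag_def)

lemma block_diag_add [simp]:
  "\<lbrakk>dim_row M = dim_row M'; dim_col M = dim_col M'; dim_row N = dim_row N'; dim_col N = dim_col N'\<rbrakk>
    \<Longrightarrow> (M + M') \<boxplus> (N + N') = (M \<boxplus> N) + (M' \<boxplus> N')"
  by (rule eq_matI) (auto simp: block_diag_entry)

lemma block_diag_smult [simp]: "x \<cdot>\<^sub>m M \<boxplus> x \<cdot>\<^sub>m N = x \<cdot>\<^sub>m (M \<boxplus> N)"
  by (rule eq_matI) (auto simp: block_diag_entry)

lemma dim_kronecker [simp]:
  "dim_row (M \<odot> N) = dim_row M * dim_row N" "dim_col (M \<odot> N) = dim_col M * dim_col N"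
  by (simp_all add: kronecker_def)

lemma div_mod_less: "i < m * n \<Longrightarrow> i div n < m \<and> i mod n < (n::nat)"
  by (cases "n = 0") (auto simp: less_mult_imp_div_less)

lemma kronecker_entry:
  "\<lbrakk>i < dim_row M * dim_row N; j < dim_col M * dim_col N\<rbrakk> \<Longrightarrow>
     (M \<odot> N) $$ (i, j) =
       M $$ (i div dim_row N, j div dim_col N) * N $$ (i mod dim_row N, j mod dim_col N)"
  by (simp add: kronecker_def)

text \<open>The lexicographic basis of a tensor product is indexed by quotient and remainder, and a sum over
this index set factors. The interchange law of the Kronecker product rests on this.\<close>

lemma sum_div_mod:
  fixes f g :: "nat \<Rightarrow> 'a :: comm_semiring_0"
  shows "(\<Sum>k<m * n. f (k div n) * g (k mod n)) = (\<Sum>a<m. f a) * (\<Sum>b<n. g b)"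
proof -
  have "(\<Sum>k<m * n. f (k div n) * g (k mod n)) =
      (\<Sum>a<m. \<Sum>k = a * n..<a * n + n. f (k div n) * g (k mod n))"
    by (rule sum.nat_group[symmetric])
  also have "\<dots> = (\<Sum>a<m. \<Sum>b<n. f a * g b)"
  proof (rule sum.cong[OF refl])
    fix a
    have "(\<Sum>k = a * n..<a * n + n. f (k div n) * g (k mod n)) =
        (\<Sum>b<n. f ((a * n + b) div n) * g ((a * n + b) mod n))"
      using sum.atLeastLessThan_shift_0[of "\<lambda>k. f (k div n) * g (k mod n)" "a * n" "a * n + n"]
      by (simp add: lessThan_atLeast0)
    also have "\<dots> = (\<Sum>b<n. f a * g b)"
      by (rule sum.cong) auto
    finally show "(\<Sum>k = a * n..<a * n + n. f (k div n) * g (k mod n)) = (\<Sum>b<n. f a * g b)" .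
  qed
  finally show ?thesis by (simp add: sum_product)
qed

lemma kronecker_mult [simp]:
  assumes "dim_col M = dim_row M'" "dim_col N = dim_row N'"
  shows "(M \<odot> N) * (M' \<odot> N') = (M * M') \<odot> (N * N')"
proof (rule eq_matI)
  fix i j assume "i < dim_row ((M * M') \<odot> (N * N'))" "j < dim_col ((M * M') \<odot> (N * N'))"
  then have i: "i < dim_row M * dim_row N" and j: "j < dim_col M' * dim_col N'" by auto
  note ij = div_mod_less[OF i] div_mod_less[OF j]
  have "((M \<odot> N) * (M' \<odot> N')) $$ (i, j) =
      (\<Sum>k<dim_row M' * dim_row N'. (M \<odot> N) $$ (i, k) * (M' \<odot> N') $$ (k, j))"
    using assms i j by (simp add: mult_entry del: index_mult_mat(1))
  also have "\<dots> = (\<Sum>k<dim_row M' * dim_row N'.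
      (M $$ (i div dim_row N, k div dim_row N') * M' $$ (k div dim_row N', j div dim_col N')) *
      (N $$ (i mod dim_row N, k mod dim_row N') * N' $$ (k mod dim_row N', j mod dim_col N')))"
    using assms i j by (intro sum.cong) (auto simp: kronecker_entry)
  also have "\<dots> = (M * M') $$ (i div dim_row N, j div dim_col N') * (N * N') $$
      (i mod dim_row N, j mod dim_col N')"
    using assms ij by (subst sum_div_mod) (simp add: mult_entry del: index_mult_mat(1))
  also have "\<dots> = ((M * M') \<odot> (N * N')) $$ (i, j)"
    using i j by (simp add: kronecker_entry del: index_mult_mat(1))
  finally show "((M \<odot> N) * (M' \<odot> N')) $$ (i, j) = ((M * M') \<odot> (N * N')) $$ (i, j)" .
qed simp_all

lemma kronecker_one [simp]: "1\<^sub>m m \<odot> 1\<^sub>m n = 1\<^sub>m (m * n)"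
proof (rule eq_matI)
  fix i j assume "i < dim_row (1\<^sub>m (m * n))" "j < dim_col (1\<^sub>m (m * n))"
  then have ij: "i < m * n" "j < m * n" by simp_all
  have "i = j \<longleftrightarrow> i div n = j div n \<and> i mod n = j mod n"
    by (metis div_mult_mod_eq)
  then show "(1\<^sub>m m \<odot> 1\<^sub>m n) $$ (i, j) = 1\<^sub>m (m * n) $$ (i, j)"
    using ij div_mod_less[OF ij(1)] div_mod_less[OF ij(2)] by (auto simp: kronecker_entry)
qed simp_all

lemma kronecker_zero [simp]:
  "0\<^sub>m m n \<odot> N = 0\<^sub>m (m * dim_row N) (n * dim_col N)"
  "M \<odot> 0\<^sub>m m n = 0\<^sub>m (dim_row M * m) (dim_col M * n)"
  by (rule eq_matI; auto simp: kronecker_entry dest!: div_mod_less)+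

lemma kronecker_add [simp]:
  "\<lbrakk>dim_row M = dim_row M'; dim_col M = dim_col M'\<rbrakk> \<Longrightarrow> (M + M') \<odot> N = (M \<odot> N) + (M' \<odot> N)"
  "\<lbrakk>dim_row N = dim_row N'; dim_col N = dim_col N'\<rbrakk> \<Longrightarrow> M \<odot> (N + N') = (M \<odot> N) + (M \<odot> N')"
  by (rule eq_matI; auto simp: kronecker_entry dest!: div_mod_less; simp add: algebra_simps)+

lemma kronecker_smult [simp]:
  "(x \<cdot>\<^sub>m M) \<odot> N = x \<cdot>\<^sub>m (M \<odot> N)" "M \<odot> (x \<cdot>\<^sub>m N) = x \<cdot>\<^sub>m (M \<odot> N)"
  by (rule eq_matI; auto simp: kronecker_entry dest!: div_mod_less)+

section \<open>Fusion is a bilinear functor\<close>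

lemma component_fuse_arr:
  "component (fuse_arr f g) Vac = component f Vac \<odot> component g Vac
    \<boxplus> component f Sig \<odot> component g Sig \<boxplus> component f Psi \<odot> component g Psi"
  "component (fuse_arr f g) Sig = component f Vac \<odot> component g Sig
    \<boxplus> component f Sig \<odot> component g Vac \<boxplus> component f Sig \<odot> component g Psi
    \<boxplus> component f Psi \<odot> component g Sig"
  "component (fuse_arr f g) Psi = component f Vac \<odot> component g Psi
    \<boxplus> component f Sig \<odot> component g Sig \<boxplus> component f Psi \<odot> component g Vac"
  by (cases f; cases g; simp)+

lemma component_fuse_obj:
  "component (fuse_obj A B) Vac = component A Vac * component B Vac
    + component A Sig * component B Sig + component A Psi * component B Psi"
  "component (fuse_obj A B) Sig = component A Vac * component B Sig
    + component A Sig * component B Vac + component A Sig * component B Psi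
    + component A Psi * component B Sig"
  "component (fuse_obj A B) Psi = component A Vac * component B Psi
    + component A Sig * component B Sig + component A Psi * component B Vac"
  by (cases A; cases B; simp)+

lemma charge_cases: "\<lbrakk>P Vac; P Sig; P Psi\<rbrakk> \<Longrightarrow> P c"
  by (cases c) simp_all

lemma idom_icod_fuse [simp]:
  "idom (fuse_arr f g) = fuse_obj (idom f) (idom g)"
  "icod (fuse_arr f g) = fuse_obj (icod f) (icod g)"
  by (rule component_eqI, rule charge_cases; simp add: component_fuse_arr component_fuse_obj)+

lemma fuse_ide [simp]: "fuse_arr (iide A) (iide B) = iide (fuse_obj A B)"
  by (rule component_eqI, rule charge_cases)
    (simp_all add: component_fuse_arr component_fuse_obj add.assoc)

lemma fuse_comp [simp]:
  "\<lbrakk>idom f' = icod f; idom g' = icod g\<rbrakk> \<Longrightarrow>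
     icomp (fuse_arr f' g') (fuse_arr f g) = fuse_arr (icomp f' f) (icomp g' g)"
  by (rule component_eqI, rule charge_cases)
    (simp_all add: component_fuse_arr idom_icod_eqD)

lemma fuse_zero [simp]:
  "fuse_arr (izero_arr A B) f = izero_arr (fuse_obj A (idom f)) (fuse_obj B (icod f))"
  "fuse_arr f (izero_arr A B) = izero_arr (fuse_obj (idom f) A) (fuse_obj (icod f) B)"
  by (rule component_eqI, rule charge_cases;
      simp add: component_fuse_arr component_fuse_obj add.assoc)+

lemma fuse_add:
  "\<lbrakk>idom f = idom f'; icod f = icod f'\<rbrakk> \<Longrightarrow>
     fuse_arr (iadd f f') g = iadd (fuse_arr f g) (fuse_arr f' g)"
  "\<lbrakk>idom g = idom g'; icod g = icod g'\<rbrakk> \<Longrightarrow>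
     fuse_arr f (iadd g g') = iadd (fuse_arr f g) (fuse_arr f g')"
  by (rule component_eqI, rule charge_cases;
      simp add: component_fuse_arr idom_eqD[of f f'] icod_eqD[of f f'] idom_eqD[of g g']
        icod_eqD[of g g'])+

lemma fuse_scale [simp]:
  "fuse_arr (iscale x f) g = iscale x (fuse_arr f g)"
  "fuse_arr f (iscale x g) = iscale x (fuse_arr f g)"
  by (rule component_eqI, rule charge_cases; simp add: component_fuse_arr)+

lemma fuse_obj_one [simp]: "fuse_obj ione A = A" "fuse_obj A ione = A"
  by (fact fusion_rules)+

lemma kronecker_one_one [simp]: "1\<^sub>m (Suc 0) \<odot> M = M" "M \<odot> 1\<^sub>m (Suc 0) = M"
  by (rule eq_matI; auto simp: kronecker_entry)+

lemma kronecker_empty [simp]: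
  "1\<^sub>m 0 \<odot> M = 0\<^sub>m 0 0" "M \<odot> 1\<^sub>m 0 = 0\<^sub>m 0 0"
  by (rule eq_matI; auto)+

lemma block_diag_empty [simp]: "0\<^sub>m 0 0 \<boxplus> M = M" "M \<boxplus> 0\<^sub>m 0 0 = M"
  by (rule eq_matI; auto simp: block_diag_entry)+

lemma fuse_ide_one [simp]: "fuse_arr (iide ione) f = f" "fuse_arr f (iide ione) = f"
  by (rule component_eqI, rule charge_cases; simp add: component_fuse_arr)+

section \<open>Biproducts\<close>

lemma component_inj_proj:
  "component (inj1 A B) c =
     mat (component A c + component B c) (component A c) (\<lambda>(i, j). if i = j then 1 else 0)"
  "component (inj2 A B) c =
     mat (component A c + component B c) (component B c) (\<lambda>(i, j). if i =
         component A c + j then 1 else 0)"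
  "component (proj1 A B) c =
     mat (component A c) (component A c + component B c) (\<lambda>(i, j). if j = i then 1 else 0)"
  "component (proj2 A B) c =
     mat (component B c) (component A c + component B c) (\<lambda>(i, j). if j =
         component A c + i then 1 else 0)"
  by (rule eq_matI; auto simp: inj1_def inj2_def proj1_def proj2_def append_rows_def)+

lemma idom_icod_inj_proj [simp]:
  "idom (inj1 A B) = A" "icod (inj1 A B) = dsum_obj A B"
  "idom (inj2 A B) = B" "icod (inj2 A B) = dsum_obj A B"
  "idom (proj1 A B) = dsum_obj A B" "icod (proj1 A B) = A"
  "idom (proj2 A B) = dsum_obj A B" "icod (proj2 A B) = B"
  by (rule component_eqI; simp add: component_inj_proj)+

lemma delta_mult:
  "(if b then 1 else 0) * x = (if b then x else 0 :: 'a :: semiring_1)"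
  "x * (if b then 1 else 0) = (if b then x else 0)"
  by auto

lemma proj_comp_entry:
  "\<lbrakk>icod f = dsum_obj A B; i < component A c; j < component (idom f) c\<rbrakk> \<Longrightarrow>
     component (icomp (proj1 A B) f) c $$ (i, j) = component f c $$ (i, j)"
  "\<lbrakk>icod f = dsum_obj A B; i < component B c; j < component (idom f) c\<rbrakk> \<Longrightarrow>
     component (icomp (proj2 A B) f) c $$ (i, j) = component f c $$ (component A c + i, j)"
  by (simp_all add: icod_eq_iff mult_entry component_inj_proj delta_mult del: index_mult_mat(1))

lemma comp_proj_entry:
  "\<lbrakk>idom f = A; i < component (icod f) c; j < component A c + component B c\<rbrakk> \<Longrightarrow>
     component (icomp f (proj1 A B)) c $$ (i, j) =
       (if j < component A c then component f c $$ (i, j) else 0)"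
  "\<lbrakk>idom f = B; i < component (icod f) c; j < component A c + component B c\<rbrakk> \<Longrightarrow>
     component (icomp f (proj2 A B)) c $$ (i, j) =
       (if j < component A c then 0 else component f c $$ (i, j - component A c))"
proof -
  have shift: "j = a + k \<longleftrightarrow> k = j - a" if "\<not> j < a" for j a k :: nat
    using that by auto
  show "\<lbrakk>idom f = A; i < component (icod f) c; j < component A c + component B c\<rbrakk> \<Longrightarrow>
     component (icomp f (proj1 A B)) c $$ (i, j) =
       (if j < component A c then component f c $$ (i, j) else 0)"
    by (auto simp: idom_eq_iff mult_entry component_inj_proj delta_mult simp del: index_mult_mat(1))
  show "\<lbrakk>idom f = B; i < component (icod f) c; j < component A c + component B c\<rbrakk> \<Longrightarrow>
     component (icomp f (proj2 A B)) c $$ (i, j) =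
       (if j < component A c then 0 else component f c $$ (i, j - component A c))"
    by (cases "j < component A c")
      (auto simp: idom_eq_iff mult_entry component_inj_proj delta_mult shift
        simp del: index_mult_mat(1))
qed

lemma dim_icomp [simp]:
  "dim_row (component (icomp g f) c) = dim_row (component g c)"
  "dim_col (component (icomp g f) c) = dim_col (component f c)"
  by simp_all

lemma proj_inj [simp]:
  "icomp (proj1 A B) (inj1 A B) = iide A"
  "icomp (proj1 A B) (inj2 A B) = izero_arr B A"
  "icomp (proj2 A B) (inj1 A B) = izero_arr A B"
  "icomp (proj2 A B) (inj2 A B) = iide B"
  by (rule component_eqI, rule eq_matI;
      simp add: component_inj_proj proj_comp_entry del: component_ops(2);
          simp add: component_inj_proj)+

lemma inj_proj: "iadd (icomp (inj1 A B) (proj1 A B)) (icomp (inj2 A B) (proj2 A B)) =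
    iide (dsum_obj A B)"
proof (rule component_eqI, rule eq_matI)
  fix c i j
  assume "i < dim_row (component (iide (dsum_obj A B)) c)"
    "j < dim_col (component (iide (dsum_obj A B)) c)"
  then have "i < component A c + component B c" "j < component A c + component B c" by simp_all
  then show "component (iadd (icomp (inj1 A B) (proj1 A B)) (icomp (inj2 A B) (proj2 A B))) c $$
      (i, j) =
      component (iide (dsum_obj A B)) c $$ (i, j)"
    by (auto simp: comp_proj_entry component_inj_proj simp del: component_ops(2))
qed (simp_all add: component_inj_proj)

lemma proj_sum [simp]:
  assumes "icod f = A" "icod g = B"
  shows "icomp (proj1 A B) (dsum_arr f g) = icomp f (proj1 (idom f) (idom g))"
    and "icomp (proj2 A B) (dsum_arr f g) = icomp g (proj2 (idom f) (idom g))"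
  unfolding assms[symmetric]
  by (rule component_eqI, rule eq_matI;
      simp add: proj_comp_entry comp_proj_entry block_diag_entry component_inj_proj
        del: component_ops(2))+

lemma dsum_obj_assoc: "dsum_obj (dsum_obj A B) C = dsum_obj A (dsum_obj B C)"
  by (rule component_eqI) simp

lemma proj_proj:
  "icomp (proj1 A B) (proj1 (dsum_obj A B) C) = proj1 A (dsum_obj B C)"
  "icomp (proj1 B C) (proj2 A (dsum_obj B C)) = icomp (proj2 A B) (proj1 (dsum_obj A B) C)"
  "icomp (proj2 B C) (proj2 A (dsum_obj B C)) = proj2 (dsum_obj A B) C"
  by (rule component_eqI, rule eq_matI;
      simp add: proj_comp_entry component_inj_proj dsum_obj_assoc add.assoc del: component_ops(2);
      simp add: component_inj_proj)+

lemma proj_izero: "proj2 izero A = iide A" "proj1 A izero = iide A"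
  by (rule component_eqI, rule eq_matI; auto simp: component_inj_proj)+

lemma dsum_braid_proj:
  "icomp (proj1 B A) (dsum_braid A B) = proj2 A B"
  "icomp (proj2 B A) (dsum_braid A B) = proj1 A B"
  by (simp_all add: dsum_braid_def flip: icomp_assoc)

section \<open>Finite sums of arrows\<close>

lemma component_iSum [simp]:
  "component (iSum A B J t) c =
     mat (component B c) (component A c) (\<lambda>(p, q). \<Sum>j\<in>J. component (t j) c $$ (p, q))"
  by (simp add: iSum_def)

lemma idom_icod_iSum [simp]: "idom (iSum A B J t) = A" "icod (iSum A B J t) = B"
  by (rule component_eqI; simp)+

lemma iSum_empty [simp]: "iSum A B {} t = izero_arr A B"
  by (rule component_eqI) auto

lemma iSum_insert:
  "\<lbrakk>finite J; j \<notin> J; idom (t j) = A; icod (t j) = B\<rbrakk> \<Longrightarrow>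
     iSum A B (insert j J) t = iadd (t j) (iSum A B J t)"
  by (rule component_eqI, rule eq_matI) auto

lemma iSum_cong: "(\<And>j. j \<in> J \<Longrightarrow> t j = t' j) \<Longrightarrow> iSum A B J t = iSum A B J t'"
  by (rule component_eqI) simp

lemma iSum_reindex: "bij_betw h K J \<Longrightarrow> iSum A B J t = iSum A B K (\<lambda>k. t (h k))"
  by (rule component_eqI, rule eq_matI) (simp_all add: sum.reindex_bij_betw[symmetric])

lemma iSum_Times: "iSum A B (J \<times> K) t = iSum A B J (\<lambda>j. iSum A B K (\<lambda>k. t (j, k)))"
  by (rule component_eqI, rule eq_matI) (simp_all add: sum.cartesian_product)

lemma iSum_single:
  assumes "finite J" "j \<in> J" "idom (t j) = A" "icod (t j) = B"
    and "\<And>i. i \<in> J \<Longrightarrow> i \<noteq> j \<Longrightarrow> t i = izero_arr A B"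
  shows "iSum A B J t = t j"
proof (rule component_eqI, rule eq_matI)
  fix c p q assume "p < dim_row (component (t j) c)" "q < dim_col (component (t j) c)"
  then have pq: "p < component B c" "q < component A c" using assms(3,4) by auto
  have "(\<Sum>i\<in>J. component (t i) c $$ (p, q)) = component (t j) c $$ (p, q)"
    using assms pq by (subst sum.remove[OF assms(1,2)]) (simp add: sum.neutral)
  then show "component (iSum A B J t) c $$ (p, q) = component (t j) c $$ (p, q)"
    using pq by simp
qed (use assms(3,4) in auto)

lemma icomp_iSum:
  assumes "finite J" "\<And>j. j \<in> J \<Longrightarrow> idom (t j) = A \<and> icod (t j) = B" "idom g = B"
  shows "icomp g (iSum A B J t) = iSum A (icod g) J (\<lambda>j. icomp g (t j))"
  using assms(1,2) by induction (simp_all add: assms(3) iSum_insert)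

lemma iSum_icomp:
  assumes "finite J" "\<And>j. j \<in> J \<Longrightarrow> idom (t j) = A \<and> icod (t j) = B" "icod f = A"
  shows "icomp (iSum A B J t) f = iSum (idom f) B J (\<lambda>j. icomp (t j) f)"
  using assms(1,2) by induction (simp_all add: assms(3) iSum_insert)

lemma fuse_iSum_left:
  assumes "finite J" "\<And>j. j \<in> J \<Longrightarrow> idom (t j) = A \<and> icod (t j) = B"
  shows "fuse_arr (iSum A B J t) g =
    iSum (fuse_obj A (idom g)) (fuse_obj B (icod g)) J (\<lambda>j. fuse_arr (t j) g)"
  using assms by induction (simp_all add: iSum_insert fuse_add)

lemma fuse_iSum_right:
  assumes "finite J" "\<And>j. j \<in> J \<Longrightarrow> idom (t j) = A \<and> icod (t j) = B"
  shows "fuse_arr f (iSum A B J t) =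
    iSum (fuse_obj (idom f) A) (fuse_obj (icod f) B) J (\<lambda>j. fuse_arr f (t j))"
  using assms by induction (simp_all add: iSum_insert fuse_add)

section \<open>Decompositions and transformations determined by their parts\<close>

text \<open>A finite biproduct, with inclusions \<open>e\<close> and projections \<open>p\<close> of its parts. Its purpose is that
arrows out of or into \<open>X\<close> may be compared part by part, and that decompositions of two factors
give one of their fusion product.\<close>

locale decomposition =
  fixes X :: iobj and J :: "'i set" and S :: "'i \<Rightarrow> iobj" and e p :: "'i \<Rightarrow> iarr"
  assumes finite [simp]: "finite J"
    and e [simp]: "j \<in> J \<Longrightarrow> idom (e j) = S j" "j \<in> J \<Longrightarrow> icod (e j) = X"
    and p [simp]: "j \<in> J \<Longrightarrow> idom (p j) = X" "j \<in> J \<Longrightarrow> icod (p j) = S j"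
    and orthogonal: "\<lbrakk>i \<in> J; j \<in> J\<rbrakk> \<Longrightarrow>
      icomp (p i) (e j) = (if i = j then iide (S j) else izero_arr (S j) (S i))"
    and complete: "iSum X X J (\<lambda>j. icomp (e j) (p j)) = iide X"
begin

lemma source_eqI:
  assumes "idom f = X" "idom g = X" "icod f = icod g"
    and "\<And>j. j \<in> J \<Longrightarrow> icomp f (e j) = icomp g (e j)"
  shows "f = g"
proof -
  have "h = iSum X (icod h) J (\<lambda>j. icomp (icomp h (e j)) (p j))" if "idom h = X" for h
  proof -
    have "h = icomp h (iSum X X J (\<lambda>j. icomp (e j) (p j)))"
      using that by (simp add: complete)
    also have "\<dots> = iSum X (icod h) J (\<lambda>j. icomp h (icomp (e j) (p j)))"
      using that by (intro icomp_iSum) auto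
    also have "\<dots> = iSum X (icod h) J (\<lambda>j. icomp (icomp h (e j)) (p j))"
      using that by (intro iSum_cong) simp
    finally show ?thesis .
  qed
  note expand = this
  have "f = iSum X (icod f) J (\<lambda>j. icomp (icomp f (e j)) (p j))"
    by (rule expand[OF assms(1)])
  also have "\<dots> = iSum X (icod g) J (\<lambda>j. icomp (icomp g (e j)) (p j))"
    unfolding assms(3) by (rule iSum_cong) (simp only: assms(4))
  also have "\<dots> = g"
    by (rule expand[OF assms(2), symmetric])
  finally show ?thesis .
qed

lemma target_eqI:
  assumes "icod f = X" "icod g = X" "idom f = idom g"
    and "\<And>j. j \<in> J \<Longrightarrow> icomp (p j) f = icomp (p j) g"
  shows "f = g"
proof -
  have "h = iSum (idom h) X J (\<lambda>j. icomp (e j) (icomp (p j) h))" if "icod h = X" for h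
  proof -
    have "h = icomp (iSum X X J (\<lambda>j. icomp (e j) (p j))) h"
      using that by (simp add: complete)
    also have "\<dots> = iSum (idom h) X J (\<lambda>j. icomp (icomp (e j) (p j)) h)"
      using that by (intro iSum_icomp) auto
    also have "\<dots> = iSum (idom h) X J (\<lambda>j. icomp (e j) (icomp (p j) h))"
      using that by (intro iSum_cong) simp
    finally show ?thesis .
  qed
  note expand = this
  have "f = iSum (idom f) X J (\<lambda>j. icomp (e j) (icomp (p j) f))"
    by (rule expand[OF assms(1)])
  also have "\<dots> = iSum (idom g) X J (\<lambda>j. icomp (e j) (icomp (p j) g))"
    unfolding assms(3) by (rule iSum_cong) (simp only: assms(4))
  also have "\<dots> = g"
    by (rule expand[OF assms(2), symmetric])
  finally show ?thesis .
qed

lemma reindex: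
  assumes h: "bij_betw h K J"
  shows "decomposition X K (\<lambda>k. S (h k)) (\<lambda>k. e (h k)) (\<lambda>k. p (h k))"
proof
  have [simp]: "h k \<in> J" if "k \<in> K" for k
    using h that by (rule bij_betw_apply)
  show "finite K" using h bij_betw_finite finite by blast
  show "iSum X X K (\<lambda>k. icomp (e (h k)) (p (h k))) = iide X"
    unfolding complete[symmetric] by (rule iSum_reindex[OF h, symmetric])
  show "icomp (p (h i)) (e (h j)) = (if i = j then iide (S (h j)) else izero_arr (S (h j))
      (S (h i)))"
    if "i \<in> K" "j \<in> K" for i j
    using that h by (auto simp: orthogonal bij_betw_def inj_on_def)
qed (use h in \<open>auto dest: bij_betw_apply\<close>)

end

lemma decomposition_fuse:
  assumes "decomposition X J S e p" "decomposition Y K T e' p'"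
  shows "decomposition (fuse_obj X Y) (J \<times> K) (\<lambda>(j, k). fuse_obj (S j) (T k))
    (\<lambda>(j, k). fuse_arr (e j) (e' k)) (\<lambda>(j, k). fuse_arr (p j) (p' k))"
proof -
  interpret X: decomposition X J S e p by fact
  interpret Y: decomposition Y K T e' p' by fact
  show ?thesis
  proof
    have "iSum (fuse_obj X Y) (fuse_obj X Y) (J \<times> K)
        (\<lambda>j. icomp (case j of (j, k) \<Rightarrow> fuse_arr (e j) (e' k))
            (case j of (j, k) \<Rightarrow> fuse_arr (p j) (p' k))) =
      iSum (fuse_obj X Y) (fuse_obj X Y) J (\<lambda>j. iSum (fuse_obj X Y) (fuse_obj X Y) K
        (\<lambda>k. fuse_arr (icomp (e j) (p j)) (icomp (e' k) (p' k))))"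
      by (subst iSum_Times) (intro iSum_cong, simp)
    also have "\<dots> = iSum (fuse_obj X Y) (fuse_obj X Y) J (\<lambda>j. fuse_arr (icomp (e j) (p j)) (iide Y))"
      by (rule iSum_cong) (simp add: fuse_iSum_right flip: Y.complete)
    also have "\<dots> = fuse_arr (iide X) (iide Y)"
      by (subst X.complete[symmetric], subst fuse_iSum_left) simp_all
    finally show "iSum (fuse_obj X Y) (fuse_obj X Y) (J \<times> K)
        (\<lambda>j. icomp (case j of (j, k) \<Rightarrow> fuse_arr (e j) (e' k))
            (case j of (j, k) \<Rightarrow> fuse_arr (p j) (p' k))) =
      iide (fuse_obj X Y)" by simp
  qed (auto simp: X.orthogonal Y.orthogonal split: if_splits)
qed

lemma component_incl_proj [simp]:
  "component (incl A s) c =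
     mat (component A c) (if c = fst s then 1 else 0) (\<lambda>(i, j). if i = snd s then 1 else 0)"
  "component (proj A s) c =
     mat (if c = fst s then 1 else 0) (component A c) (\<lambda>(i, j). if j = snd s then 1 else 0)"
  by (simp_all add: incl_def proj_def)

lemma idom_icod_incl_proj [simp]:
  "idom (incl A s) = simple (fst s)" "icod (incl A s) = A"
  "idom (proj A s) = A" "icod (proj A s) = simple (fst s)"
  by (rule component_eqI; simp)+

lemma copies_iff: "s \<in> copies A \<longleftrightarrow> snd s < component A (fst s)"
  by (cases s) (simp add: copies_def)

lemma UNIV_charge: "UNIV = {Vac, Sig, Psi}"
  using charge.exhaust by auto

lemma copies_Sigma: "copies A = Sigma UNIV (\<lambda>a. {..<component A a})"
  by (auto simp: copies_def)

lemma finite_UNIV_charge: "finite (UNIV :: charge set)"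
  by (simp add: UNIV_charge)

lemma decomposition_copies:
  "decomposition A (copies A) (\<lambda>s. simple (fst s)) (incl A) (proj A)"
proof
  show "finite (copies A)"
    by (simp add: copies_Sigma finite_UNIV_charge)
next
  fix r s assume r: "r \<in> copies A" and s: "s \<in> copies A"
  show "icomp (proj A r) (incl A s) =
      (if r = s then iide (simple (fst s)) else izero_arr (simple (fst s)) (simple (fst r)))"
  proof (rule component_eqI, rule eq_matI)
    fix c i j
    let ?R = "component (if r = s then iide (simple (fst s)) else izero_arr (simple (fst s))
        (simple (fst r))) c"
    assume "i < dim_row ?R" "j < dim_col ?R"
    then have ij: "i = 0" "j = 0" "fst s = c" "fst r = c" by (auto split: if_splits)
    have "component (icomp (proj A r) (incl A s)) c $$ (i, j) = (if snd r = snd s then 1 else 0)"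
      using r s ij by (simp add: mult_entry delta_mult copies_iff del: index_mult_mat(1))
    then show "component (icomp (proj A r) (incl A s)) c $$ (i, j) = ?R $$ (i, j)"
      using ij by (auto simp: prod_eq_iff)
  qed (simp_all split: if_splits)
next
  show "iSum A A (copies A) (\<lambda>s. icomp (incl A s) (proj A s)) = iide A"
  proof (rule component_eqI, rule eq_matI)
    fix c i j assume "i < dim_row (component (iide A) c)" "j < dim_col (component (iide A) c)"
    then have ij: "i < component A c" "j < component A c" by simp_all
    have entry: "component (icomp (incl A s) (proj A s)) c $$ (i, j) =
        (if s = (c, i) then if i = j then 1 else 0 else 0)" for s
      using ij by (cases s) (auto simp: mult_entry simp del: index_mult_mat(1))
    have "(c, i) \<in> copies A" "finite (copies A)"
      using ij by (simp_all add: copies_iff copies_Sigma finite_UNIV_charge)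
    then show "component (iSum A A (copies A) (\<lambda>s. icomp (incl A s) (proj A s))) c $$ (i, j) =
        component (iide A) c $$ (i, j)"
      using ij by (simp add: entry del: component_ops(2))
  qed simp_all
qed simp_all

text \<open>Between two objects decomposed over the same index set, a family of arrows between corresponding
parts defines an arrow of the whole objects. The associativity and braiding of the fusion product
both have this form.\<close>

locale diagonal_arrow =
  source: decomposition X J S e p + target: decomposition Y J T e' p'
  for X Y :: iobj and J :: "'i set" and S T and e p e' p' :: "'i \<Rightarrow> iarr" +
  fixes k :: "'i \<Rightarrow> iarr"
  assumes k [simp]: "j \<in> J \<Longrightarrow> idom (k j) = S j" "j \<in> J \<Longrightarrow> icod (k j) = T j"
begin

definition diag :: iarr where
  "diag = iSum X Y J (\<lambda>j. icomp (e' j) (icomp (k j) (p j)))"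

lemma idom_icod_diag [simp]: "idom diag = X" "icod diag = Y"
  by (simp_all add: diag_def)

lemma diag_e:
  assumes j: "j \<in> J"
  shows "icomp diag (e j) = icomp (e' j) (k j)"
proof -
  have "icomp diag (e j) = iSum (S j) Y J (\<lambda>i. icomp (icomp (e' i) (icomp (k i) (p i))) (e j))"
    unfolding diag_def using j by (subst iSum_icomp) simp_all
  also have "\<dots> = iSum (S j) Y J (\<lambda>i. if i = j then icomp (e' j) (k j) else izero_arr (S j) Y)"
    using j by (intro iSum_cong) (simp add: source.orthogonal)
  also have "\<dots> = icomp (e' j) (k j)"
    using j by (subst iSum_single[of _ j]) simp_all
  finally show ?thesis .
qed

lemma p_diag:
  assumes j: "j \<in> J"
  shows "icomp (p' j) diag = icomp (k j) (p j)"
proof -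
  have "icomp (p' j) diag = iSum X (T j) J (\<lambda>i. icomp (p' j) (icomp (e' i) (icomp (k i) (p i))))"
    unfolding diag_def using j by (subst icomp_iSum) simp_all
  also have "\<dots> = iSum X (T j) J (\<lambda>i. if i = j then icomp (k j) (p j) else izero_arr X (T j))"
    using j by (intro iSum_cong) (simp add: target.orthogonal flip: icomp_assoc)
  also have "\<dots> = icomp (k j) (p j)"
    using j by (subst iSum_single[of _ j]) simp_all
  finally show ?thesis .
qed

end

text \<open>Naturality may be tested on the matrix entries of \<open>F\<close> and \<open>G\<close> between single parts. For
decompositions into simple objects those entries are subject to Schur's lemma.\<close>

lemma diag_natural:
  assumes "diagonal_arrow X Y J S T e p e' p' k"
    and "diagonal_arrow X' Y' J' S' T' d q d' q' k'"
    and "idom F = X" "icod F = X'" "idom G = Y" "icod G = Y'"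
    and square: "\<And>j j'. j \<in> J \<Longrightarrow> j' \<in> J' \<Longrightarrow>
      icomp (k' j') (icomp (q j') (icomp F (e j))) = icomp (icomp (q' j') (icomp G (e' j))) (k j)"
  shows "icomp (diagonal_arrow.diag X' Y' J' q d' k') F =
      icomp G (diagonal_arrow.diag X Y J p e' k)"
proof -
  interpret A: diagonal_arrow X Y J S T e p e' p' k by fact
  interpret B: diagonal_arrow X' Y' J' S' T' d q d' q' k' by fact
  note [simp] = assms(3-6)
  show ?thesis
  proof (rule A.source.source_eqI)
    fix j assume j: "j \<in> J"
    show "icomp (icomp B.diag F) (e j) = icomp (icomp G A.diag) (e j)"
    proof (rule B.target.target_eqI)
      fix j' assume j': "j' \<in> J'"
      have "icomp (q' j') (icomp (icomp B.diag F) (e j)) =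
          icomp (icomp (q' j') B.diag) (icomp F (e j))"
        using j j' by simp
      also have "\<dots> = icomp (k' j') (icomp (q j') (icomp F (e j)))"
        using j j' by (subst B.p_diag) simp_all
      also have "\<dots> = icomp (q' j') (icomp G (icomp (e' j) (k j)))"
        using j j' by (simp add: square)
      also have "\<dots> = icomp (q' j') (icomp (icomp G A.diag) (e j))"
        using j j' by (simp add: A.diag_e)
      finally show "icomp (q' j') (icomp (icomp B.diag F) (e j)) =
          icomp (q' j') (icomp (icomp G A.diag) (e j))" .
    qed (use j in simp_all)
  qed simp_all
qed

lemma diag_inverse:
  assumes "diagonal_arrow X Y J S T e p e' p' k" "diagonal_arrow Y X J T S e' p' e p l"
    and inverse: "\<And>j. j \<in> J \<Longrightarrow> icomp (l j) (k j) = iide (S j)"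
  shows "icomp (diagonal_arrow.diag Y X J p' e l) (diagonal_arrow.diag X Y J p e' k) = iide X"
proof -
  interpret A: diagonal_arrow X Y J S T e p e' p' k by fact
  interpret B: diagonal_arrow Y X J T S e' p' e p l by fact
  show ?thesis
  proof (rule A.source.source_eqI)
    fix j assume j: "j \<in> J"
    have "icomp (icomp B.diag A.diag) (e j) = icomp (icomp B.diag (e' j)) (k j)"
      using j by (simp add: A.diag_e)
    also have "\<dots> = icomp (e j) (icomp (l j) (k j))"
      using j by (subst B.diag_e) simp_all
    also have "\<dots> = icomp (iide X) (e j)"
      using j by (simp add: inverse)
    finally show "icomp (icomp B.diag A.diag) (e j) = icomp (iide X) (e j)" .
  qed simp_all
qed

section \<open>Naturality and invertibility of associativity and braiding\<close>

lemma decomposition_fuse_left: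
  "decomposition (fuse_obj (fuse_obj A B) C) (copies A \<times> copies B \<times> copies C)
     (\<lambda>(r, s, t). fuse_obj (fuse_obj (simple (fst r)) (simple (fst s))) (simple (fst t)))
     (\<lambda>(r, s, t). fuse_arr (fuse_arr (incl A r) (incl B s)) (incl C t))
     (\<lambda>(r, s, t). fuse_arr (fuse_arr (proj A r) (proj B s)) (proj C t))"
proof -
  have h: "bij_betw (\<lambda>(r, s, t). ((r, s), t)) (copies A \<times> copies B \<times> copies C)
      ((copies A \<times> copies B) \<times> copies C)"
    by (rule bij_betw_byWitness[where f' = "\<lambda>((r, s), t). (r, s, t)"]) auto
  show ?thesis
    using decomposition.reindex[OF decomposition_fuse[OF decomposition_fuse[OF
          decomposition_copies[of A] decomposition_copies[of B]] decomposition_copies[of C]] h]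
    by (simp add: split_def)
qed

lemma decomposition_fuse_right:
  "decomposition (fuse_obj A (fuse_obj B C)) (copies A \<times> copies B \<times> copies C)
     (\<lambda>(r, s, t). fuse_obj (simple (fst r)) (fuse_obj (simple (fst s)) (simple (fst t))))
     (\<lambda>(r, s, t). fuse_arr (incl A r) (fuse_arr (incl B s) (incl C t)))
     (\<lambda>(r, s, t). fuse_arr (proj A r) (fuse_arr (proj B s) (proj C t)))"
  using decomposition_fuse[OF decomposition_copies[of A]
      decomposition_fuse[OF decomposition_copies[of B] decomposition_copies[of C]]]
  by (simp add: split_def)

lemma decomposition_swap:
  "decomposition (fuse_obj B A) (copies A \<times> copies B)
     (\<lambda>(r, s). fuse_obj (simple (fst s)) (simple (fst r)))
     (\<lambda>(r, s). fuse_arr (incl B s) (incl A r)) (\<lambda>(r, s). fuse_arr (proj B s) (proj A r))"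
proof -
  have h: "bij_betw (\<lambda>(r, s). (s, r)) (copies A \<times> copies B) (copies B \<times> copies A)"
    by (rule bij_betw_byWitness[where f' = "\<lambda>(s, r). (r, s)"]) auto
  show ?thesis
    using decomposition.reindex[OF decomposition_fuse[OF
          decomposition_copies[of B] decomposition_copies[of A]] h]
    by (simp add: split_def)
qed

lemma iscale_izero [simp]: "iscale x (izero_arr A B) = izero_arr A B"
  by (rule component_eqI) auto

lemma iscale_commute: "iscale x (iscale y f) = iscale y (iscale x f)"
  by (rule component_eqI) (auto simp: mult.left_commute)

text \<open>Schur's lemma. Between simple objects of charges \<open>a\<close> and \<open>b\<close> a matrix has an entry only in the component
of a charge equal to both.\<close>

lemma simple_arrow_cases:
  assumes "idom f = simple a" "icod f = simple b"
  obtains "a \<noteq> b" "f = izero_arr (simple a) (simple b)"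
    | x where "a = b" "f = iscale x (iide (simple a))"
proof (cases "a = b")
  case True
  have "f = iscale (component f a $$ (0, 0)) (iide (simple a))"
    using assms True by (intro component_eqI eq_matI)
        (auto simp: idom_eq_iff icod_eq_iff split: if_splits)
  then show ?thesis using that True by blast
next
  case False
  have "f = izero_arr (simple a) (simple b)"
    using assms False by (intro component_eqI eq_matI)
        (auto simp: idom_eq_iff icod_eq_iff split: if_splits)
  then show ?thesis using that False by blast
qed

lemma fuse_obj_simple:
  "fuse_obj (simple Sig) (simple Psi) = simple Sig"
  "fuse_obj (simple Psi) (simple Sig) = simple Sig"
  "fuse_obj (simple Psi) (simple Psi) = simple Vac"
  "fuse_obj (simple Vac) A = A" "fuse_obj A (simple Vac) = A"
  by (simp_all add: fusion_rules)

lemma idom_icod_assoc_simple [simp]: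
  "idom (assoc_simple a b c) = fuse_obj (fuse_obj (simple a) (simple b)) (simple c)"
  "icod (assoc_simple a b c) = fuse_obj (simple a) (fuse_obj (simple b) (simple c))"
  by (cases a; cases b; cases c;
      simp add: fuse_obj_simple idom_def icod_def triple_def mat_of_rows_list_def;
      simp add: simple_def triple_def)+

lemma idom_icod_braid_simple [simp]:
  "idom (braid_simple a b) = fuse_obj (simple a) (simple b)"
  "icod (braid_simple a b) = fuse_obj (simple b) (simple a)"
  by (cases a; cases b; simp add: fuse_obj_simple idom_def icod_def triple_def;
      simp add: simple_def triple_def)+

text \<open>Between different simple objects there are only zero arrows, and scalars pass through the bilinear
product. So any arrow of the right type would be natural here; the values of the associativity
matter only for the pentagon and the hexagons.\<close>

lemma assoc_simple_natural:
  assumes "idom f = simple a" "icod f = simple a'" "idom g = simple b" "icod g = simple b'"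
    and "idom h = simple c" "icod h = simple c'"
  shows "icomp (assoc_simple a' b' c') (fuse_arr (fuse_arr f g) h) =
    icomp (fuse_arr f (fuse_arr g h)) (assoc_simple a b c)"
  by (rule simple_arrow_cases[OF assms(1,2)]; rule simple_arrow_cases[OF assms(3,4)];
      rule simple_arrow_cases[OF assms(5,6)]; simp)

lemma braid_simple_natural:
  assumes "idom f = simple a" "icod f = simple a'" "idom g = simple b" "icod g = simple b'"
  shows "icomp (braid_simple a' b') (fuse_arr f g) = icomp (fuse_arr g f) (braid_simple a b)"
  by (rule simple_arrow_cases[OF assms(1,2)]; rule simple_arrow_cases[OF assms(3,4)];
      simp add: iscale_commute)

lemma fuse_obj_assoc: "fuse_obj (fuse_obj A B) C = fuse_obj A (fuse_obj B C)"
  by (cases A; cases B; cases C) (simp add: algebra_simps)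

text \<open>The two ways of bracketing three simple objects are the same object, and the associativity is its
own inverse: it is an identity, a diagonal matrix of signs, or the symmetric orthogonal matrix of
\<open>(\<sigma>\<sigma>)\<sigma>\<close>.\<close>

lemma assoc_simple_involution:
  "icomp (assoc_simple a b c) (assoc_simple a b c) =
     iide (fuse_obj (fuse_obj (simple a) (simple b)) (simple c))"
proof (cases "(a, b, c) = (Sig, Sig, Sig)")
  case True
  let ?F = "complex_of_real (1 / sqrt 2) \<cdot>\<^sub>m mat_of_rows_list 2 [[1, 1], [1, -1]] :: complex mat"
  have "?F * ?F = 1\<^sub>m 2"
    by (rule eq_matI)
      (auto simp: mat_of_rows_list_def scalar_prod_def numeral_2_eq_2 less_Suc_eq
        simp flip: of_real_mult)
  then show ?thesis
    using True by (simp add: icomp_def iide_def triple_def simple_def numeral_2_eq_2)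
next
  case False
  have "(-1 \<cdot>\<^sub>m 1\<^sub>m 1) * (-1 \<cdot>\<^sub>m 1\<^sub>m 1) = (1\<^sub>m 1 :: complex mat)"
    by (rule eq_matI) auto
  then show ?thesis
    using False
    by (cases a; cases b; cases c; simp add: fuse_obj_assoc;
        simp add: icomp_def iide_def triple_def simple_def)
qed

text \<open>The braiding of two simple objects is a non-zero scalar on each channel; the witness
inverts these scalars.\<close>

lemma braid_simple_inverse:
  "\<exists>g. idom g = fuse_obj (simple b) (simple a) \<and> icod g = fuse_obj (simple a) (simple b) \<and>
     icomp g (braid_simple a b) = iide (fuse_obj (simple a) (simple b)) \<and>
     icomp (braid_simple a b) g = iide (fuse_obj (simple b) (simple a))"
proof -
  let ?g = "triple (\<lambda>c. if component (fuse_obj (simple a) (simple b)) c = 1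
    then inverse (component (braid_simple a b) c $$ (0, 0)) \<cdot>\<^sub>m 1\<^sub>m 1 else 1\<^sub>m 0)"
  have mult: "(x \<cdot>\<^sub>m 1\<^sub>m 1) * (y \<cdot>\<^sub>m 1\<^sub>m 1) = (x * y) \<cdot>\<^sub>m (1\<^sub>m 1 :: complex mat)" for x y
    by (rule eq_matI) auto
  have [simp]: "(1 \<cdot>\<^sub>m 1\<^sub>m (Suc 0)) = (1\<^sub>m (Suc 0) :: complex mat)" by (rule eq_matI) auto
  have [simp]: "ising_w \<noteq> 0" by (simp add: ising_w_def)
  have "idom ?g = fuse_obj (simple b) (simple a)" "icod ?g = fuse_obj (simple a) (simple b)"
    "icomp ?g (braid_simple a b) = iide (fuse_obj (simple a) (simple b))"
    "icomp (braid_simple a b) ?g = iide (fuse_obj (simple b) (simple a))"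
    by (cases a; cases b; rule component_eqI, rule charge_cases;
        simp add: fuse_obj_simple component_fuse_obj mult[simplified])+
  then show ?thesis by blast
qed

lemma diagonal_fuse_assoc:
  "diagonal_arrow (fuse_obj (fuse_obj A B) C) (fuse_obj A (fuse_obj B C))
      (copies A \<times> copies B \<times> copies C)
     (\<lambda>(r, s, t). fuse_obj (fuse_obj (simple (fst r)) (simple (fst s))) (simple (fst t)))
     (\<lambda>(r, s, t). fuse_obj (simple (fst r)) (fuse_obj (simple (fst s)) (simple (fst t))))
     (\<lambda>(r, s, t). fuse_arr (fuse_arr (incl A r) (incl B s)) (incl C t))
     (\<lambda>(r, s, t). fuse_arr (fuse_arr (proj A r) (proj B s)) (proj C t))
     (\<lambda>(r, s, t). fuse_arr (incl A r) (fuse_arr (incl B s) (incl C t)))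
     (\<lambda>(r, s, t). fuse_arr (proj A r) (fuse_arr (proj B s) (proj C t)))
     (\<lambda>(r, s, t). assoc_simple (fst r) (fst s) (fst t))"
  by (intro diagonal_arrow.intro decomposition_fuse_left decomposition_fuse_right
      diagonal_arrow_axioms.intro) auto

lemma diagonal_fuse_assoc_inv:
  "diagonal_arrow (fuse_obj A (fuse_obj B C)) (fuse_obj (fuse_obj A B) C)
      (copies A \<times> copies B \<times> copies C)
     (\<lambda>(r, s, t). fuse_obj (simple (fst r)) (fuse_obj (simple (fst s)) (simple (fst t))))
     (\<lambda>(r, s, t). fuse_obj (fuse_obj (simple (fst r)) (simple (fst s))) (simple (fst t)))
     (\<lambda>(r, s, t). fuse_arr (incl A r) (fuse_arr (incl B s) (incl C t)))
     (\<lambda>(r, s, t). fuse_arr (proj A r) (fuse_arr (proj B s) (proj C t)))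
     (\<lambda>(r, s, t). fuse_arr (fuse_arr (incl A r) (incl B s)) (incl C t))
     (\<lambda>(r, s, t). fuse_arr (fuse_arr (proj A r) (proj B s)) (proj C t))
     (\<lambda>(r, s, t). assoc_simple (fst r) (fst s) (fst t))"
  by (intro diagonal_arrow.intro decomposition_fuse_left decomposition_fuse_right
      diagonal_arrow_axioms.intro) (auto simp: fuse_obj_assoc)

lemma fuse_assoc_eq_diag:
  "fuse_assoc A B C = diagonal_arrow.diag (fuse_obj (fuse_obj A B) C) (fuse_obj A (fuse_obj B C))
     (copies A \<times> copies B \<times> copies C)
     (\<lambda>(r, s, t). fuse_arr (fuse_arr (proj A r) (proj B s)) (proj C t))
     (\<lambda>(r, s, t). fuse_arr (incl A r) (fuse_arr (incl B s) (incl C t)))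
     (\<lambda>(r, s, t). assoc_simple (fst r) (fst s) (fst t))"
  unfolding fuse_assoc_def diagonal_arrow.diag_def[OF diagonal_fuse_assoc] by (simp add: split_def)

lemma idom_icod_fuse_assoc [simp]:
  "idom (fuse_assoc A B C) = fuse_obj (fuse_obj A B) C"
  "icod (fuse_assoc A B C) = fuse_obj A (fuse_obj B C)"
  by (simp_all add: fuse_assoc_def)

lemma fuse_assoc_incl:
  assumes "r \<in> copies A" "s \<in> copies B" "t \<in> copies C"
  shows "icomp (fuse_assoc A B C) (fuse_arr (fuse_arr (incl A r) (incl B s)) (incl C t)) =
    icomp (fuse_arr (incl A r) (fuse_arr (incl B s) (incl C t)))
        (assoc_simple (fst r) (fst s) (fst t))"
  using diagonal_arrow.diag_e[OF diagonal_fuse_assoc, of "(r, s, t)" A B C] assms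
  by (simp add: fuse_assoc_eq_diag)

lemma fuse_assoc_natural:
  assumes "idom f = A" "icod f = A'" "idom g = B" "icod g = B'" "idom h = C" "icod h = C'"
  shows "icomp (fuse_assoc A' B' C') (fuse_arr (fuse_arr f g) h) =
    icomp (fuse_arr f (fuse_arr g h)) (fuse_assoc A B C)"
  unfolding fuse_assoc_eq_diag
  by (rule diag_natural[OF diagonal_fuse_assoc diagonal_fuse_assoc])
    (auto simp: assms intro!: assoc_simple_natural)

text \<open>The associativity of simple objects being its own inverse, the same family of arrows with source and
target exchanged defines the inverse.\<close>

definition fuse_assoc_inv :: "iobj \<Rightarrow> iobj \<Rightarrow> iobj \<Rightarrow> iarr" where
  "fuse_assoc_inv A B C = diagonal_arrow.diag (fuse_obj A (fuse_obj B C))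
      (fuse_obj (fuse_obj A B) C)
     (copies A \<times> copies B \<times> copies C)
     (\<lambda>(r, s, t). fuse_arr (proj A r) (fuse_arr (proj B s) (proj C t)))
     (\<lambda>(r, s, t). fuse_arr (fuse_arr (incl A r) (incl B s)) (incl C t))
     (\<lambda>(r, s, t). assoc_simple (fst r) (fst s) (fst t))"

lemma idom_icod_fuse_assoc_inv [simp]:
  "idom (fuse_assoc_inv A B C) = fuse_obj A (fuse_obj B C)"
  "icod (fuse_assoc_inv A B C) = fuse_obj (fuse_obj A B) C"
  by (simp_all add: fuse_assoc_inv_def diagonal_arrow.diag_def[OF diagonal_fuse_assoc_inv])

lemma fuse_assoc_inverse [simp]:
  "icomp (fuse_assoc_inv A B C) (fuse_assoc A B C) = iide (fuse_obj (fuse_obj A B) C)"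
  "icomp (fuse_assoc A B C) (fuse_assoc_inv A B C) = iide (fuse_obj A (fuse_obj B C))"
  unfolding fuse_assoc_eq_diag fuse_assoc_inv_def
  by (rule diag_inverse[OF diagonal_fuse_assoc diagonal_fuse_assoc_inv],
      auto simp: assoc_simple_involution)
    (rule diag_inverse[OF diagonal_fuse_assoc_inv diagonal_fuse_assoc],
      auto simp: assoc_simple_involution fuse_obj_assoc)

lemma fuse_assoc_inv_incl:
  assumes "r \<in> copies A" "s \<in> copies B" "t \<in> copies C"
  shows "icomp (fuse_assoc_inv A B C) (fuse_arr (incl A r) (fuse_arr (incl B s) (incl C t))) =
    icomp (fuse_arr (fuse_arr (incl A r) (incl B s)) (incl C t))
        (assoc_simple (fst r) (fst s) (fst t))"
  using diagonal_arrow.diag_e[OF diagonal_fuse_assoc_inv, of "(r, s, t)" A B C] assms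
  by (simp add: fuse_assoc_inv_def)

lemma fuse_assoc_inv_natural:
  assumes "idom f = A" "icod f = A'" "idom g = B" "icod g = B'" "idom h = C" "icod h = C'"
  shows "icomp (fuse_assoc_inv A' B' C') (fuse_arr f (fuse_arr g h)) =
    icomp (fuse_arr (fuse_arr f g) h) (fuse_assoc_inv A B C)"
proof -
  note [simp] = assms
  have "icomp (fuse_assoc_inv A' B' C') (fuse_arr f (fuse_arr g h)) =
      icomp (fuse_assoc_inv A' B' C')
        (icomp (icomp (fuse_arr f (fuse_arr g h)) (fuse_assoc A B C)) (fuse_assoc_inv A B C))"
    by simp
  also have "\<dots> = icomp (icomp (fuse_assoc_inv A' B' C') (fuse_assoc A' B' C'))
      (icomp (fuse_arr (fuse_arr f g) h) (fuse_assoc_inv A B C))"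
    by (subst fuse_assoc_natural[OF assms, symmetric]) (simp del: fuse_assoc_inverse)
  also have "\<dots> = icomp (fuse_arr (fuse_arr f g) h) (fuse_assoc_inv A B C)"
    by simp
  finally show ?thesis .
qed

lemma diagonal_fuse_braid:
  "diagonal_arrow (fuse_obj A B) (fuse_obj B A) (copies A \<times> copies B)
     (\<lambda>(r, s). fuse_obj (simple (fst r)) (simple (fst s)))
     (\<lambda>(r, s). fuse_obj (simple (fst s)) (simple (fst r)))
     (\<lambda>(r, s). fuse_arr (incl A r) (incl B s)) (\<lambda>(r, s). fuse_arr (proj A r) (proj B s))
     (\<lambda>(r, s). fuse_arr (incl B s) (incl A r)) (\<lambda>(r, s). fuse_arr (proj B s) (proj A r))
     (\<lambda>(r, s). braid_simple (fst r) (fst s))"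
  by (intro diagonal_arrow.intro decomposition_swap diagonal_arrow_axioms.intro
      decomposition_fuse[OF decomposition_copies decomposition_copies]) auto

lemma fuse_braid_eq_diag:
  "fuse_braid A B = diagonal_arrow.diag (fuse_obj A B) (fuse_obj B A) (copies A \<times> copies B)
     (\<lambda>(r, s). fuse_arr (proj A r) (proj B s)) (\<lambda>(r, s). fuse_arr (incl B s) (incl A r))
     (\<lambda>(r, s). braid_simple (fst r) (fst s))"
  unfolding fuse_braid_def diagonal_arrow.diag_def[OF diagonal_fuse_braid] by (simp add: split_def)

lemma idom_icod_fuse_braid [simp]:
  "idom (fuse_braid A B) = fuse_obj A B" "icod (fuse_braid A B) = fuse_obj B A"
  by (simp_all add: fuse_braid_def)

lemma fuse_braid_incl:
  assumes "r \<in> copies A" "s \<in> copies B"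
  shows "icomp (fuse_braid A B) (fuse_arr (incl A r) (incl B s)) =
    icomp (fuse_arr (incl B s) (incl A r)) (braid_simple (fst r) (fst s))"
  using diagonal_arrow.diag_e[OF diagonal_fuse_braid, of "(r, s)" A B] assms
  by (simp add: fuse_braid_eq_diag)

lemma fuse_braid_natural:
  assumes "idom f = A" "icod f = A'" "idom g = B" "icod g = B'"
  shows "icomp (fuse_braid A' B') (fuse_arr f g) = icomp (fuse_arr g f) (fuse_braid A B)"
  unfolding fuse_braid_eq_diag
  by (rule diag_natural[OF diagonal_fuse_braid diagonal_fuse_braid])
    (auto simp: assms intro!: braid_simple_natural)

lemma fuse_braid_inverse:
  obtains g where "idom g = fuse_obj B A" "icod g = fuse_obj A B"
    "icomp g (fuse_braid A B) = iide (fuse_obj A B)" "icomp (fuse_braid A B) g =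
        iide (fuse_obj B A)"
proof -
  \<comment> \<open>a simultaneous choice of inverses for all pairs of charges\<close>
  define l where "l a b = (SOME g. idom g = fuse_obj (simple b) (simple a) \<and>
    icod g = fuse_obj (simple a) (simple b) \<and>
    icomp g (braid_simple a b) = iide (fuse_obj (simple a) (simple b)) \<and>
    icomp (braid_simple a b) g = iide (fuse_obj (simple b) (simple a)))" for a b
  have l: "idom (l a b) = fuse_obj (simple b) (simple a)"
    "icod (l a b) = fuse_obj (simple a) (simple b)"
    "icomp (l a b) (braid_simple a b) = iide (fuse_obj (simple a) (simple b))"
    "icomp (braid_simple a b) (l a b) = iide (fuse_obj (simple b) (simple a))" for a b
    using someI_ex[OF braid_simple_inverse[of b a]] unfolding l_def by blast+
  have inv: "diagonal_arrow (fuse_obj B A) (fuse_obj A B) (copies A \<times> copies B)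
     (\<lambda>(r, s). fuse_obj (simple (fst s)) (simple (fst r)))
     (\<lambda>(r, s). fuse_obj (simple (fst r)) (simple (fst s)))
     (\<lambda>(r, s). fuse_arr (incl B s) (incl A r)) (\<lambda>(r, s). fuse_arr (proj B s) (proj A r))
     (\<lambda>(r, s). fuse_arr (incl A r) (incl B s)) (\<lambda>(r, s). fuse_arr (proj A r) (proj B s))
     (\<lambda>(r, s). l (fst r) (fst s))"
    by (intro diagonal_arrow.intro decomposition_swap diagonal_arrow_axioms.intro
        decomposition_fuse[OF decomposition_copies decomposition_copies]) (auto simp: l)
  show ?thesis
  proof (rule that)
    let ?g = "diagonal_arrow.diag (fuse_obj B A) (fuse_obj A B) (copies A \<times> copies B)
      (\<lambda>(r, s). fuse_arr (proj B s) (proj A r)) (\<lambda>(r, s). fuse_arr (incl A r) (incl B s))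
      (\<lambda>(r, s). l (fst r) (fst s))"
    show "idom ?g = fuse_obj B A" "icod ?g = fuse_obj A B"
      by (simp_all add: diagonal_arrow.diag_def[OF inv])
    show "icomp ?g (fuse_braid A B) = iide (fuse_obj A B)"
      unfolding fuse_braid_eq_diag
      by (rule diag_inverse[OF diagonal_fuse_braid inv]) (auto simp: l)
    show "icomp (fuse_braid A B) ?g = iide (fuse_obj B A)"
      unfolding fuse_braid_eq_diag
      by (rule diag_inverse[OF inv diagonal_fuse_braid]) (auto simp: l)
  qed
qed

section \<open>Pentagon and hexagons for simple objects\<close>

text \<open>Matrices with explicit entries. The following rules let the simplifier carry out every matrix
operation on such matrices: \<open>tabulate\<close> lists the entries of a result, and unfolding it returns to the
form \<open>lmat\<close>.\<close>

definition lmat :: "nat \<Rightarrow> nat \<Rightarrow> complex list list \<Rightarrow> complex mat" where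
  "lmat m n xs = mat m n (\<lambda>(i, j). xs ! i ! j)"

lemma dim_lmat [simp]: "dim_row (lmat m n xs) = m" "dim_col (lmat m n xs) = n"
  by (simp_all add: lmat_def)

lemma lmat_entry [simp]: "\<lbrakk>i < m; j < n\<rbrakk> \<Longrightarrow> lmat m n xs $$ (i, j) = xs ! i ! j"
  by (simp add: lmat_def)

definition tabulate :: "nat \<Rightarrow> nat \<Rightarrow> (nat \<Rightarrow> nat \<Rightarrow> complex) \<Rightarrow> complex mat" where
  "tabulate m n f = lmat m n (map (\<lambda>i. map (f i) [0..<n]) [0..<m])"

lemma dim_tabulate [simp]: "dim_row (tabulate m n f) = m" "dim_col (tabulate m n f) = n"
  by (simp_all add: tabulate_def)

lemma tabulate_entry [simp]: "\<lbrakk>i < m; j < n\<rbrakk> \<Longrightarrow> tabulate m n f $$ (i, j) = f i j"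
  by (simp add: tabulate_def)

lemma one_lmat: "1\<^sub>m n = tabulate n n (\<lambda>i j. if i = j then 1 else 0)"
  by (rule eq_matI) simp_all

lemma zero_lmat: "0\<^sub>m m n = tabulate m n (\<lambda>i j. 0)"
  by (rule eq_matI) simp_all

lemma smult_lmat: "x \<cdot>\<^sub>m lmat m n xs = tabulate m n (\<lambda>i j. x * xs ! i ! j)"
  by (rule eq_matI) simp_all

lemma add_lmat: "lmat m n xs + lmat m n ys = tabulate m n (\<lambda>i j. xs ! i ! j + ys ! i ! j)"
  by (rule eq_matI) simp_all

lemma mult_lmat:
  "lmat m l xs * lmat l n ys = tabulate m n (\<lambda>i j. \<Sum>k\<leftarrow>[0..<l]. xs ! i ! k * ys ! k ! j)"
  by (rule eq_matI)
    (simp_all add: mult_entry interv_sum_list_conv_sum_set_nat lessThan_atLeast0 del: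
        index_mult_mat(1))

lemma kronecker_lmat:
  "lmat m n xs \<odot> lmat m' n' ys =
     tabulate (m * m') (n * n') (\<lambda>i j. xs ! (i div m') ! (j div n') * ys ! (i mod m') ! (j mod n'))"
  by (rule eq_matI) (auto simp: kronecker_entry dest!: div_mod_less)

lemma block_diag_lmat:
  "lmat m n xs \<boxplus> lmat m' n' ys = tabulate (m + m') (n + n') (\<lambda>i j.
     if i < m \<and> j < n then xs ! i ! j
     else if m \<le> i \<and> n \<le> j then ys ! (i - m) ! (j - n) else 0)"
  by (rule eq_matI) (auto simp: block_diag_entry)

lemma rows_lmat: "mat_of_rows_list n xs = lmat (length xs) n xs"
  by (rule eq_matI) (auto simp: mat_of_rows_list_def)

lemma triple_ops:
  "icomp (a, b, c) (a', b', c') = (a * a', b * b', c * c')"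
  "iadd (a, b, c) (a', b', c') = (a + a', b + b', c + c')"
  "iide (k, m, n) = (1\<^sub>m k, 1\<^sub>m m, 1\<^sub>m n)"
  "dsum_obj (k, m, n) (k', m', n') = (k + k', m + m', n + n')"
  by (simp_all add: icomp_def iadd_def iide_def dsum_obj_def triple_def)

lemma incl_proj_triple:
  "incl (k, m, n) (Vac, i) =
     (tabulate k 1 (\<lambda>p q. if p = i then 1 else 0),
      tabulate m 0 (\<lambda>p q. 0),
      tabulate n 0 (\<lambda>p q. 0))"
  "incl (k, m, n) (Psi, i) =
     (tabulate k 0 (\<lambda>p q. 0),
      tabulate m 0 (\<lambda>p q. 0),
      tabulate n 1 (\<lambda>p q. if p = i then 1 else 0))"
  "proj (k, m, n) (Vac, i) =
     (tabulate 1 k (\<lambda>p q. if q = i then 1 else 0),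
      tabulate 0 m (\<lambda>p q. 0),
      tabulate 0 n (\<lambda>p q. 0))"
  "proj (k, m, n) (Psi, i) =
     (tabulate 0 k (\<lambda>p q. 0),
      tabulate 0 m (\<lambda>p q. 0),
      tabulate 1 n (\<lambda>p q. if q = i then 1 else 0))"
  by (simp_all add: incl_def proj_def triple_def; intro conjI eq_matI; simp)+

text \<open>The product \<open>\<sigma>\<sigma>\<close>, the one product of simple objects which is not simple.\<close>

definition vac_psi :: iobj where "vac_psi = dsum_obj ione (simple Psi)"

lemma fusion_table:
  "fuse_obj (simple Sig) (simple Sig) = vac_psi"
  "fuse_obj (simple Sig) (simple Psi) = simple Sig"
  "fuse_obj (simple Psi) (simple Sig) = simple Sig"
  "fuse_obj (simple Psi) (simple Psi) = ione"
  by (simp_all add: fusion_rules vac_psi_def)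

lemma copies_simple: "copies (simple a) = {(a, 0)}"
  by (auto simp: copies_iff split: if_splits)

lemma copies_ione: "copies ione = {(Vac, 0)}"
  by (auto simp: copies_iff split: if_splits)

lemma copies_vac_psi: "copies vac_psi = {(Vac, 0), (Psi, 0)}"
  by (auto simp: copies_iff vac_psi_def split: if_splits)

lemma incl_simple [simp]:
  "incl (simple a) (a, 0) = iide (simple a)" "proj (simple a) (a, 0) = iide (simple a)"
  by (rule component_eqI; auto)+

lemma simple_Vac: "simple Vac = ione"
  by (fact fusion_rules)

lemma incl_ione [simp]: "incl ione (Vac, 0) = iide ione" "proj ione (Vac, 0) = iide ione"
  using incl_simple[of Vac] by (simp_all add: simple_Vac)

lemma fuse_assoc_simple: "fuse_assoc (simple a) (simple b) (simple c) = assoc_simple a b c"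
  using fuse_assoc_incl[of "(a, 0)" "simple a" "(b, 0)" "simple b" "(c, 0)" "simple c"]
  by (simp add: copies_simple)

lemma fuse_braid_simple: "fuse_braid (simple a) (simple b) = braid_simple a b"
  using fuse_braid_incl[of "(a, 0)" "simple a" "(b, 0)" "simple b"] by (simp add: copies_simple)

lemma assoc_simple_Vac:
  "assoc_simple Vac b c = iide (fuse_obj (simple b) (simple c))"
  "assoc_simple a Vac c = iide (fuse_obj (simple a) (simple c))"
  "assoc_simple a b Vac = iide (fuse_obj (simple a) (simple b))"
  by (cases a; cases b; cases c; simp add: simple_Vac)+

text \<open>The unit is strict and the associativity of simple objects is the identity when one of them is
the unit. With naturality this extends to arbitrary objects.\<close>

lemma fuse_assoc_eq_iide:
  assumes "A = ione \<or> B = ione \<or> C = ione"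
  shows "fuse_assoc A B C = iide (fuse_obj (fuse_obj A B) C)"
proof (rule decomposition.source_eqI[OF decomposition_fuse_left[of A B C]])
  fix j assume j: "j \<in> copies A \<times> copies B \<times> copies C"
  obtain r s t where rst: "j = (r, s, t)" by (cases j) auto
  have "fuse_arr (incl A r) (fuse_arr (incl B s) (incl C t)) =
      fuse_arr (fuse_arr (incl A r) (incl B s)) (incl C t)"
    and "assoc_simple (fst r) (fst s) (fst t) =
      iide (fuse_obj (fuse_obj (simple (fst r)) (simple (fst s))) (simple (fst t)))"
    using assms j unfolding rst by (auto simp: copies_ione assoc_simple_Vac simple_Vac)
  then show "icomp (fuse_assoc A B C)
      (case j of (r, s, t) \<Rightarrow> fuse_arr (fuse_arr (incl A r) (incl B s)) (incl C t)) =
    icomp (iide (fuse_obj (fuse_obj A B) C))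
      (case j of (r, s, t) \<Rightarrow> fuse_arr (fuse_arr (incl A r) (incl B s)) (incl C t))"
    using j by (simp add: rst fuse_assoc_incl)
qed (simp_all add: fuse_obj_assoc)

lemma fuse_assoc_ione:
  "fuse_assoc ione B C = iide (fuse_obj B C)"
  "fuse_assoc A ione C = iide (fuse_obj A C)"
  "fuse_assoc A B ione = iide (fuse_obj A B)"
  by (simp_all add: fuse_assoc_eq_iide)

lemma braid_simple_Vac:
  "braid_simple Vac b = iide (simple b)" "braid_simple a Vac = iide (simple a)"
  by (cases a; cases b; simp add: simple_Vac)+

lemma fuse_braid_eq_iide:
  assumes "A = ione \<or> B = ione"
  shows "fuse_braid A B = iide (fuse_obj A B)"
proof (rule decomposition.source_eqI[OF decomposition_fuse[OF decomposition_copies[of A]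
        decomposition_copies[of B]]])
  fix j assume j: "j \<in> copies A \<times> copies B"
  obtain r s where rs: "j = (r, s)" by (cases j) auto
  have "fuse_arr (incl B s) (incl A r) = fuse_arr (incl A r) (incl B s)"
    and "braid_simple (fst r) (fst s) = iide (fuse_obj (simple (fst r)) (simple (fst s)))"
    using assms j unfolding rs by (auto simp: copies_ione braid_simple_Vac simple_Vac)
  then show "icomp (fuse_braid A B) (case j of (r, s) \<Rightarrow> fuse_arr (incl A r) (incl B s)) =
      icomp (iide (fuse_obj A B)) (case j of (r, s) \<Rightarrow> fuse_arr (incl A r) (incl B s))"
    using j by (simp add: rs fuse_braid_incl)
qed (use assms in auto)

lemma fuse_braid_ione: "fuse_braid ione B = iide B" "fuse_braid A ione = iide A"
  by (simp_all add: fuse_braid_eq_iide)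

lemma iSum_doubleton:
  assumes "j \<noteq> j'" "idom (t j) = A" "icod (t j) = B" "idom (t j') = A" "icod (t j') = B"
  shows "iSum A B {j, j'} t = iadd (t j) (t j')"
  using assms by (simp add: iSum_insert)

text \<open>The defining sum of the associativity has two terms when one argument is \<open>\<one> \<oplus> \<psi>\<close> and the others are
simple.\<close>

lemma fuse_assoc_vac_psi:
  "fuse_assoc vac_psi (simple b) (simple c) =
     iadd (icomp (fuse_arr (incl vac_psi (Vac, 0)) (iide (fuse_obj (simple b) (simple c))))
            (icomp (assoc_simple Vac b c) (fuse_arr
                (fuse_arr (proj vac_psi (Vac, 0)) (iide (simple b))) (iide (simple c)))))
          (icomp (fuse_arr (incl vac_psi (Psi, 0)) (iide (fuse_obj (simple b) (simple c))))
            (icomp (assoc_simple Psi b c) (fuse_arr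
                (fuse_arr (proj vac_psi (Psi, 0)) (iide (simple b))) (iide (simple c)))))"
  "fuse_assoc (simple a) vac_psi (simple c) =
     iadd (icomp (fuse_arr (iide (simple a)) (fuse_arr (incl vac_psi (Vac, 0)) (iide (simple c))))
            (icomp (assoc_simple a Vac c) (fuse_arr
                (fuse_arr (iide (simple a)) (proj vac_psi (Vac, 0))) (iide (simple c)))))
          (icomp (fuse_arr (iide (simple a)) (fuse_arr (incl vac_psi (Psi, 0)) (iide (simple c))))
            (icomp (assoc_simple a Psi c) (fuse_arr
                (fuse_arr (iide (simple a)) (proj vac_psi (Psi, 0))) (iide (simple c)))))"
  "fuse_assoc (simple a) (simple b) vac_psi =
     iadd (icomp (fuse_arr (iide (simple a)) (fuse_arr (iide (simple b)) (incl vac_psi (Vac, 0))))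
            (icomp (assoc_simple a b Vac) (fuse_arr (iide (fuse_obj (simple a) (simple b)))
                (proj vac_psi (Vac, 0)))))
          (icomp (fuse_arr (iide (simple a)) (fuse_arr (iide (simple b)) (incl vac_psi (Psi, 0))))
            (icomp (assoc_simple a b Psi) (fuse_arr (iide (fuse_obj (simple a) (simple b)))
                (proj vac_psi (Psi, 0)))))"
  by (simp_all add: fuse_assoc_def copies_simple copies_vac_psi insert_Times_insert iSum_doubleton)

lemma fuse_braid_vac_psi:
  "fuse_braid vac_psi (simple b) =
     iadd (icomp (fuse_arr (iide (simple b)) (incl vac_psi (Vac, 0)))
            (icomp (braid_simple Vac b) (fuse_arr (proj vac_psi (Vac, 0)) (iide (simple b)))))
          (icomp (fuse_arr (iide (simple b)) (incl vac_psi (Psi, 0)))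
            (icomp (braid_simple Psi b) (fuse_arr (proj vac_psi (Psi, 0)) (iide (simple b)))))"
  "fuse_braid (simple a) vac_psi =
     iadd (icomp (fuse_arr (incl vac_psi (Vac, 0)) (iide (simple a)))
            (icomp (braid_simple a Vac) (fuse_arr (iide (simple a)) (proj vac_psi (Vac, 0)))))
          (icomp (fuse_arr (incl vac_psi (Psi, 0)) (iide (simple a)))
            (icomp (braid_simple a Psi) (fuse_arr (iide (simple a)) (proj vac_psi (Psi, 0)))))"
  by (simp_all add: fuse_braid_def copies_simple copies_vac_psi insert_Times_insert iSum_doubleton)

lemma simple_triple:
  "simple Sig = (0, 1, 0)" "simple Psi = (0, 0, 1)" "ione = (1, 0, 0)" "vac_psi = (1, 0, 1)"
  by (simp_all add: vac_psi_def simple_def triple_def ione_def dsum_obj_def)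

lemmas evaluate = simple_triple simple_Vac triple_ops incl_proj_triple one_lmat zero_lmat
    smult_lmat add_lmat mult_lmat
  kronecker_lmat block_diag_lmat rows_lmat tabulate_def upt_rec numeral_2_eq_2[symmetric]

definition inv_sqrt2 :: complex where "inv_sqrt2 = complex_of_real (1 / sqrt 2)"

lemma inv_sqrt2_mult: "inv_sqrt2 * inv_sqrt2 = 1 / 2" "inv_sqrt2 * (inv_sqrt2 * x) = x / 2"
proof -
  show *: "inv_sqrt2 * inv_sqrt2 = 1 / 2"
    by (simp add: inv_sqrt2_def flip: of_real_mult)
  show "inv_sqrt2 * (inv_sqrt2 * x) = x / 2"
    by (simp add: * flip: mult.assoc)
qed

lemma assoc_simple_SSS:
  "assoc_simple Sig Sig Sig = (1\<^sub>m 0, inv_sqrt2 \<cdot>\<^sub>m mat_of_rows_list 2 [[1, 1], [1, -1]], 1\<^sub>m 0)"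
  by (simp add: inv_sqrt2_def)

text \<open>The entries \<open>1/\<surd>2\<close> stay folded, so that their products are simplified by \<open>inv_sqrt2_mult\<close>.\<close>

declare assoc_simple.simps(1) [simp del]

text \<open>The off-diagonal matrices do not come from the associativity of simple objects but from
the ordering of channels by the charges of the factors. For instance in \<open>(\<sigma>\<psi>)(\<one> \<oplus> \<psi>)\<close> the channels are
listed as \<open>\<sigma>\<one>, \<sigma>\<psi>\<close>, while in \<open>\<sigma>(\<psi>(\<one> \<oplus> \<psi>))\<close> the channel \<open>\<sigma>(\<psi>\<psi>)\<close> comes first.\<close>

lemma fuse_assoc_vac_psi_table:
  "fuse_assoc vac_psi (simple Sig) (simple Sig) =
      (lmat 2 2 [[1,0],[0,1]], lmat 0 0 [], lmat 2 2 [[1,0],[0,1]])"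
  "fuse_assoc (simple Sig) vac_psi (simple Sig) =
      (lmat 2 2 [[1,0],[0,1]], lmat 0 0 [], lmat 2 2 [[1,0],[0,-1]])"
  "fuse_assoc (simple Sig) (simple Sig) vac_psi =
      (lmat 2 2 [[1,0],[0,1]], lmat 0 0 [], lmat 2 2 [[0,1],[1,0]])"
  "fuse_assoc (simple Sig) (simple Psi) vac_psi =
      (lmat 0 0 [], lmat 2 2 [[0,1],[1,0]], lmat 0 0 [])"
  "fuse_assoc (simple Sig) vac_psi (simple Psi) =
      (lmat 0 0 [], lmat 2 2 [[0,1],[1,0]], lmat 0 0 [])"
  "fuse_assoc (simple Psi) (simple Sig) vac_psi =
      (lmat 0 0 [], lmat 2 2 [[1,0],[0,-1]], lmat 0 0 [])"
  "fuse_assoc (simple Psi) (simple Psi) vac_psi = (lmat 1 1 [[1]], lmat 0 0 [], lmat 1 1 [[1]])"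
  "fuse_assoc (simple Psi) vac_psi (simple Sig) =
      (lmat 0 0 [], lmat 2 2 [[0,1],[1,0]], lmat 0 0 [])"
  "fuse_assoc (simple Psi) vac_psi (simple Psi) = (lmat 1 1 [[1]], lmat 0 0 [], lmat 1 1 [[1]])"
  "fuse_assoc vac_psi (simple Sig) (simple Psi) =
      (lmat 0 0 [], lmat 2 2 [[1,0],[0,-1]], lmat 0 0 [])"
  "fuse_assoc vac_psi (simple Psi) (simple Sig) =
      (lmat 0 0 [], lmat 2 2 [[0,1],[1,0]], lmat 0 0 [])"
  "fuse_assoc vac_psi (simple Psi) (simple Psi) = (lmat 1 1 [[1]], lmat 0 0 [], lmat 1 1 [[1]])"
  by (simp only: fuse_assoc_vac_psi; simp add: evaluate)+

lemma fuse_braid_vac_psi_table: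
  "fuse_braid (simple Sig) vac_psi =
      (lmat 0 0 [], lmat 2 2 [[1,0],[0,inverse (ising_w ^ 4)]], lmat 0 0 [])"
  "fuse_braid vac_psi (simple Sig) =
      (lmat 0 0 [], lmat 2 2 [[1,0],[0,inverse (ising_w ^ 4)]], lmat 0 0 [])"
  "fuse_braid (simple Psi) vac_psi = (lmat 1 1 [[-1]], lmat 0 0 [], lmat 1 1 [[1]])"
  "fuse_braid vac_psi (simple Psi) = (lmat 1 1 [[-1]], lmat 0 0 [], lmat 1 1 [[1]])"
  by (simp only: fuse_braid_vac_psi; simp add: evaluate)+

text \<open>The steps of the computation must not be merged: products of objects are named first, so that each
associativity can be looked up under its objects; only then are objects and arrows unfolded into
numbers and matrices, and multiplied.\<close>

lemma pentagon_nonunit: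
  assumes "{a, b, c, d} \<subseteq> {Sig, Psi}"
  shows "icomp (fuse_assoc (simple a) (simple b) (fuse_obj (simple c) (simple d)))
      (fuse_assoc (fuse_obj (simple a) (simple b)) (simple c) (simple d)) =
    icomp (fuse_arr (iide (simple a)) (fuse_assoc (simple b) (simple c) (simple d)))
      (icomp (fuse_assoc (simple a) (fuse_obj (simple b) (simple c)) (simple d))
        (fuse_arr (fuse_assoc (simple a) (simple b) (simple c)) (iide (simple d))))"
  using assms
  by (cases a; cases b; cases c; cases d; simp only: insert_subset empty_iff insert_iff
      charge.distinct simp_thms;
    simp only: fusion_table fuse_assoc_vac_psi_table fuse_assoc_ione fuse_assoc_simple fuse_obj_one;
    simp add: assoc_simple_SSS evaluate inv_sqrt2_mult)

text \<open>The relations of \<open>w = exp (\<i>\<pi>/8)\<close> that the hexagons need. The last one is what relates the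
matrix of \<open>(\<sigma>\<sigma>)\<sigma>\<close>, whose entries contain \<open>1/\<surd>2\<close>, to the braiding of \<open>\<sigma>\<sigma>\<close>. Every power of \<open>w\<close> in
the braiding is expressed by \<open>\<i>\<close> and \<open>inverse w\<close>, so that simplification reaches a normal form.\<close>

lemma ising_w_relations:
  "inverse (ising_w ^ 4) = - \<i>" "ising_w ^ 3 = \<i> * inverse ising_w"
  "inverse ising_w * inverse ising_w = inv_sqrt2 * (1 - \<i>)"
proof -
  have w: "ising_w = cis (pi / 8)"
    by (simp add: ising_w_def cis_conv_exp mult.commute)
  have "inverse ising_w = cis (- (pi / 8))"
    unfolding w by (rule cis_inverse)
  then have "inverse ising_w * inverse ising_w = cis (- (pi / 4))"
    by (simp add: cis_mult)
  also have "\<dots> = inv_sqrt2 * (1 - \<i>)"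
    by (simp add: complex_eq_iff inv_sqrt2_def cos_45 sin_45 real_div_sqrt field_simps)
  finally show "inverse ising_w * inverse ising_w = inv_sqrt2 * (1 - \<i>)" .
  have w4: "ising_w ^ 4 = \<i>"
    unfolding w DeMoivre by (simp add: complex_eq_iff)
  then show "inverse (ising_w ^ 4) = - \<i>" by simp
  have "ising_w \<noteq> 0" by (simp add: ising_w_def)
  moreover have "ising_w ^ 3 * ising_w = \<i>"
    using w4 by (simp add: power_Suc2[symmetric])
  ultimately show "ising_w ^ 3 = \<i> * inverse ising_w"
    by (simp add: field_simps)
qed

lemma ising_w_mult:
  "inverse ising_w * (inverse ising_w * x) = inv_sqrt2 * ((1 - \<i>) * x)"
  "\<i> * (\<i> * x) = - x"
  using ising_w_relations(3) by (simp_all flip: mult.assoc)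

lemma hexagon1_nonunit:
  assumes "{a, b, c} \<subseteq> {Sig, Psi}"
  shows "icomp (fuse_assoc (simple b) (simple c) (simple a))
      (icomp (fuse_braid (simple a) (fuse_obj (simple b) (simple c)))
          (fuse_assoc (simple a) (simple b) (simple c))) =
    icomp (fuse_arr (iide (simple b)) (fuse_braid (simple a) (simple c)))
      (icomp (fuse_assoc (simple b) (simple a) (simple c))
        (fuse_arr (fuse_braid (simple a) (simple b)) (iide (simple c))))"
  using assms
  by (cases a; cases b; cases c; simp only: insert_subset empty_iff insert_iff charge.distinct
      simp_thms;
    simp only: fusion_table fuse_braid_vac_psi_table fuse_braid_ione fuse_braid_simple
        fuse_assoc_simple;
    simp add: assoc_simple_SSS evaluate ising_w_relations(1,2);
    simp add: ising_w_relations ising_w_mult inv_sqrt2_mult algebra_simps)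

text \<open>The second hexagon contains inverses of the associativity, but all three are taken at simple objects,
where the associativity is an involution.\<close>

lemma hexagon2_nonunit:
  assumes "{a, b, c} \<subseteq> {Sig, Psi}"
  shows "icomp (fuse_assoc (simple c) (simple a) (simple b))
      (icomp (fuse_braid (fuse_obj (simple a) (simple b)) (simple c))
          (fuse_assoc (simple a) (simple b) (simple c))) =
    icomp (fuse_arr (fuse_braid (simple a) (simple c)) (iide (simple b)))
      (icomp (fuse_assoc (simple a) (simple c) (simple b))
        (fuse_arr (iide (simple a)) (fuse_braid (simple b) (simple c))))"
  using assms
  by (cases a; cases b; cases c; simp only: insert_subset empty_iff insert_iff charge.distinct
      simp_thms;
    simp only: fusion_table fuse_braid_vac_psi_table fuse_braid_ione fuse_braid_simple
        fuse_assoc_simple;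
    simp add: assoc_simple_SSS evaluate ising_w_relations(1,2);
    simp add: ising_w_relations ising_w_mult inv_sqrt2_mult algebra_simps)

section \<open>Pentagon and hexagons for all objects\<close>

text \<open>Pasting of naturality squares: inclusions of simple objects are moved past one factor of a composite
after the other.\<close>

lemma paste2:
  assumes "icomp x1 E0 = icomp E1 y1" "icomp x2 E1 = icomp E2 y2"
    and "idom x1 = icod E0" "idom E1 = icod y1" "idom x2 = icod E1" "idom E2 = icod y2"
    and "icod x1 = icod E1" "icod y1 = idom y2"
  shows "icomp (icomp x2 x1) E0 = icomp E2 (icomp y2 y1)"
proof -
  have "icomp (icomp x2 x1) E0 = icomp x2 (icomp x1 E0)" using assms(3-) by simp
  also have "\<dots> = icomp x2 (icomp E1 y1)" by (simp only: assms(1))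
  also have "\<dots> = icomp (icomp x2 E1) y1" using assms(3-) by simp
  also have "\<dots> = icomp E2 (icomp y2 y1)" unfolding assms(2) using assms(3-) by simp
  finally show ?thesis .
qed

lemma paste3:
  assumes "icomp x1 E0 = icomp E1 y1" "icomp x2 E1 = icomp E2 y2" "icomp x3 E2 = icomp E3 y3"
    and "idom x1 = icod E0" "idom E1 = icod y1" "idom x2 = icod E1" "idom E2 = icod y2"
    and "icod x1 = icod E1" "icod y1 = idom y2"
    and "idom x3 = icod E2" "idom E3 = icod y3" "icod x2 = icod E2" "icod y2 = idom y3"
  shows "icomp (icomp x3 (icomp x2 x1)) E0 = icomp E3 (icomp y3 (icomp y2 y1))"
  by (rule paste2[OF paste2[OF assms(1,2)] assms(3)]) (simp_all add: assms(4-))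

lemma fuse_assoc_nat:
  "\<lbrakk>icod f = A; icod g = B; icod h = C\<rbrakk> \<Longrightarrow>
     icomp (fuse_assoc A B C) (fuse_arr (fuse_arr f g) h) =
     icomp (fuse_arr f (fuse_arr g h)) (fuse_assoc (idom f) (idom g) (idom h))"
  by (rule fuse_assoc_natural) simp_all

lemma fuse_assoc_inv_nat:
  "\<lbrakk>icod f = A; icod g = B; icod h = C\<rbrakk> \<Longrightarrow>
     icomp (fuse_assoc_inv A B C) (fuse_arr f (fuse_arr g h)) =
     icomp (fuse_arr (fuse_arr f g) h) (fuse_assoc_inv (idom f) (idom g) (idom h))"
  by (rule fuse_assoc_inv_natural) simp_all

lemma fuse_braid_nat:
  "\<lbrakk>icod f = A; icod g = B\<rbrakk> \<Longrightarrow>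
     icomp (fuse_braid A B) (fuse_arr f g) = icomp (fuse_arr g f) (fuse_braid (idom f) (idom g))"
  by (rule fuse_braid_natural) simp_all

lemma fuse_assoc_inv_simple:
  "fuse_assoc_inv (simple a) (simple b) (simple c) = fuse_assoc (simple a) (simple b) (simple c)"
  using fuse_assoc_inv_incl[of "(a, 0)" "simple a" "(b, 0)" "simple b" "(c, 0)" "simple c"]
  by (simp add: copies_simple fuse_assoc_simple fuse_obj_assoc)

lemma pentagon_simple:
  "icomp (fuse_assoc (simple a) (simple b) (fuse_obj (simple c) (simple d)))
      (fuse_assoc (fuse_obj (simple a) (simple b)) (simple c) (simple d)) =
    icomp (fuse_arr (iide (simple a)) (fuse_assoc (simple b) (simple c) (simple d)))
      (icomp (fuse_assoc (simple a) (fuse_obj (simple b) (simple c)) (simple d))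
        (fuse_arr (fuse_assoc (simple a) (simple b) (simple c)) (iide (simple d))))"
proof (cases "{a, b, c, d} \<subseteq> {Sig, Psi}")
  case True then show ?thesis by (rule pentagon_nonunit)
next
  case False
  then have "a = Vac \<or> b = Vac \<or> c = Vac \<or> d = Vac" by (cases a; cases b; cases c; cases d; simp)
  then show ?thesis by (elim disjE) (simp_all add: simple_Vac fuse_assoc_ione fuse_obj_assoc)
qed

lemma hexagon1_simple:
  "icomp (fuse_assoc (simple b) (simple c) (simple a))
      (icomp (fuse_braid (simple a) (fuse_obj (simple b) (simple c)))
          (fuse_assoc (simple a) (simple b) (simple c))) =
    icomp (fuse_arr (iide (simple b)) (fuse_braid (simple a) (simple c)))
      (icomp (fuse_assoc (simple b) (simple a) (simple c))
        (fuse_arr (fuse_braid (simple a) (simple b)) (iide (simple c))))"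
proof (cases "{a, b, c} \<subseteq> {Sig, Psi}")
  case True then show ?thesis by (rule hexagon1_nonunit)
next
  case False
  then have "a = Vac \<or> b = Vac \<or> c = Vac" by (cases a; cases b; cases c; simp)
  then show ?thesis
    by (elim disjE) (simp_all add: simple_Vac fuse_assoc_ione fuse_braid_ione fuse_obj_assoc)
qed

lemma hexagon2_simple:
  "icomp (fuse_assoc_inv (simple c) (simple a) (simple b))
      (icomp (fuse_braid (fuse_obj (simple a) (simple b)) (simple c))
          (fuse_assoc_inv (simple a) (simple b) (simple c))) =
    icomp (fuse_arr (fuse_braid (simple a) (simple c)) (iide (simple b)))
      (icomp (fuse_assoc_inv (simple a) (simple c) (simple b))
        (fuse_arr (iide (simple a)) (fuse_braid (simple b) (simple c))))"
  unfolding fuse_assoc_inv_simple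
proof (cases "{a, b, c} \<subseteq> {Sig, Psi}")
  case True then show "icomp (fuse_assoc (simple c) (simple a) (simple b))
      (icomp (fuse_braid (fuse_obj (simple a) (simple b)) (simple c))
          (fuse_assoc (simple a) (simple b) (simple c))) =
    icomp (fuse_arr (fuse_braid (simple a) (simple c)) (iide (simple b)))
      (icomp (fuse_assoc (simple a) (simple c) (simple b))
        (fuse_arr (iide (simple a)) (fuse_braid (simple b) (simple c))))" by (rule hexagon2_nonunit)
next
  case False
  then have "a = Vac \<or> b = Vac \<or> c = Vac" by (cases a; cases b; cases c; simp)
  then show "icomp (fuse_assoc (simple c) (simple a) (simple b))
      (icomp (fuse_braid (fuse_obj (simple a) (simple b)) (simple c))
          (fuse_assoc (simple a) (simple b) (simple c))) =
    icomp (fuse_arr (fuse_braid (simple a) (simple c)) (iide (simple b)))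
      (icomp (fuse_assoc (simple a) (simple c) (simple b))
        (fuse_arr (iide (simple a)) (fuse_braid (simple b) (simple c))))"
    by (elim disjE) (simp_all add: simple_Vac fuse_assoc_ione fuse_braid_ione fuse_obj_assoc)
qed

lemma fuse_pentagon:
  "icomp (fuse_assoc A B (fuse_obj C D)) (fuse_assoc (fuse_obj A B) C D) =
    icomp (fuse_arr (iide A) (fuse_assoc B C D))
      (icomp (fuse_assoc A (fuse_obj B C) D) (fuse_arr (fuse_assoc A B C) (iide D)))"
proof (rule decomposition.source_eqI[OF decomposition_fuse[OF decomposition_fuse_left[of A B C]
        decomposition_copies[of D]]])
  fix j assume "j \<in> (copies A \<times> copies B \<times> copies C) \<times> copies D"
  obtain r s t u where j: "j = ((r, s, t), u)" by (metis prod.collapse)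
  let ?a = "incl A r" and ?b = "incl B s" and ?c = "incl C t" and ?d = "incl D u"
  let ?A = "simple (fst r)" and ?B = "simple (fst s)" and ?C = "simple (fst t)" and ?D =
      "simple (fst u)"
  let ?E = "fuse_arr (fuse_arr (fuse_arr ?a ?b) ?c) ?d"
  have "icomp (icomp (fuse_assoc A B (fuse_obj C D)) (fuse_assoc (fuse_obj A B) C D)) ?E =
      icomp (fuse_arr ?a (fuse_arr ?b (fuse_arr ?c ?d)))
        (icomp (fuse_assoc ?A ?B (fuse_obj ?C ?D)) (fuse_assoc (fuse_obj ?A ?B) ?C ?D))"
    by (rule paste2[where ?E1.0 = "fuse_arr (fuse_arr ?a ?b) (fuse_arr ?c ?d)"])
      (simp_all add: fuse_assoc_nat)
  also have "\<dots> = icomp (fuse_arr ?a (fuse_arr ?b (fuse_arr ?c ?d)))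
      (icomp (fuse_arr (iide ?A) (fuse_assoc ?B ?C ?D))
        (icomp (fuse_assoc ?A (fuse_obj ?B ?C) ?D) (fuse_arr (fuse_assoc ?A ?B ?C) (iide ?D))))"
    by (simp only: pentagon_simple)
  also have "\<dots> = icomp (icomp (fuse_arr (iide A) (fuse_assoc B C D))
      (icomp (fuse_assoc A (fuse_obj B C) D) (fuse_arr (fuse_assoc A B C) (iide D)))) ?E"
    by (rule paste3[where ?E1.0 = "fuse_arr (fuse_arr ?a (fuse_arr ?b ?c)) ?d"
          and ?E2.0 = "fuse_arr ?a (fuse_arr (fuse_arr ?b ?c) ?d)", symmetric])
      (simp_all add: fuse_assoc_nat)
  finally show "icomp (icomp (fuse_assoc A B (fuse_obj C D)) (fuse_assoc (fuse_obj A B) C D))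
      (case j of (j, k) \<Rightarrow> fuse_arr (case j of (r, s, t) \<Rightarrow> fuse_arr
          (fuse_arr (incl A r) (incl B s)) (incl C t)) (incl D k)) =
    icomp (icomp (fuse_arr (iide A) (fuse_assoc B C D))
      (icomp (fuse_assoc A (fuse_obj B C) D) (fuse_arr (fuse_assoc A B C) (iide D))))
      (case j of (j, k) \<Rightarrow> fuse_arr (case j of (r, s, t) \<Rightarrow> fuse_arr
          (fuse_arr (incl A r) (incl B s)) (incl C t)) (incl D k))"
    by (simp only: j prod.case)
qed simp_all

lemma fuse_hexagon1:
  "icomp (fuse_assoc B C A) (icomp (fuse_braid A (fuse_obj B C)) (fuse_assoc A B C)) =
    icomp (fuse_arr (iide B) (fuse_braid A C))
      (icomp (fuse_assoc B A C) (fuse_arr (fuse_braid A B) (iide C)))"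
proof (rule decomposition.source_eqI[OF decomposition_fuse_left[of A B C]])
  fix j assume "j \<in> copies A \<times> copies B \<times> copies C"
  obtain r s t where j: "j = (r, s, t)" by (metis prod.collapse)
  let ?a = "incl A r" and ?b = "incl B s" and ?c = "incl C t"
  let ?A = "simple (fst r)" and ?B = "simple (fst s)" and ?C = "simple (fst t)"
  let ?E = "fuse_arr (fuse_arr ?a ?b) ?c"
  have "icomp (icomp (fuse_assoc B C A) (icomp (fuse_braid A (fuse_obj B C))
      (fuse_assoc A B C))) ?E =
      icomp (fuse_arr ?b (fuse_arr ?c ?a))
        (icomp (fuse_assoc ?B ?C ?A) (icomp (fuse_braid ?A (fuse_obj ?B ?C))
            (fuse_assoc ?A ?B ?C)))"
    by (rule paste3[where ?E1.0 = "fuse_arr ?a (fuse_arr ?b ?c)"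
          and ?E2.0 = "fuse_arr (fuse_arr ?b ?c) ?a"])
      (simp_all add: fuse_assoc_nat fuse_braid_nat)
  also have "\<dots> = icomp (fuse_arr ?b (fuse_arr ?c ?a)) (icomp (fuse_arr (iide ?B) (fuse_braid ?A ?C))
      (icomp (fuse_assoc ?B ?A ?C) (fuse_arr (fuse_braid ?A ?B) (iide ?C))))"
    by (simp only: hexagon1_simple)
  also have "\<dots> = icomp (icomp (fuse_arr (iide B) (fuse_braid A C))
      (icomp (fuse_assoc B A C) (fuse_arr (fuse_braid A B) (iide C)))) ?E"
    by (rule paste3[where ?E1.0 = "fuse_arr (fuse_arr ?b ?a) ?c"
          and ?E2.0 = "fuse_arr ?b (fuse_arr ?a ?c)", symmetric])
      (simp_all add: fuse_assoc_nat fuse_braid_nat)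
  finally show "icomp (icomp (fuse_assoc B C A)
      (icomp (fuse_braid A (fuse_obj B C)) (fuse_assoc A B C)))
      (case j of (r, s, t) \<Rightarrow> fuse_arr (fuse_arr (incl A r) (incl B s)) (incl C t)) =
    icomp (icomp (fuse_arr (iide B) (fuse_braid A C))
      (icomp (fuse_assoc B A C) (fuse_arr (fuse_braid A B) (iide C))))
      (case j of (r, s, t) \<Rightarrow> fuse_arr (fuse_arr (incl A r) (incl B s)) (incl C t))"
    by (simp only: j prod.case)
qed simp_all

lemma fuse_hexagon2:
  "icomp (fuse_assoc_inv C A B) (icomp (fuse_braid (fuse_obj A B) C) (fuse_assoc_inv A B C)) =
    icomp (fuse_arr (fuse_braid A C) (iide B))
      (icomp (fuse_assoc_inv A C B) (fuse_arr (iide A) (fuse_braid B C)))"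
proof (rule decomposition.source_eqI[OF decomposition_fuse_right[of A B C]])
  fix j assume "j \<in> copies A \<times> copies B \<times> copies C"
  obtain r s t where j: "j = (r, s, t)" by (metis prod.collapse)
  let ?a = "incl A r" and ?b = "incl B s" and ?c = "incl C t"
  let ?A = "simple (fst r)" and ?B = "simple (fst s)" and ?C = "simple (fst t)"
  let ?E = "fuse_arr ?a (fuse_arr ?b ?c)"
  have "icomp (icomp (fuse_assoc_inv C A B) (icomp (fuse_braid (fuse_obj A B) C)
      (fuse_assoc_inv A B C))) ?E =
      icomp (fuse_arr (fuse_arr ?c ?a) ?b)
        (icomp (fuse_assoc_inv ?C ?A ?B) (icomp (fuse_braid (fuse_obj ?A ?B) ?C)
            (fuse_assoc_inv ?A ?B ?C)))"
    by (rule paste3[where ?E1.0 = "fuse_arr (fuse_arr ?a ?b) ?c"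
          and ?E2.0 = "fuse_arr ?c (fuse_arr ?a ?b)"])
      (simp_all add: fuse_assoc_inv_nat fuse_braid_nat)
  also have "\<dots> = icomp (fuse_arr (fuse_arr ?c ?a) ?b) (icomp (fuse_arr (fuse_braid ?A ?C) (iide ?B))
      (icomp (fuse_assoc_inv ?A ?C ?B) (fuse_arr (iide ?A) (fuse_braid ?B ?C))))"
    by (simp only: hexagon2_simple)
  also have "\<dots> = icomp (icomp (fuse_arr (fuse_braid A C) (iide B))
      (icomp (fuse_assoc_inv A C B) (fuse_arr (iide A) (fuse_braid B C)))) ?E"
    by (rule paste3[where ?E1.0 = "fuse_arr ?a (fuse_arr ?c ?b)"
          and ?E2.0 = "fuse_arr (fuse_arr ?a ?c) ?b", symmetric])
      (simp_all add: fuse_assoc_inv_nat fuse_braid_nat)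
  finally show "icomp (icomp (fuse_assoc_inv C A B)
      (icomp (fuse_braid (fuse_obj A B) C) (fuse_assoc_inv A B C)))
      (case j of (r, s, t) \<Rightarrow> fuse_arr (incl A r) (fuse_arr (incl B s) (incl C t))) =
    icomp (icomp (fuse_arr (fuse_braid A C) (iide B))
      (icomp (fuse_assoc_inv A C B) (fuse_arr (iide A) (fuse_braid B C))))
      (case j of (r, s, t) \<Rightarrow> fuse_arr (incl A r) (fuse_arr (incl B s) (incl C t)))"
    by (simp only: j prod.case)
qed simp_all

section \<open>The Ising anyons\<close>

interpretation additive: additive_category idom icod iide icomp izero_arr iadd dsum_obj dsum_arr
    izero
  inj1 inj2 proj1 proj2 dsum_assoc dsum_lunit dsum_runit dsum_braid
proof
  show "idom (dsum_braid A B) = dsum_obj A B" "icod (dsum_braid A B) = dsum_obj B A" for A B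
    by (simp_all add: dsum_braid_def)
  show "idom (dsum_assoc A B C) = dsum_obj (dsum_obj A B) C"
    "icod (dsum_assoc A B C) = dsum_obj A (dsum_obj B C)" for A B C
    by (simp_all add: dsum_assoc_def dsum_obj_assoc)
qed (simp_all add: dsum_assoc_def dsum_lunit_def dsum_runit_def dsum_obj_assoc iide_izero inj_proj
    proj_proj proj_izero dsum_braid_proj)

lemma additive_hom: "additive.hom = ihom"
  by (intro ext) (simp add: additive.hom_def ihom_eq)

lemma in_ihom: "f \<in> ihom A B \<longleftrightarrow> idom f = A \<and> icod f = B"
  by (simp add: ihom_eq)

lemma category_ising: "category ihom iide icomp"
  using additive.category_axioms by (simp add: additive_hom)

lemma fuse_braided: "braided_monoidal_category ihom iide icomp fuse_obj fuse_arr ione fuse_assoc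
    fuse_lunit fuse_runit fuse_braid"
proof -
  interpret category ihom iide icomp by (rule category_ising)
  have iso: "is_iso A B f" if "idom f = A" "icod f = B" "idom g = B" "icod g = A"
    "icomp g f = iide A" "icomp f g = iide B" for f g A B
    unfolding is_iso_def mutually_inverse_def in_ihom using that by blast
  have inv: "inv_arr (fuse_assoc A B C) = fuse_assoc_inv A B C" for A B C
    by (rule inv_arr_eq[of "fuse_obj (fuse_obj A B) C" "fuse_obj A (fuse_obj B C)"])
      (simp add: mutually_inverse_def in_ihom)
  show ?thesis
  proof (unfold_locales, unfold in_ihom)
    show "is_iso (fuse_obj (fuse_obj A B) C) (fuse_obj A (fuse_obj B C))
        (fuse_assoc A B C)" for A B C
      by (rule iso[of _ _ _ "fuse_assoc_inv A B C"]) simp_all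
    show "is_iso (fuse_obj A B) (fuse_obj B A) (fuse_braid A B)" for A B
      by (rule fuse_braid_inverse[of B A]) (rule iso, simp_all)
    show "is_iso (fuse_obj ione A) A (fuse_lunit A)" "is_iso (fuse_obj A ione) A
        (fuse_runit A)" for A
      by (rule iso[of _ _ _ "iide A"]; simp add: fuse_lunit_def fuse_runit_def)+
    show "icomp (inv_arr (fuse_assoc C A B))
        (icomp (fuse_braid (fuse_obj A B) C) (inv_arr (fuse_assoc A B C))) =
      icomp (fuse_arr (fuse_braid A C) (iide B))
        (icomp (inv_arr (fuse_assoc A C B)) (fuse_arr (iide A) (fuse_braid B C)))" for A B C
      unfolding inv by (rule fuse_hexagon2)
  qed (simp_all add: fuse_pentagon fuse_hexagon1 fuse_lunit_def fuse_runit_def fuse_assoc_ione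
      fuse_braid_ione fuse_assoc_nat fuse_braid_nat)
qed

theorem mainTheorem20:
  "tight_braided_bimonoidal_category ihom iide icomp
     dsum_obj dsum_arr izero dsum_assoc dsum_lunit dsum_runit dsum_braid
     fuse_obj fuse_arr ione fuse_assoc fuse_lunit fuse_runit fuse_braid
     fuse_lnull fuse_rnull fuse_ldist fuse_rdist"
proof -
  interpret additive_braided_category idom icod iide icomp izero_arr iadd dsum_obj dsum_arr izero
    inj1 inj2 proj1 proj2 dsum_assoc dsum_lunit dsum_runit dsum_braid
    fuse_obj fuse_arr ione fuse_assoc fuse_lunit fuse_runit fuse_braid
    fuse_lnull fuse_rnull fuse_ldist fuse_rdist
    by (intro additive_braided_category.intro additive.additive_category_axioms
        additive_braided_category_axioms.intro)
      (simp_all add: additive_hom fuse_braided fuse_add fuse_lnull_def fuse_rnull_def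
        fuse_ldist_def fuse_rdist_def)
  show ?thesis
    using tight_braided_bimonoidal by (simp only: additive_hom)
qed

end
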